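(* For any $k$-graph $\Lambda$, any left $\Lambda$-module $\mathcal{N}$ and any right $\Lambda$-module $\mathcal{M}$, there are isomorphisms \[C_*^{\mathrm{cub}}(\Lambda,\mathcal{N})\cong\mathbb{Z}Q_*(\widetilde\Lambda)\otimes_\Lambda\mathcal{N}\qquad\text{and}\qquad C^*_{\mathrm{cub}}(\Lambda,\mathcal{M})\cong\mathrm{Hom}_\Lambda\big(\mathbb{Z}Q_*(\widetilde\Lambda),\mathcal{M}\big)\] of chain complexes and of cochain complexes, respectively.
   Context: $\mathbb{N}$ includes $0$; $e_1,\dots,e_k$ are the canonical generators of $\mathbb{N}^k$. **k-graphs.** A $k$-graph is a countable small category $\Lambda$ with a functor $d\colon\Lambda\to\mathbb{N}^k$ ($\mathbb{N}^k$ a one-object category under addition) with the factorization property: if $d(\lambda)=m+n$ there are unique $\mu,\nu$ with $d(\mu)=m$, $d(\nu)=n$, $\lambda=\mu\nu$. Here $\mu\nu$ is defined iff $s(\mu)=r(\nu)$. $\lambda\in\Lambda$ means $\lambda$ is a morphism; objects are identified with identity morphisms, exactly the morphisms of degree $0$ (vertices). $d_i(\lambda)$ is the $i$-th coordinate of $d(\lambda)$. For $0\le m\le n\le d(\lambda)$, $\lambda(m,n)$ is the unique morphism of degree $n-m$ with $\lambda=\lambda'\lambda(m,n)\lambda''$, $d(\lambda')=m$. **Modules.** A right (left) $\Lambda$-module is a contravariant (covariant) functor from $\Lambda$ to abelian groups; the action is written $m\cdot\lambda$, $m\in\mathcal{M}(r(\lambda))$ (resp. $\lambda\cdot a$, $a\in\mathcal{N}(s(\lambda))$).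 Module maps are natural transformations and form the group $\mathrm{Hom}_\Lambda$. $\mathcal{M}\otimes_\Lambda\mathcal{N}$ is the abelian group generated by $m\otimes a$ with $m\in\mathcal{M}(v)$, $a\in\mathcal{N}(v)$, $v$ an object, subject to biadditivity and $(m\cdot\lambda)\otimes a=m\otimes(\lambda\cdot a)$. **Cubes.** For a $k$-graph $\Gamma$ with degree $d$, $Q_n(\Gamma)=\{\eta\in\Gamma:\sum_id_i(\eta)=n,\ d_i(\eta)\in\{0,1\}\ \forall i\}$ for $n\ge0$ and $Q_n(\Gamma)=\varnothing$ for $n<0$. For $\lambda\in Q_n(\Gamma)$ with $d(\lambda)=\sum_{j=1}^ne_{c_j}$, $c_1<\dots<c_n$: $F^0_j(\lambda)=\lambda(0,d(\lambda)-e_{c_j})$, $F^1_j(\lambda)=\lambda(e_{c_j},d(\lambda))$, $S_j(\lambda)=\lambda(d(\lambda)-e_{c_j},d(\lambda))$. $\mathbb{Z}Q_n(\Gamma)$ is the free abelian group on $Q_n(\Gamma)$ with $\partial_n(\lambda)=\sum_{j=1}^n\sum_{l=0}^1(-1)^{j+l}F^l_j(\lambda)$ for $n\ge1$ (so no augmentation term in degree $-1$). **The complex $\mathbb{Z}Q_*(\widetilde\Lambda)$.** For a vertex $v$ of $\Lambda$, $\widetilde\Lambda(v)$ is the $k$-graph whose objects are the morphisms of $\Lambda$ with source $v$ and whose morphisms are the composable pairs $(\eta,\mu)$ with $s(\mu)=v$; $(\eta,\mu)$ has source $\mu$, range $\eta\mu$, degree $d(\eta)$. $\mathbb{Z}Q_n(\widetilde\Lambda)$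 is the right $\Lambda$-module $v\mapsto\mathbb{Z}Q_n(\widetilde\Lambda(v))$ with action $(\eta,\mu)\cdot\lambda=(\eta,\mu\lambda)$; with $\partial_n$ objectwise these form a chain complex of right $\Lambda$-modules. $\mathrm{Hom}_\Lambda(\mathbb{Z}Q_*(\widetilde\Lambda),\mathcal{M})$ has coboundaries $f\mapsto f\circ\partial_{n+1}$ and $\mathbb{Z}Q_*(\widetilde\Lambda)\otimes_\Lambda\mathcal{N}$ has boundaries $\partial_n\otimes\mathrm{id}$. **Cubical (co-)chains with coefficients.** $C_n^{\mathrm{cub}}(\Lambda,\mathcal{N})=\bigoplus_{\lambda\in Q_n(\Lambda)}\mathcal{N}(s(\lambda))$, generated by pairs $(\lambda,a)$, with boundary $(\lambda,a)\mapsto\sum_{i=1}^n(-1)^i\big((F_i^0(\lambda),S_i(\lambda)\cdot a)-(F_i^1(\lambda),a)\big)$; $C^n_{\mathrm{cub}}(\Lambda,\mathcal{M})=\prod_{\lambda\in Q_n(\Lambda)}\mathcal{M}(s(\lambda))$ with $\delta_{n-1}(f)(\lambda)=\sum_{i=1}^n(-1)^i\big(f(F_i^0(\lambda))\cdot S_i(\lambda)-f(F_i^1(\lambda))\big)$. *)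

theory Defs
  imports
    "HOL-Algebra.Free_Abelian_Groups"
    "HOL-Library.Countable_Set"
    "HOL-Library.Function_Algebras"
begin

section \<open>k-graphs\<close>

text \<open>
  Small categories are arrows-only: objects are identified with their identity morphisms, so
  source and range are maps from morphisms to morphisms. The value of \<open>cmp\<close> on
  \<open>\<mu>\<close>, \<open>\<nu>\<close> is meaningful only if the source of \<open>\<mu>\<close> is the range of \<open>\<nu>\<close>.
  Elements of \<open>\<nat>\<^sup>k\<close> are functions \<open>nat \<Rightarrow> nat\<close> supported in \<open>{1..k}\<close>, with the
  pointwise sum, difference and order.
\<close>

record 'a kgraph =
  mor :: "'a set"
  src :: "'a \<Rightarrow> 'a"
  rng :: "'a \<Rightarrow> 'a"
  cmp :: "'a \<Rightarrow> 'a \<Rightarrow> 'a"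
  deg :: "'a \<Rightarrow> nat \<Rightarrow> nat"

definition composable :: "'a kgraph \<Rightarrow> 'a \<Rightarrow> 'a \<Rightarrow> bool" where
  "composable \<Lambda> \<mu> \<nu> \<longleftrightarrow> \<mu> \<in> mor \<Lambda> \<and> \<nu> \<in> mor \<Lambda> \<and> src \<Lambda> \<mu> = rng \<Lambda> \<nu>"

definition obj :: "'a kgraph \<Rightarrow> 'a set" where
  "obj \<Lambda> = {v \<in> mor \<Lambda>. src \<Lambda> v = v}"

locale k_graph =
  fixes k :: nat and \<Lambda> :: "'a kgraph"
  assumes countable_mor: "countable (mor \<Lambda>)"
    and src_obj: "\<xi> \<in> mor \<Lambda> \<Longrightarrow> src \<Lambda> \<xi> \<in> obj \<Lambda>"
    and rng_obj: "\<xi> \<in> mor \<Lambda> \<Longrightarrow> rng \<Lambda> \<xi> \<in> obj \<Lambda>"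
    and rng_of_obj: "v \<in> obj \<Lambda> \<Longrightarrow> rng \<Lambda> v = v"
    and cmp_mor: "composable \<Lambda> \<mu> \<nu> \<Longrightarrow> cmp \<Lambda> \<mu> \<nu> \<in> mor \<Lambda>"
    and src_cmp: "composable \<Lambda> \<mu> \<nu> \<Longrightarrow> src \<Lambda> (cmp \<Lambda> \<mu> \<nu>) = src \<Lambda> \<nu>"
    and rng_cmp: "composable \<Lambda> \<mu> \<nu> \<Longrightarrow> rng \<Lambda> (cmp \<Lambda> \<mu> \<nu>) = rng \<Lambda> \<mu>"
    and cmp_assoc: "composable \<Lambda> \<xi> \<mu> \<Longrightarrow> composable \<Lambda> \<mu> \<nu> \<Longrightarrow>
          cmp \<Lambda> (cmp \<Lambda> \<xi> \<mu>) \<nu> = cmp \<Lambda> \<xi> (cmp \<Lambda> \<mu> \<nu>)"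
    and cmp_src: "\<xi> \<in> mor \<Lambda> \<Longrightarrow> cmp \<Lambda> \<xi> (src \<Lambda> \<xi>) = \<xi>"
    and cmp_rng: "\<xi> \<in> mor \<Lambda> \<Longrightarrow> cmp \<Lambda> (rng \<Lambda> \<xi>) \<xi> = \<xi>"
    and deg_supp: "\<xi> \<in> mor \<Lambda> \<Longrightarrow> i \<notin> {1..k} \<Longrightarrow> deg \<Lambda> \<xi> i = 0"
    and deg_obj: "v \<in> obj \<Lambda> \<Longrightarrow> deg \<Lambda> v = 0"
    and deg_cmp: "composable \<Lambda> \<mu> \<nu> \<Longrightarrow> deg \<Lambda> (cmp \<Lambda> \<mu> \<nu>) = deg \<Lambda> \<mu> + deg \<Lambda> \<nu>"
    and factorization: "\<xi> \<in> mor \<Lambda> \<Longrightarrow> deg \<Lambda> \<xi> = m + n \<Longrightarrow>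
          \<exists>!p. composable \<Lambda> (fst p) (snd p) \<and> deg \<Lambda> (fst p) = m \<and> deg \<Lambda> (snd p) = n
             \<and> \<xi> = cmp \<Lambda> (fst p) (snd p)"

definition segment :: "'a kgraph \<Rightarrow> 'a \<Rightarrow> (nat \<Rightarrow> nat) \<Rightarrow> (nat \<Rightarrow> nat) \<Rightarrow> 'a" where
  "segment \<Lambda> \<xi> m n = (THE \<mu>. deg \<Lambda> \<mu> = n - m \<and>
     (\<exists>\<xi>' \<xi>''. composable \<Lambda> \<xi>' \<mu> \<and> composable \<Lambda> \<mu> \<xi>'' \<and>
        \<xi> = cmp \<Lambda> \<xi>' (cmp \<Lambda> \<mu> \<xi>'') \<and> deg \<Lambda> \<xi>' = m))"


section \<open>Modules\<close>

text \<open>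
  The abelian groups \<open>fib M v\<close> are written multiplicatively, as usual in HOL-Algebra.
  For a right module, \<open>act M \<xi> m\<close> is \<open>m \<cdot> \<xi>\<close>; for a left module it is
  \<open>\<xi> \<cdot> m\<close>.
\<close>

record ('a, 'm) gmodule =
  fib :: "'a \<Rightarrow> 'm monoid"
  act :: "'a \<Rightarrow> 'm \<Rightarrow> 'm"

definition right_module :: "'a kgraph \<Rightarrow> ('a, 'm) gmodule \<Rightarrow> bool" where
  "right_module \<Lambda> M \<longleftrightarrow>
     (\<forall>v\<in>obj \<Lambda>. comm_group (fib M v)) \<and>
     (\<forall>\<xi>\<in>mor \<Lambda>. act M \<xi> \<in> hom (fib M (rng \<Lambda> \<xi>)) (fib M (src \<Lambda> \<xi>))) \<and>
     (\<forall>v\<in>obj \<Lambda>. \<forall>x\<in>carrier (fib M v). act M v x = x) \<and>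
     (\<forall>\<mu> \<nu>. composable \<Lambda> \<mu> \<nu> \<longrightarrow>
        (\<forall>x\<in>carrier (fib M (rng \<Lambda> \<mu>)). act M (cmp \<Lambda> \<mu> \<nu>) x = act M \<nu> (act M \<mu> x)))"

definition left_module :: "'a kgraph \<Rightarrow> ('a, 'm) gmodule \<Rightarrow> bool" where
  "left_module \<Lambda> N \<longleftrightarrow>
     (\<forall>v\<in>obj \<Lambda>. comm_group (fib N v)) \<and>
     (\<forall>\<xi>\<in>mor \<Lambda>. act N \<xi> \<in> hom (fib N (src \<Lambda> \<xi>)) (fib N (rng \<Lambda> \<xi>))) \<and>
     (\<forall>v\<in>obj \<Lambda>. \<forall>x\<in>carrier (fib N v). act N v x = x) \<and>
     (\<forall>\<mu> \<nu>. composable \<Lambda> \<mu> \<nu> \<longrightarrow>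
        (\<forall>x\<in>carrier (fib N (src \<Lambda> \<nu>)). act N (cmp \<Lambda> \<mu> \<nu>) x = act N \<mu> (act N \<nu> x)))"

text \<open>
  Natural transformations between right modules. Extensionality makes two of them equal
  as soon as they agree on all elements of all \<open>fib M v\<close>.
\<close>

definition right_Hom :: "'a kgraph \<Rightarrow> ('a, 'm) gmodule \<Rightarrow> ('a, 'n) gmodule \<Rightarrow> ('a \<Rightarrow> 'm \<Rightarrow> 'n) monoid" where
  "right_Hom \<Lambda> M N =
     \<lparr> carrier = {f \<in> (\<Pi>\<^sub>E v\<in>obj \<Lambda>. hom (fib M v) (fib N v) \<inter> extensional (carrier (fib M v))).
         \<forall>\<xi>\<in>mor \<Lambda>. \<forall>x\<in>carrier (fib M (rng \<Lambda> \<xi>)).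
           f (src \<Lambda> \<xi>) (act M \<xi> x) = act N \<xi> (f (rng \<Lambda> \<xi>) x)},
       monoid.mult = (\<lambda>f g. \<lambda>v\<in>obj \<Lambda>. \<lambda>x\<in>carrier (fib M v). f v x \<otimes>\<^bsub>fib N v\<^esub> g v x),
       one = (\<lambda>v\<in>obj \<Lambda>. \<lambda>x\<in>carrier (fib M v). \<one>\<^bsub>fib N v\<^esub>) \<rparr>"

text \<open>The map \<open>f \<mapsto> f \<circ> \<phi>\<close> induced by a module map \<open>\<phi>\<close> with domain \<open>M\<close>.\<close>

definition Hom_precomp :: "'a kgraph \<Rightarrow> ('a, 'm) gmodule \<Rightarrow> ('a \<Rightarrow> 'm \<Rightarrow> 'l) \<Rightarrow> ('a \<Rightarrow> 'l \<Rightarrow> 'n)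
    \<Rightarrow> ('a \<Rightarrow> 'm \<Rightarrow> 'n)" where
  "Hom_precomp \<Lambda> M \<phi> f = (\<lambda>v\<in>obj \<Lambda>. \<lambda>x\<in>carrier (fib M v). f v (\<phi> v x))"

text \<open>
  The tensor product, by generators and relations. A generator \<open>m \<otimes> a\<close> is a triple
  \<open>(v, m, a)\<close>, because the carriers of the groups at different objects may overlap.
\<close>

definition tensor_gens :: "'a kgraph \<Rightarrow> ('a, 'm) gmodule \<Rightarrow> ('a, 'n) gmodule \<Rightarrow> ('a \<times> 'm \<times> 'n) set" where
  "tensor_gens \<Lambda> M N = (SIGMA v:obj \<Lambda>. carrier (fib M v) \<times> carrier (fib N v))"

definition tensor_rels :: "'a kgraph \<Rightarrow> ('a, 'm) gmodule \<Rightarrow> ('a, 'n) gmodule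
    \<Rightarrow> (('a \<times> 'm \<times> 'n) \<Rightarrow>\<^sub>0 int) set" where
  "tensor_rels \<Lambda> M N =
     {frag_of (v, m \<otimes>\<^bsub>fib M v\<^esub> m', a) - (frag_of (v, m, a) + frag_of (v, m', a)) | v m m' a.
        v \<in> obj \<Lambda> \<and> m \<in> carrier (fib M v) \<and> m' \<in> carrier (fib M v) \<and> a \<in> carrier (fib N v)} \<union>
     {frag_of (v, m, a \<otimes>\<^bsub>fib N v\<^esub> a') - (frag_of (v, m, a) + frag_of (v, m, a')) | v m a a'.
        v \<in> obj \<Lambda> \<and> m \<in> carrier (fib M v) \<and> a \<in> carrier (fib N v) \<and> a' \<in> carrier (fib N v)} \<union>
     {frag_of (src \<Lambda> \<xi>, act M \<xi> m, a) - frag_of (rng \<Lambda> \<xi>, m, act N \<xi> a) | \<xi> m a.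
        \<xi> \<in> mor \<Lambda> \<and> m \<in> carrier (fib M (rng \<Lambda> \<xi>)) \<and> a \<in> carrier (fib N (src \<Lambda> \<xi>))}"

definition tensor_kernel :: "'a kgraph \<Rightarrow> ('a, 'm) gmodule \<Rightarrow> ('a, 'n) gmodule
    \<Rightarrow> (('a \<times> 'm \<times> 'n) \<Rightarrow>\<^sub>0 int) set" where
  "tensor_kernel \<Lambda> M N = generate (free_Abelian_group (tensor_gens \<Lambda> M N)) (tensor_rels \<Lambda> M N)"

definition tensor :: "'a kgraph \<Rightarrow> ('a, 'm) gmodule \<Rightarrow> ('a, 'n) gmodule
    \<Rightarrow> (('a \<times> 'm \<times> 'n) \<Rightarrow>\<^sub>0 int) set monoid" where
  "tensor \<Lambda> M N = free_Abelian_group (tensor_gens \<Lambda> M N) Mod tensor_kernel \<Lambda> M N"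

text \<open>
  The map \<open>\<phi> \<otimes> id\<close> induced by a module map \<open>\<phi>\<close> from \<open>M\<close> to \<open>M'\<close>:
  the class of \<open>x\<close> is sent to the class of the image of \<open>x\<close>.
\<close>

definition tensor_map :: "'a kgraph \<Rightarrow> ('a, 'm) gmodule \<Rightarrow> ('a, 'l) gmodule \<Rightarrow> ('a, 'n) gmodule
    \<Rightarrow> ('a \<Rightarrow> 'm \<Rightarrow> 'l) \<Rightarrow> (('a \<times> 'm \<times> 'n) \<Rightarrow>\<^sub>0 int) set \<Rightarrow> (('a \<times> 'l \<times> 'n) \<Rightarrow>\<^sub>0 int) set" where
  "tensor_map \<Lambda> M M' N \<phi> X =
     the_elem ((\<lambda>x. tensor_kernel \<Lambda> M' N #>\<^bsub>free_Abelian_group (tensor_gens \<Lambda> M' N)\<^esub>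
        frag_extend (\<lambda>(v, m, a). frag_of (v, \<phi> v m, a)) x) ` X)"


section \<open>Cubes\<close>

definition cubes :: "nat \<Rightarrow> 'a kgraph \<Rightarrow> int \<Rightarrow> 'a set" where
  "cubes k \<Gamma> n = {\<eta> \<in> mor \<Gamma>. int (\<Sum>i\<in>{1..k}. deg \<Gamma> \<eta> i) = n \<and> (\<forall>i\<in>{1..k}. deg \<Gamma> \<eta> i \<in> {0, 1})}"

definition unit_deg :: "nat \<Rightarrow> nat \<Rightarrow> nat" where
  "unit_deg i = (\<lambda>j. if j = i then 1 else 0)"

text \<open>
  \<open>cube_dir \<Gamma> \<xi> j\<close> is \<open>c\<^sub>j\<close>, where the degree of \<open>\<xi>\<close> is the sum of the unit
  vectors in the directions \<open>c\<^sub>1 < \<dots> < c\<^sub>n\<close>.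
\<close>

definition cube_dir :: "'a kgraph \<Rightarrow> 'a \<Rightarrow> nat \<Rightarrow> nat" where
  "cube_dir \<Gamma> \<xi> j = sorted_list_of_set {i. deg \<Gamma> \<xi> i = 1} ! (j - 1)"

definition face0 :: "'a kgraph \<Rightarrow> nat \<Rightarrow> 'a \<Rightarrow> 'a" where
  "face0 \<Gamma> j \<xi> = segment \<Gamma> \<xi> 0 (deg \<Gamma> \<xi> - unit_deg (cube_dir \<Gamma> \<xi> j))"

definition face1 :: "'a kgraph \<Rightarrow> nat \<Rightarrow> 'a \<Rightarrow> 'a" where
  "face1 \<Gamma> j \<xi> = segment \<Gamma> \<xi> (unit_deg (cube_dir \<Gamma> \<xi> j)) (deg \<Gamma> \<xi>)"

definition last_edge :: "'a kgraph \<Rightarrow> nat \<Rightarrow> 'a \<Rightarrow> 'a" where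
  "last_edge \<Gamma> j \<xi> = segment \<Gamma> \<xi> (deg \<Gamma> \<xi> - unit_deg (cube_dir \<Gamma> \<xi> j)) (deg \<Gamma> \<xi>)"

definition face :: "'a kgraph \<Rightarrow> nat \<Rightarrow> nat \<Rightarrow> 'a \<Rightarrow> 'a" where
  "face \<Gamma> l = (if l = 0 then face0 \<Gamma> else face1 \<Gamma>)"

text \<open>For \<open>n \<le> 0\<close> the sum is empty and the boundary is the zero map.\<close>

definition cube_boundary :: "'a kgraph \<Rightarrow> int \<Rightarrow> ('a \<Rightarrow>\<^sub>0 int) \<Rightarrow> ('a \<Rightarrow>\<^sub>0 int)" where
  "cube_boundary \<Gamma> n =
     frag_extend (\<lambda>\<xi>. \<Sum>j\<in>{1..nat n}. \<Sum>l\<in>{0..1}. frag_cmul ((-1) ^ (j + l)) (frag_of (face \<Gamma> l j \<xi>)))"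


section \<open>The complex of right modules\<close>

text \<open>
  The object \<open>\<mu>\<close> of \<open>tilde_graph \<Lambda> v\<close> is represented by its identity morphism
  \<open>(rng \<Lambda> \<mu>, \<mu>)\<close>.
\<close>

definition tilde_graph :: "'a kgraph \<Rightarrow> 'a \<Rightarrow> ('a \<times> 'a) kgraph" where
  "tilde_graph \<Lambda> v =
     \<lparr> mor = {(\<eta>, \<mu>). composable \<Lambda> \<eta> \<mu> \<and> src \<Lambda> \<mu> = v},
       src = (\<lambda>(\<eta>, \<mu>). (rng \<Lambda> \<mu>, \<mu>)),
       rng = (\<lambda>(\<eta>, \<mu>). (rng \<Lambda> \<eta>, cmp \<Lambda> \<eta> \<mu>)),
       cmp = (\<lambda>(\<zeta>, \<nu>) (\<eta>, \<mu>). (cmp \<Lambda> \<zeta> \<eta>, \<mu>)),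
       deg = (\<lambda>(\<eta>, \<mu>). deg \<Lambda> \<eta>) \<rparr>"

lemma (in k_graph) k_graph_tilde_graph:
  assumes "v \<in> obj \<Lambda>"
  shows "k_graph k (tilde_graph \<Lambda> v)"
proof -
  let ?G = "tilde_graph \<Lambda> v"
  have mor: "p \<in> mor ?G \<longleftrightarrow> composable \<Lambda> (fst p) (snd p) \<and> src \<Lambda> (snd p) = v" for p
    by (auto simp: tilde_graph_def split: prod.splits)
  have G [simp]: "src ?G p = (rng \<Lambda> (snd p), snd p)" "rng ?G p = (rng \<Lambda> (fst p), cmp \<Lambda> (fst p) (snd p))"
    "cmp ?G p q = (cmp \<Lambda> (fst p) (fst q), snd q)" "deg ?G p = deg \<Lambda> (fst p)" for p q
    by (simp_all add: tilde_graph_def split: prod.splits)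
  have comp: "composable ?G p q \<longleftrightarrow>
      composable \<Lambda> (fst p) (fst q) \<and> composable \<Lambda> (fst q) (snd q)
      \<and> src \<Lambda> (snd q) = v \<and> snd p = cmp \<Lambda> (fst q) (snd q)" (is "?L \<longleftrightarrow> ?R") for p q
  proof
    assume ?L
    then have "composable \<Lambda> (fst p) (snd p)" "composable \<Lambda> (fst q) (snd q)" "src \<Lambda> (snd q) = v"
      "rng \<Lambda> (snd p) = rng \<Lambda> (fst q)" "snd p = cmp \<Lambda> (fst q) (snd q)"
      by (auto simp only: composable_def[of ?G] mor G prod.inject)
    then show ?R by (simp add: composable_def)
  next
    assume r: ?R
    then have c: "composable \<Lambda> (fst q) (snd q)" by simp
    from r cmp_mor[OF c] rng_cmp[OF c] src_cmp[OF c] have "composable \<Lambda> (fst p) (snd p)"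
      by (simp add: composable_def)
    with r src_cmp[OF c] rng_cmp[OF c] show ?L
      by (simp add: composable_def[of ?G] mor)
  qed
  have objI: "x \<in> obj \<Lambda> \<longleftrightarrow> x \<in> mor \<Lambda> \<and> src \<Lambda> x = x" for x by (auto simp: obj_def)
  have obj: "p \<in> obj ?G \<longleftrightarrow> snd p \<in> mor \<Lambda> \<and> src \<Lambda> (snd p) = v \<and> fst p = rng \<Lambda> (snd p)" for p
    using rng_obj[of "snd p"] by (cases p) (auto simp: obj_def mor composable_def)
  show ?thesis
  proof
    have "mor ?G \<subseteq> mor \<Lambda> \<times> mor \<Lambda>" by (auto simp: mor composable_def)
    then show "countable (mor ?G)"
      by (rule countable_subset) (simp add: countable_mor)
  next
    fix p assume p: "p \<in> mor ?G"
    show "src ?G p \<in> obj ?G" using p by (auto simp: obj mor composable_def)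
    show "rng ?G p \<in> obj ?G" using p cmp_mor rng_cmp src_cmp by (auto simp: obj mor)
    show "cmp ?G p (src ?G p) = p" using p cmp_src[of "fst p"]
      by (cases p) (auto simp: mor composable_def)
    show "cmp ?G (rng ?G p) p = p" using p cmp_rng[of "fst p"]
      by (cases p) (auto simp: mor composable_def)
    show "deg ?G p i = 0" if "i \<notin> {1..k}" for i
      using that deg_supp[of "fst p" i] p by (auto simp: mor composable_def)
  next
    fix p assume p: "p \<in> obj ?G"
    show "rng ?G p = p" using p cmp_rng[of "snd p"] rng_obj[of "snd p"] rng_of_obj
      by (cases p) (auto simp: obj)
    show "deg ?G p = 0" using p rng_obj[of "snd p"] deg_obj by (auto simp: obj)
  next
    fix p q assume pq: "composable ?G p q"
    then have c: "composable \<Lambda> (fst p) (fst q)" "composable \<Lambda> (fst q) (snd q)"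
      "src \<Lambda> (snd q) = v" "snd p = cmp \<Lambda> (fst q) (snd q)" by (auto simp: comp)
    show "cmp ?G p q \<in> mor ?G"
      using c cmp_mor[OF c(1)] src_cmp[OF c(1)] by (auto simp: mor composable_def)
    show "src ?G (cmp ?G p q) = src ?G q" by simp
    show "rng ?G (cmp ?G p q) = rng ?G p" using c rng_cmp cmp_assoc by simp
    show "deg ?G (cmp ?G p q) = deg ?G p + deg ?G q" using c deg_cmp by simp
    show "cmp ?G (cmp ?G o' p) q = cmp ?G o' (cmp ?G p q)" if "composable ?G o' p" for o'
      using that c cmp_assoc by (auto simp: comp)
  next
    fix p m n assume p: "p \<in> mor ?G" and d: "deg ?G p = m + n"
    obtain \<eta> \<mu> where e: "p = (\<eta>, \<mu>)" by (cases p)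
    from p e have c: "composable \<Lambda> \<eta> \<mu>" "src \<Lambda> \<mu> = v" by (auto simp: mor)
    then have eta: "\<eta> \<in> mor \<Lambda>" by (simp add: composable_def)
    obtain x y where xy: "composable \<Lambda> x y" "deg \<Lambda> x = m" "deg \<Lambda> y = n" "\<eta> = cmp \<Lambda> x y"
      and uniq: "\<And>x' y'. composable \<Lambda> x' y' \<Longrightarrow> deg \<Lambda> x' = m \<Longrightarrow> deg \<Lambda> y' = n
          \<Longrightarrow> \<eta> = cmp \<Lambda> x' y' \<Longrightarrow> x' = x \<and> y' = y"
    proof -
      have "\<exists>!q. composable \<Lambda> (fst q) (snd q) \<and> deg \<Lambda> (fst q) = m \<and> deg \<Lambda> (snd q) = n
          \<and> \<eta> = cmp \<Lambda> (fst q) (snd q)" (is "\<exists>!q. ?P q")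
        using factorization[OF eta, of m n] d e by simp
      then obtain q where q: "?P q" and un: "\<And>q'. ?P q' \<Longrightarrow> q' = q" by blast
      show thesis
      proof (rule that)
        show "x' = fst q \<and> y' = snd q"
          if "composable \<Lambda> x' y'" "deg \<Lambda> x' = m" "deg \<Lambda> y' = n" "\<eta> = cmp \<Lambda> x' y'" for x' y'
          using un[of "(x', y')"] that by auto
      qed (use q in auto)
    qed
    have ym: "composable \<Lambda> y \<mu>" using c xy src_cmp[OF xy(1)] by (simp add: composable_def)
    show "\<exists>!q. composable ?G (fst q) (snd q) \<and> deg ?G (fst q) = m \<and> deg ?G (snd q) = n
             \<and> p = cmp ?G (fst q) (snd q)"
    proof (rule ex1I[of _ "((x, cmp \<Lambda> y \<mu>), (y, \<mu>))"])
      show "composable ?G (fst ((x, cmp \<Lambda> y \<mu>), (y, \<mu>))) (snd ((x, cmp \<Lambda> y \<mu>), (y, \<mu>))) \<and>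
        deg ?G (fst ((x, cmp \<Lambda> y \<mu>), (y, \<mu>))) = m \<and> deg ?G (snd ((x, cmp \<Lambda> y \<mu>), (y, \<mu>))) = n \<and>
        p = cmp ?G (fst ((x, cmp \<Lambda> y \<mu>), (y, \<mu>))) (snd ((x, cmp \<Lambda> y \<mu>), (y, \<mu>)))"
        using xy ym c e by (simp add: comp)
    next
      fix q assume q: "composable ?G (fst q) (snd q) \<and> deg ?G (fst q) = m \<and> deg ?G (snd q) = n
             \<and> p = cmp ?G (fst q) (snd q)"
      then show "q = ((x, cmp \<Lambda> y \<mu>), (y, \<mu>))"
        using uniq[of "fst (fst q)" "fst (snd q)"] e by (cases q) (auto simp: comp prod_eq_iff)
    qed
  qed
qed

definition ZQ :: "nat \<Rightarrow> 'a kgraph \<Rightarrow> int \<Rightarrow> ('a, ('a \<times> 'a) \<Rightarrow>\<^sub>0 int) gmodule" where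
  "ZQ k \<Lambda> n =
     \<lparr> fib = (\<lambda>v. free_Abelian_group (cubes k (tilde_graph \<Lambda> v) n)),
       act = (\<lambda>\<xi>. frag_extend (\<lambda>(\<eta>, \<mu>). frag_of (\<eta>, cmp \<Lambda> \<mu> \<xi>))) \<rparr>"

lemma (in k_graph) right_module_ZQ: "right_module \<Lambda> (ZQ k \<Lambda> n)"
proof -
  have G: "\<And>p v. p \<in> mor (tilde_graph \<Lambda> v) \<longleftrightarrow> composable \<Lambda> (fst p) (snd p) \<and> src \<Lambda> (snd p) = v"
    "\<And>p v. deg (tilde_graph \<Lambda> v) p = deg \<Lambda> (fst p)"
    by (auto simp: tilde_graph_def split: prod.splits)
  have keys: "Poly_Mapping.keys (act (ZQ k \<Lambda> n) \<xi> x) \<subseteq> cubes k (tilde_graph \<Lambda> (src \<Lambda> \<xi>)) n"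
    if xi: "\<xi> \<in> mor \<Lambda>" and x: "Poly_Mapping.keys x \<subseteq> cubes k (tilde_graph \<Lambda> (rng \<Lambda> \<xi>)) n" for \<xi> x
  proof -
    have "(\<eta>, cmp \<Lambda> \<mu> \<xi>) \<in> cubes k (tilde_graph \<Lambda> (src \<Lambda> \<xi>)) n"
      if "(\<eta>, \<mu>) \<in> Poly_Mapping.keys x" for \<eta> \<mu>
    proof -
      have "(\<eta>, \<mu>) \<in> cubes k (tilde_graph \<Lambda> (rng \<Lambda> \<xi>)) n" using x that by blast
      then have c: "composable \<Lambda> \<eta> \<mu>" "composable \<Lambda> \<mu> \<xi>" and
        d: "int (\<Sum>i\<in>{1..k}. deg \<Lambda> \<eta> i) = n \<and> (\<forall>i\<in>{1..k}. deg \<Lambda> \<eta> i \<in> {0, 1})"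
        using xi by (auto simp: cubes_def G composable_def)
      have "composable \<Lambda> \<eta> (cmp \<Lambda> \<mu> \<xi>)"
        using c cmp_mor[OF c(2)] rng_cmp[OF c(2)] by (simp add: composable_def)
      with d src_cmp[OF c(2)] show ?thesis by (simp add: cubes_def G)
    qed
    then show ?thesis
      using keys_frag_extend[of "\<lambda>(\<eta>, \<mu>). frag_of (\<eta>, cmp \<Lambda> \<mu> \<xi>)" x]
      by (fastforce simp: ZQ_def)
  qed
  have act: "act (ZQ k \<Lambda> n) \<xi> = frag_extend (\<lambda>p. frag_of (fst p, cmp \<Lambda> (snd p) \<xi>))" for \<xi>
    by (simp add: ZQ_def case_prod_beta')
  have idn: "frag_extend frag_of x = x" for x :: "('a \<times> 'a) \<Rightarrow>\<^sub>0 int"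
    using frag_expansion[of x] by simp
  have c1: "act (ZQ k \<Lambda> n) v x = x"
    if "v \<in> obj \<Lambda>" and x: "Poly_Mapping.keys x \<subseteq> cubes k (tilde_graph \<Lambda> v) n" for v x
  proof -
    have "act (ZQ k \<Lambda> n) v x = frag_extend frag_of x" unfolding act
    proof (rule frag_extend_eq)
      fix p assume "p \<in> Poly_Mapping.keys x"
      with x have "p \<in> cubes k (tilde_graph \<Lambda> v) n" by blast
      then have "snd p \<in> mor \<Lambda>" "src \<Lambda> (snd p) = v" by (simp_all add: cubes_def G composable_def)
      then show "frag_of (fst p, cmp \<Lambda> (snd p) v) = frag_of p"
        using cmp_src[of "snd p"] by simp
    qed
    then show ?thesis by (simp add: idn)
  qed
  have c2: "act (ZQ k \<Lambda> n) (cmp \<Lambda> \<mu> \<nu>) x = act (ZQ k \<Lambda> n) \<nu> (act (ZQ k \<Lambda> n) \<mu> x)"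
    if mn: "composable \<Lambda> \<mu> \<nu>" and x: "Poly_Mapping.keys x \<subseteq> cubes k (tilde_graph \<Lambda> (rng \<Lambda> \<mu>)) n" for \<mu> \<nu> x
  proof -
    have "act (ZQ k \<Lambda> n) \<nu> (act (ZQ k \<Lambda> n) \<mu> x)
        = frag_extend (\<lambda>p. frag_of (fst p, cmp \<Lambda> (cmp \<Lambda> (snd p) \<mu>) \<nu>)) x"
      unfolding act 
      using frag_extend_compose[of "\<lambda>p. frag_of (fst p, cmp \<Lambda> (snd p) \<nu>)"
          "\<lambda>p. (fst p, cmp \<Lambda> (snd p) \<mu>)" x] by (simp add: o_def)
    also have "\<dots> = act (ZQ k \<Lambda> n) (cmp \<Lambda> \<mu> \<nu>) x" unfolding act
    proof (rule frag_extend_eq)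
      fix p assume "p \<in> Poly_Mapping.keys x"
      with x have "p \<in> cubes k (tilde_graph \<Lambda> (rng \<Lambda> \<mu>)) n" by blast
      then have "composable \<Lambda> (snd p) \<mu>" using mn by (auto simp: cubes_def G composable_def)
      then show "frag_of (fst p, cmp \<Lambda> (cmp \<Lambda> (snd p) \<mu>) \<nu>) = frag_of (fst p, cmp \<Lambda> (snd p) (cmp \<Lambda> \<mu> \<nu>))"
        using mn cmp_assoc by simp
    qed
    finally show ?thesis by simp
  qed
  have fib: "fib (ZQ k \<Lambda> n) v = free_Abelian_group (cubes k (tilde_graph \<Lambda> v) n)" for v
    by (simp add: ZQ_def)
  show ?thesis
    unfolding right_module_def fib using keys c1 c2
    by (auto simp: abelian_free_Abelian_group hom_def act frag_extend_add)
qed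

definition ZQ_boundary :: "'a kgraph \<Rightarrow> int \<Rightarrow> 'a \<Rightarrow> (('a \<times> 'a) \<Rightarrow>\<^sub>0 int) \<Rightarrow> (('a \<times> 'a) \<Rightarrow>\<^sub>0 int)" where
  "ZQ_boundary \<Lambda> n v = cube_boundary (tilde_graph \<Lambda> v) n"

definition ZQ_tensor :: "nat \<Rightarrow> 'a kgraph \<Rightarrow> ('a, 'n) gmodule \<Rightarrow> int
    \<Rightarrow> (('a \<times> (('a \<times> 'a) \<Rightarrow>\<^sub>0 int) \<times> 'n) \<Rightarrow>\<^sub>0 int) set monoid" where
  "ZQ_tensor k \<Lambda> N n = tensor \<Lambda> (ZQ k \<Lambda> n) N"

definition ZQ_tensor_boundary :: "nat \<Rightarrow> 'a kgraph \<Rightarrow> ('a, 'n) gmodule \<Rightarrow> int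
    \<Rightarrow> (('a \<times> (('a \<times> 'a) \<Rightarrow>\<^sub>0 int) \<times> 'n) \<Rightarrow>\<^sub>0 int) set
    \<Rightarrow> (('a \<times> (('a \<times> 'a) \<Rightarrow>\<^sub>0 int) \<times> 'n) \<Rightarrow>\<^sub>0 int) set" where
  "ZQ_tensor_boundary k \<Lambda> N n = tensor_map \<Lambda> (ZQ k \<Lambda> n) (ZQ k \<Lambda> (n - 1)) N (ZQ_boundary \<Lambda> n)"

definition ZQ_Hom :: "nat \<Rightarrow> 'a kgraph \<Rightarrow> ('a, 'm) gmodule \<Rightarrow> int
    \<Rightarrow> ('a \<Rightarrow> (('a \<times> 'a) \<Rightarrow>\<^sub>0 int) \<Rightarrow> 'm) monoid" where
  "ZQ_Hom k \<Lambda> M n = right_Hom \<Lambda> (ZQ k \<Lambda> n) M"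

definition ZQ_Hom_coboundary :: "nat \<Rightarrow> 'a kgraph \<Rightarrow> int
    \<Rightarrow> ('a \<Rightarrow> (('a \<times> 'a) \<Rightarrow>\<^sub>0 int) \<Rightarrow> 'm) \<Rightarrow> ('a \<Rightarrow> (('a \<times> 'a) \<Rightarrow>\<^sub>0 int) \<Rightarrow> 'm)" where
  "ZQ_Hom_coboundary k \<Lambda> n = Hom_precomp \<Lambda> (ZQ k \<Lambda> (n + 1)) (ZQ_boundary \<Lambda> (n + 1))"


section \<open>Cubical chains and cochains with coefficients\<close>

definition cub_chains :: "nat \<Rightarrow> 'a kgraph \<Rightarrow> ('a, 'n) gmodule \<Rightarrow> int \<Rightarrow> ('a \<Rightarrow> 'n) monoid" where
  "cub_chains k \<Lambda> N n = sum_group (cubes k \<Lambda> n) (\<lambda>\<xi>. fib N (src \<Lambda> \<xi>))"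

text \<open>The generator \<open>(\<xi>, a)\<close> of the direct sum of the groups at the sources of cubes.\<close>

definition cub_gen :: "nat \<Rightarrow> 'a kgraph \<Rightarrow> ('a, 'n) gmodule \<Rightarrow> int \<Rightarrow> 'a \<Rightarrow> 'n \<Rightarrow> 'a \<Rightarrow> 'n" where
  "cub_gen k \<Lambda> N n \<xi> a = (\<lambda>\<mu>\<in>cubes k \<Lambda> n. if \<mu> = \<xi> then a else \<one>\<^bsub>fib N (src \<Lambda> \<mu>)\<^esub>)"

definition cub_boundary_gen :: "nat \<Rightarrow> 'a kgraph \<Rightarrow> ('a, 'n) gmodule \<Rightarrow> int \<Rightarrow> 'a \<Rightarrow> 'n \<Rightarrow> 'a \<Rightarrow> 'n" where
  "cub_boundary_gen k \<Lambda> N n \<xi> a =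
     (let C = cub_chains k \<Lambda> N (n - 1) in
      finprod C (\<lambda>i.
        (cub_gen k \<Lambda> N (n - 1) (face0 \<Lambda> i \<xi>) (act N (last_edge \<Lambda> i \<xi>) a)
          \<otimes>\<^bsub>C\<^esub> inv\<^bsub>C\<^esub> cub_gen k \<Lambda> N (n - 1) (face1 \<Lambda> i \<xi>) a) [^]\<^bsub>C\<^esub> ((-1 :: int) ^ i))
        {1..nat n})"

definition cub_boundary :: "nat \<Rightarrow> 'a kgraph \<Rightarrow> ('a, 'n) gmodule \<Rightarrow> int \<Rightarrow> ('a \<Rightarrow> 'n) \<Rightarrow> ('a \<Rightarrow> 'n)" where
  "cub_boundary k \<Lambda> N n x =
     finprod (cub_chains k \<Lambda> N (n - 1)) (\<lambda>\<xi>. cub_boundary_gen k \<Lambda> N n \<xi> (x \<xi>))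
       {\<xi> \<in> cubes k \<Lambda> n. x \<xi> \<noteq> \<one>\<^bsub>fib N (src \<Lambda> \<xi>)\<^esub>}"

definition cub_cochains :: "nat \<Rightarrow> 'a kgraph \<Rightarrow> ('a, 'm) gmodule \<Rightarrow> int \<Rightarrow> ('a \<Rightarrow> 'm) monoid" where
  "cub_cochains k \<Lambda> M n = product_group (cubes k \<Lambda> n) (\<lambda>\<xi>. fib M (src \<Lambda> \<xi>))"

definition cub_coboundary :: "nat \<Rightarrow> 'a kgraph \<Rightarrow> ('a, 'm) gmodule \<Rightarrow> int \<Rightarrow> ('a \<Rightarrow> 'm) \<Rightarrow> ('a \<Rightarrow> 'm)" where
  "cub_coboundary k \<Lambda> M n f =
     (\<lambda>\<xi>\<in>cubes k \<Lambda> (n + 1).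
        let A = fib M (src \<Lambda> \<xi>) in
        finprod A (\<lambda>i.
          (act M (last_edge \<Lambda> i \<xi>) (f (face0 \<Lambda> i \<xi>)) \<otimes>\<^bsub>A\<^esub> inv\<^bsub>A\<^esub> f (face1 \<Lambda> i \<xi>)) [^]\<^bsub>A\<^esub> ((-1 :: int) ^ i))
          {1..nat (n + 1)})"


section \<open>Chain and cochain complexes\<close>

definition chain_complex :: "(int \<Rightarrow> 'x monoid) \<Rightarrow> (int \<Rightarrow> 'x \<Rightarrow> 'x) \<Rightarrow> bool" where
  "chain_complex C d \<longleftrightarrow>
     (\<forall>n. comm_group (C n) \<and> d n \<in> hom (C n) (C (n - 1)) \<and>
        (\<forall>x\<in>carrier (C n). d (n - 1) (d n x) = \<one>\<^bsub>C (n - 1 - 1)\<^esub>))"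

definition cochain_complex :: "(int \<Rightarrow> 'x monoid) \<Rightarrow> (int \<Rightarrow> 'x \<Rightarrow> 'x) \<Rightarrow> bool" where
  "cochain_complex C d \<longleftrightarrow>
     (\<forall>n. comm_group (C n) \<and> d n \<in> hom (C n) (C (n + 1)) \<and>
        (\<forall>x\<in>carrier (C n). d (n + 1) (d n x) = \<one>\<^bsub>C (n + 1 + 1)\<^esub>))"

definition chain_isomorphic ::
  "(int \<Rightarrow> 'x monoid) \<Rightarrow> (int \<Rightarrow> 'x \<Rightarrow> 'x) \<Rightarrow> (int \<Rightarrow> 'y monoid) \<Rightarrow> (int \<Rightarrow> 'y \<Rightarrow> 'y) \<Rightarrow> bool" where
  "chain_isomorphic C d D d' \<longleftrightarrow>
     chain_complex C d \<and> chain_complex D d' \<and>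
     (\<exists>\<phi>. \<forall>n. \<phi> n \<in> iso (C n) (D n) \<and> (\<forall>x\<in>carrier (C n). \<phi> (n - 1) (d n x) = d' n (\<phi> n x)))"

definition cochain_isomorphic ::
  "(int \<Rightarrow> 'x monoid) \<Rightarrow> (int \<Rightarrow> 'x \<Rightarrow> 'x) \<Rightarrow> (int \<Rightarrow> 'y monoid) \<Rightarrow> (int \<Rightarrow> 'y \<Rightarrow> 'y) \<Rightarrow> bool" where
  "cochain_isomorphic C d D d' \<longleftrightarrow>
     cochain_complex C d \<and> cochain_complex D d' \<and>
     (\<exists>\<phi>. \<forall>n. \<phi> n \<in> iso (C n) (D n) \<and> (\<forall>x\<in>carrier (C n). \<phi> (n + 1) (d n x) = d' n (\<phi> n x)))"

end

theory Submission
  imports Defs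
begin

text \<open>
  The right module of \<open>n\<close>-cubes \<open>\<int>Q\<^sub>n\<close> is free in the sense of modules over a
  category. Its fibre at \<open>v\<close> has the pairs \<open>(\<eta>, \<mu>)\<close> with
  \<open>s(\<mu>) = v\<close> as a basis, and
  \<open>(\<eta>, \<mu>) = (\<eta>, s(\<eta>)) \<cdot> \<mu>\<close>. So the elements
  \<open>(\<xi>, s(\<xi>))\<close>, one for each \<open>n\<close>-cube \<open>\<xi>\<close> of \<open>\<Lambda>\<close>,
  form a basis of the whole module.

  Tensoring a free module with \<open>N\<close> gives the direct sum of the groups \<open>N(s(\<xi>))\<close>: the map
  \<open>(\<xi>, a) \<mapsto> (\<xi>, s(\<xi>)) \<otimes> a\<close> has the inverse
  \<open>(\<eta>, \<mu>) \<otimes> a \<mapsto> (\<eta>, \<mu> \<cdot> a)\<close> (\<open>chains_iso_tensor\<close>). Dually, by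
  the Yoneda lemma, a module map into \<open>M\<close> is the same as an arbitrary choice of the values in
  \<open>M(s(\<xi>))\<close> of the basis elements (\<open>eval_cubes_iso\<close>).

  For the differentials, the faces of \<open>(\<xi>, s(\<xi>))\<close> are computed in the graph of pairs
  (\<open>tilde_faces\<close>). The final ones are \<open>(F\<^sup>1\<^sub>i(\<xi>), s(\<xi>))\<close>, again basis elements. The
  initial ones are
  \<open>(F\<^sup>0\<^sub>i(\<xi>), S\<^sub>i(\<xi>)) = (F\<^sup>0\<^sub>i(\<xi>), s(F\<^sup>0\<^sub>i(\<xi>))) \<cdot> S\<^sub>i(\<xi>)\<close>. Under
  the tensor product the factor \<open>S\<^sub>i(\<xi>)\<close> moves over to the coefficient, and under a module map it
  acts on the value. This is exactly the twist in the boundary and coboundary with coefficients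
  (\<open>boundary_of_generator\<close>, \<open>eval_cubes_coboundary\<close>).

  That all four are complexes rests on one computation, \<open>cube_boundary_cube_boundary\<close>, for the
  cubes of an arbitrary k-graph. It gives the tensor and Hom complexes by functoriality, and the
  complexes with coefficients by transport along the isomorphisms.
\<close>

section \<open>Factorizations in a k-graph\<close>

context k_graph begin

lemma composableD:
  assumes "composable \<Lambda> \<mu> \<nu>"
  shows "\<mu> \<in> mor \<Lambda>" "\<nu> \<in> mor \<Lambda>" "src \<Lambda> \<mu> = rng \<Lambda> \<nu>"
  using assms by (auto simp: composable_def)

lemma obj_mor: "v \<in> obj \<Lambda> \<Longrightarrow> v \<in> mor \<Lambda>"
  by (simp add: obj_def)

lemma src_of_obj: "v \<in> obj \<Lambda> \<Longrightarrow> src \<Lambda> v = v"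
  by (simp add: obj_def)

lemma composable_src: "\<xi> \<in> mor \<Lambda> \<Longrightarrow> composable \<Lambda> \<xi> (src \<Lambda> \<xi>)"
  by (simp add: composable_def obj_mor rng_of_obj src_obj)

lemma composable_rng: "\<xi> \<in> mor \<Lambda> \<Longrightarrow> composable \<Lambda> (rng \<Lambda> \<xi>) \<xi>"
  by (simp add: composable_def obj_mor src_of_obj rng_obj)

lemma composable_cmp_left: "composable \<Lambda> \<xi> \<mu> \<Longrightarrow> composable \<Lambda> \<mu> \<nu> \<Longrightarrow> composable \<Lambda> (cmp \<Lambda> \<xi> \<mu>) \<nu>"
  by (simp add: composable_def cmp_mor src_cmp)

lemma composable_cmp_right: "composable \<Lambda> \<xi> \<mu> \<Longrightarrow> composable \<Lambda> \<mu> \<nu> \<Longrightarrow> composable \<Lambda> \<xi> (cmp \<Lambda> \<mu> \<nu>)"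
  by (simp add: composable_def cmp_mor rng_cmp)

lemma cmp_cancel:
  assumes "composable \<Lambda> \<mu> \<nu>" "composable \<Lambda> \<mu>' \<nu>'" "deg \<Lambda> \<mu> = deg \<Lambda> \<mu>'"
    and "cmp \<Lambda> \<mu> \<nu> = cmp \<Lambda> \<mu>' \<nu>'"
  shows "\<mu> = \<mu>'" "\<nu> = \<nu>'"
proof -
  have "deg \<Lambda> \<mu> + deg \<Lambda> \<nu> = deg \<Lambda> \<mu> + deg \<Lambda> \<nu>'"
    using assms deg_cmp[OF assms(1)] deg_cmp[OF assms(2)] by simp
  then have "deg \<Lambda> \<nu> = deg \<Lambda> \<nu>'" by (simp add: fun_eq_iff)
  then have "(\<mu>, \<nu>) = (\<mu>', \<nu>')"
    using factorization[OF cmp_mor[OF assms(1)] deg_cmp[OF assms(1)]] assms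
    by (metis fst_conv snd_conv)
  then show "\<mu> = \<mu>'" "\<nu> = \<nu>'" by simp_all
qed

lemma obtain_factorization:
  assumes "\<xi> \<in> mor \<Lambda>" "deg \<Lambda> \<xi> = m + n"
  obtains \<mu> \<nu> where "composable \<Lambda> \<mu> \<nu>" "deg \<Lambda> \<mu> = m" "deg \<Lambda> \<nu> = n" "\<xi> = cmp \<Lambda> \<mu> \<nu>"
  using factorization[OF assms] by blast

text \<open>
  Two applications of unique factorization: the degree of \<open>\<alpha>\<close> determines where to cut off the
  first factor, and then the degree of \<open>\<beta>\<close> determines how to cut the remaining one.
\<close>
lemma segment_cmp:
  assumes "composable \<Lambda> \<alpha> \<beta>" "composable \<Lambda> \<beta> \<gamma>"
  shows "segment \<Lambda> (cmp \<Lambda> \<alpha> (cmp \<Lambda> \<beta> \<gamma>)) (deg \<Lambda> \<alpha>) (deg \<Lambda> \<alpha> + deg \<Lambda> \<beta>) = \<beta>"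
  unfolding segment_def
proof (rule the_equality)
  have d: "deg \<Lambda> \<alpha> + deg \<Lambda> \<beta> - deg \<Lambda> \<alpha> = deg \<Lambda> \<beta>" by (simp add: fun_eq_iff)
  then show "deg \<Lambda> \<beta> = deg \<Lambda> \<alpha> + deg \<Lambda> \<beta> - deg \<Lambda> \<alpha> \<and>
    (\<exists>\<xi>' \<xi>''. composable \<Lambda> \<xi>' \<beta> \<and> composable \<Lambda> \<beta> \<xi>'' \<and>
      cmp \<Lambda> \<alpha> (cmp \<Lambda> \<beta> \<gamma>) = cmp \<Lambda> \<xi>' (cmp \<Lambda> \<beta> \<xi>'') \<and> deg \<Lambda> \<xi>' = deg \<Lambda> \<alpha>)"
    using assms by auto
  fix \<mu>
  assume m: "deg \<Lambda> \<mu> = deg \<Lambda> \<alpha> + deg \<Lambda> \<beta> - deg \<Lambda> \<alpha> \<and>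
    (\<exists>\<xi>' \<xi>''. composable \<Lambda> \<xi>' \<mu> \<and> composable \<Lambda> \<mu> \<xi>'' \<and>
      cmp \<Lambda> \<alpha> (cmp \<Lambda> \<beta> \<gamma>) = cmp \<Lambda> \<xi>' (cmp \<Lambda> \<mu> \<xi>'') \<and> deg \<Lambda> \<xi>' = deg \<Lambda> \<alpha>)"
  then obtain \<xi>' \<xi>'' where x: "composable \<Lambda> \<xi>' \<mu>" "composable \<Lambda> \<mu> \<xi>''"
    "cmp \<Lambda> \<alpha> (cmp \<Lambda> \<beta> \<gamma>) = cmp \<Lambda> \<xi>' (cmp \<Lambda> \<mu> \<xi>'')" "deg \<Lambda> \<xi>' = deg \<Lambda> \<alpha>" by blast
  have "cmp \<Lambda> \<beta> \<gamma> = cmp \<Lambda> \<mu> \<xi>''"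
    by (rule cmp_cancel(2)[OF composable_cmp_right[OF assms] composable_cmp_right[OF x(1,2)]])
      (use x in auto)
  from cmp_cancel(1)[OF assms(2) x(2) _ this] m d show "\<mu> = \<beta>" by simp
qed

lemma segment_initial:
  assumes "composable \<Lambda> \<mu> \<nu>"
  shows "segment \<Lambda> (cmp \<Lambda> \<mu> \<nu>) 0 (deg \<Lambda> \<mu>) = \<mu>"
proof -
  have r: "composable \<Lambda> (rng \<Lambda> \<mu>) \<mu>" using assms composableD composable_rng by blast
  have "deg \<Lambda> (rng \<Lambda> \<mu>) = 0" using assms composableD(1) rng_obj deg_obj by blast
  moreover have "cmp \<Lambda> (rng \<Lambda> \<mu>) (cmp \<Lambda> \<mu> \<nu>) = cmp \<Lambda> \<mu> \<nu>"
    using cmp_rng[OF cmp_mor[OF assms]] rng_cmp[OF assms] by simp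
  ultimately show ?thesis using segment_cmp[OF r assms] by simp
qed

lemma segment_final:
  assumes "composable \<Lambda> \<mu> \<nu>"
  shows "segment \<Lambda> (cmp \<Lambda> \<mu> \<nu>) (deg \<Lambda> \<mu>) (deg \<Lambda> \<mu> + deg \<Lambda> \<nu>) = \<nu>"
  using segment_cmp[OF assms composable_src] composableD(2)[OF assms] cmp_src[of \<nu>] by simp

end

section \<open>Faces of cubes\<close>

text \<open>
  Faces are first indexed by the direction \<open>c\<close> that is removed and not by its position
  \<open>j\<close> in the list of directions: removing one direction shifts the positions of the larger ones
  but leaves their names alone, so faces in different directions commute on the nose.
\<close>
definition drop_last :: "'a kgraph \<Rightarrow> nat \<Rightarrow> 'a \<Rightarrow> 'a" where
  "drop_last \<Gamma> c \<xi> = segment \<Gamma> \<xi> 0 (deg \<Gamma> \<xi> - unit_deg c)"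

definition drop_first :: "'a kgraph \<Rightarrow> nat \<Rightarrow> 'a \<Rightarrow> 'a" where
  "drop_first \<Gamma> c \<xi> = segment \<Gamma> \<xi> (unit_deg c) (deg \<Gamma> \<xi>)"

definition cube_dirs :: "'a kgraph \<Rightarrow> 'a \<Rightarrow> nat set" where
  "cube_dirs \<Gamma> \<xi> = {i. deg \<Gamma> \<xi> i = 1}"

lemma deg_minus_unit_plus:
  assumes "d c = (1::nat)" shows "(d - unit_deg c) + unit_deg c = d" "unit_deg c + (d - unit_deg c) = d"
  using assms by (auto simp: fun_eq_iff unit_deg_def)

context k_graph begin

lemma drop_last_cmp:
  assumes "composable \<Lambda> \<mu> \<nu>" "deg \<Lambda> \<nu> = unit_deg c"
  shows "drop_last \<Lambda> c (cmp \<Lambda> \<mu> \<nu>) = \<mu>"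
proof -
  have "deg \<Lambda> (cmp \<Lambda> \<mu> \<nu>) - unit_deg c = deg \<Lambda> \<mu>"
    using assms by (simp add: deg_cmp fun_eq_iff)
  then show ?thesis using segment_initial[OF assms(1)] by (simp add: drop_last_def)
qed

lemma drop_first_cmp:
  assumes "composable \<Lambda> \<mu> \<nu>" "deg \<Lambda> \<mu> = unit_deg c"
  shows "drop_first \<Lambda> c (cmp \<Lambda> \<mu> \<nu>) = \<nu>"
  using segment_final[OF assms(1)] assms by (simp add: drop_first_def deg_cmp)

lemma split_last_edge:
  assumes "\<xi> \<in> mor \<Lambda>" "deg \<Lambda> \<xi> c = 1"
  obtains \<mu> \<nu> where "composable \<Lambda> \<mu> \<nu>" "\<xi> = cmp \<Lambda> \<mu> \<nu>"
    "deg \<Lambda> \<mu> = deg \<Lambda> \<xi> - unit_deg c" "deg \<Lambda> \<nu> = unit_deg c"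
  using obtain_factorization[OF assms(1) deg_minus_unit_plus(1)[where d="deg \<Lambda> \<xi>", OF assms(2), symmetric]] by blast

lemma split_first_edge:
  assumes "\<xi> \<in> mor \<Lambda>" "deg \<Lambda> \<xi> c = 1"
  obtains \<mu> \<nu> where "composable \<Lambda> \<mu> \<nu>" "\<xi> = cmp \<Lambda> \<mu> \<nu>"
    "deg \<Lambda> \<mu> = unit_deg c" "deg \<Lambda> \<nu> = deg \<Lambda> \<xi> - unit_deg c"
  using obtain_factorization[OF assms(1) deg_minus_unit_plus(2)[where d="deg \<Lambda> \<xi>", OF assms(2), symmetric]] by blast

text \<open>
  The two edges are the two ways of walking around one square: the degree of their composite is
  symmetric in the two directions, so it can be factored in the opposite order.
\<close>
lemma swap_edges:
  assumes "composable \<Lambda> f g" "deg \<Lambda> f = unit_deg b" "deg \<Lambda> g = unit_deg c"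
  obtains g' f' where "composable \<Lambda> g' f'" "deg \<Lambda> g' = unit_deg c" "deg \<Lambda> f' = unit_deg b"
    "cmp \<Lambda> f g = cmp \<Lambda> g' f'"
  using obtain_factorization[OF cmp_mor[OF assms(1)], of "unit_deg c" "unit_deg b"] assms deg_cmp[OF assms(1)]
  by (metis add.commute)

lemma composable_assoc_left:
  assumes "composable \<Lambda> \<xi> (cmp \<Lambda> \<mu> \<nu>)" "composable \<Lambda> \<mu> \<nu>"
  shows "composable \<Lambda> \<xi> \<mu>"
  using assms by (simp add: composable_def rng_cmp)

lemma composable_assoc_right:
  assumes "composable \<Lambda> (cmp \<Lambda> \<xi> \<mu>) \<nu>" "composable \<Lambda> \<xi> \<mu>"
  shows "composable \<Lambda> \<mu> \<nu>"
  using assms by (simp add: composable_def src_cmp)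

text \<open>
  If the two directions are removed at the same end, the last two edges have to be exchanged first;
  the remaining initial piece is the same for both orders.
\<close>
lemma drop_last_drop_last:
  assumes "\<xi> \<in> mor \<Lambda>" "b \<noteq> c" "deg \<Lambda> \<xi> b = 1" "deg \<Lambda> \<xi> c = 1"
  shows "drop_last \<Lambda> b (drop_last \<Lambda> c \<xi>) = drop_last \<Lambda> c (drop_last \<Lambda> b \<xi>)"
proof -
  obtain p f where 1: "composable \<Lambda> p f" "\<xi> = cmp \<Lambda> p f" "deg \<Lambda> p = deg \<Lambda> \<xi> - unit_deg c"
    "deg \<Lambda> f = unit_deg c" using split_last_edge[OF assms(1,4)] by blast
  have "deg \<Lambda> p b = 1" using 1 assms by (simp add: unit_deg_def)
  then obtain q g where 2: "composable \<Lambda> q g" "p = cmp \<Lambda> q g" "deg \<Lambda> g = unit_deg b"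
    using split_last_edge composableD(1)[OF 1(1)] by blast
  have gf: "composable \<Lambda> g f" using 1 2 composable_assoc_right by blast
  obtain f' g' where 3: "composable \<Lambda> f' g'" "deg \<Lambda> f' = unit_deg c" "deg \<Lambda> g' = unit_deg b"
    "cmp \<Lambda> g f = cmp \<Lambda> f' g'" using swap_edges[OF gf 2(3) 1(4)] by blast
  have "composable \<Lambda> q (cmp \<Lambda> f' g')" using composable_cmp_right[OF 2(1) gf] 3 by simp
  then have qf: "composable \<Lambda> q f'" using composable_assoc_left 3 by blast
  have "\<xi> = cmp \<Lambda> (cmp \<Lambda> q f') g'" using 1 2 3 gf qf cmp_assoc by simp
  then have "drop_last \<Lambda> b \<xi> = cmp \<Lambda> q f'"
    using drop_last_cmp[OF composable_cmp_left[OF qf 3(1)] 3(3)] by simp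
  then show ?thesis using 1 2 3 qf drop_last_cmp by simp
qed

lemma drop_first_drop_first:
  assumes "\<xi> \<in> mor \<Lambda>" "b \<noteq> c" "deg \<Lambda> \<xi> b = 1" "deg \<Lambda> \<xi> c = 1"
  shows "drop_first \<Lambda> b (drop_first \<Lambda> c \<xi>) = drop_first \<Lambda> c (drop_first \<Lambda> b \<xi>)"
proof -
  obtain f p where 1: "composable \<Lambda> f p" "\<xi> = cmp \<Lambda> f p" "deg \<Lambda> f = unit_deg c"
     "deg \<Lambda> p = deg \<Lambda> \<xi> - unit_deg c" using split_first_edge[OF assms(1,4)] by blast
  have "deg \<Lambda> p b = 1" using 1 assms by (simp add: unit_deg_def)
  then obtain g q where 2: "composable \<Lambda> g q" "p = cmp \<Lambda> g q" "deg \<Lambda> g = unit_deg b"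
    using split_first_edge composableD(2)[OF 1(1)] by blast
  have fg: "composable \<Lambda> f g" using 1 2 composable_assoc_left by blast
  obtain g' f' where 3: "composable \<Lambda> g' f'" "deg \<Lambda> g' = unit_deg b" "deg \<Lambda> f' = unit_deg c"
    "cmp \<Lambda> f g = cmp \<Lambda> g' f'" using swap_edges[OF fg 1(3) 2(3)] by blast
  have "composable \<Lambda> (cmp \<Lambda> g' f') q" using composable_cmp_left[OF fg 2(1)] 3 by simp
  then have fq: "composable \<Lambda> f' q" using composable_assoc_right 3 by blast
  have "\<xi> = cmp \<Lambda> (cmp \<Lambda> f g) q" using 1 2 fg cmp_assoc by simp
  also have "\<dots> = cmp \<Lambda> g' (cmp \<Lambda> f' q)" using 3 fq cmp_assoc by simp
  finally have "drop_first \<Lambda> b \<xi> = cmp \<Lambda> f' q"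
    using drop_first_cmp[OF composable_cmp_right[OF 3(1) fq] 3(2)] by simp
  then show ?thesis using 1 2 3 fq drop_first_cmp by simp
qed

text \<open>
  Removing edges at opposite ends needs no exchange: both sides are the middle piece of one
  threefold factorization.
\<close>
lemma drop_last_drop_first:
  assumes "\<xi> \<in> mor \<Lambda>" "b \<noteq> c" "deg \<Lambda> \<xi> b = 1" "deg \<Lambda> \<xi> c = 1"
  shows "drop_last \<Lambda> b (drop_first \<Lambda> c \<xi>) = drop_first \<Lambda> c (drop_last \<Lambda> b \<xi>)"
proof -
  obtain f p where 1: "composable \<Lambda> f p" "\<xi> = cmp \<Lambda> f p" "deg \<Lambda> f = unit_deg c"
     "deg \<Lambda> p = deg \<Lambda> \<xi> - unit_deg c" using split_first_edge[OF assms(1,4)] by blast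
  have "deg \<Lambda> p b = 1" using 1 assms by (simp add: unit_deg_def)
  then obtain q g where 2: "composable \<Lambda> q g" "p = cmp \<Lambda> q g" "deg \<Lambda> g = unit_deg b"
    using split_last_edge composableD(2)[OF 1(1)] by blast
  have fq: "composable \<Lambda> f q" using 1 2 composable_assoc_left by blast
  have "\<xi> = cmp \<Lambda> (cmp \<Lambda> f q) g" using 1 2 fq cmp_assoc by simp
  then have "drop_last \<Lambda> b \<xi> = cmp \<Lambda> f q"
    using drop_last_cmp[OF composable_cmp_left[OF fq 2(1)] 2(3)] by simp
  then show ?thesis using 1 2 fq drop_first_cmp drop_last_cmp by simp
qed

lemma drop_last_mor:
  assumes "\<xi> \<in> mor \<Lambda>" "deg \<Lambda> \<xi> c = 1"
  shows "drop_last \<Lambda> c \<xi> \<in> mor \<Lambda>" "deg \<Lambda> (drop_last \<Lambda> c \<xi>) = deg \<Lambda> \<xi> - unit_deg c"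
  using split_last_edge[OF assms] drop_last_cmp composableD by metis+

lemma drop_first_mor:
  assumes "\<xi> \<in> mor \<Lambda>" "deg \<Lambda> \<xi> c = 1"
  shows "drop_first \<Lambda> c \<xi> \<in> mor \<Lambda>" "deg \<Lambda> (drop_first \<Lambda> c \<xi>) = deg \<Lambda> \<xi> - unit_deg c"
  using split_first_edge[OF assms] drop_first_cmp composableD by metis+

end

lemma cube_dirs_minus:
  assumes "deg \<Gamma> \<xi>' = deg \<Gamma> \<xi> - unit_deg c" "c \<in> cube_dirs \<Gamma> \<xi>"
  shows "cube_dirs \<Gamma> \<xi>' = cube_dirs \<Gamma> \<xi> - {c}"
  using assms by (auto simp: cube_dirs_def unit_deg_def)

context k_graph begin

lemma cube_dirs_subset: "\<xi> \<in> mor \<Lambda> \<Longrightarrow> cube_dirs \<Lambda> \<xi> \<subseteq> {1..k}"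
  using deg_supp by (force simp: cube_dirs_def)

lemma finite_cube_dirs: "\<xi> \<in> mor \<Lambda> \<Longrightarrow> finite (cube_dirs \<Lambda> \<xi>)"
  using cube_dirs_subset finite_subset by blast

lemma cubes_iff:
  "\<xi> \<in> cubes k \<Lambda> n \<longleftrightarrow> \<xi> \<in> mor \<Lambda> \<and> int (card (cube_dirs \<Lambda> \<xi>)) = n \<and> (\<forall>i. deg \<Lambda> \<xi> i \<le> 1)"
proof (cases "\<xi> \<in> mor \<Lambda> \<and> (\<forall>i\<in>{1..k}. deg \<Lambda> \<xi> i \<in> {0, 1})")
  case True
  then have "(\<Sum>i\<in>{1..k}. deg \<Lambda> \<xi> i) = (\<Sum>i\<in>{1..k}. if i \<in> cube_dirs \<Lambda> \<xi> then 1 else 0)"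
    by (intro sum.cong) (auto simp: cube_dirs_def)
  also have "\<dots> = card (cube_dirs \<Lambda> \<xi>)"
    using cube_dirs_subset True by (simp add: Int_absorb1 flip: sum.inter_restrict)
  finally have 1: "(\<Sum>i\<in>{1..k}. deg \<Lambda> \<xi> i) = card (cube_dirs \<Lambda> \<xi>)" .
  have "deg \<Lambda> \<xi> i \<le> 1" for i
    using True deg_supp[of \<xi> i] by (cases "i \<in> {1..k}") (force simp del: One_nat_def)+
  then show ?thesis using True 1 by (auto simp: cubes_def simp del: of_nat_sum)
next
  case False
  have "deg \<Lambda> \<xi> i \<in> {0,1}" if "\<forall>i. deg \<Lambda> \<xi> i \<le> 1" for i using that[rule_format, of i] by auto
  with False show ?thesis unfolding cubes_def by blast
qed

lemma cube_minus:
  assumes "\<xi> \<in> cubes k \<Lambda> n" "c \<in> cube_dirs \<Lambda> \<xi>" "\<xi>' \<in> mor \<Lambda>" "deg \<Lambda> \<xi>' = deg \<Lambda> \<xi> - unit_deg c"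
  shows "\<xi>' \<in> cubes k \<Lambda> (n - 1)"
proof -
  have "card (cube_dirs \<Lambda> \<xi>) > 0"
    using assms finite_cube_dirs[of \<xi>] by (auto simp: card_gt_0_iff cubes_iff)
  then show ?thesis
    using assms cube_dirs_minus[OF assms(4,2)] finite_cube_dirs[of \<xi>]
    by (auto simp: cubes_iff card_Diff_singleton intro: le_trans[OF diff_le_self])
qed

text \<open>
  The second part recovers the position of a direction from the set of directions alone. It turns the
  sign \<open>(-1)^j\<close> of the boundary formula into a function of that set.
\<close>
lemma bij_betw_cube_dir:
  assumes "\<xi> \<in> cubes k \<Lambda> n"
  shows "bij_betw (cube_dir \<Lambda> \<xi>) {1..nat n} (cube_dirs \<Lambda> \<xi>)"
    and "j \<in> {1..nat n} \<Longrightarrow> card {i \<in> cube_dirs \<Lambda> \<xi>. i \<le> cube_dir \<Lambda> \<xi> j} = j"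
proof -
  define xs where "xs = sorted_list_of_set (cube_dirs \<Lambda> \<xi>)"
  have fin: "finite (cube_dirs \<Lambda> \<xi>)" and n: "n = int (card (cube_dirs \<Lambda> \<xi>))"
    using assms finite_cube_dirs by (auto simp: cubes_iff)
  have xs: "set xs = cube_dirs \<Lambda> \<xi>" "sorted_wrt (<) xs" "distinct xs" "length xs = nat n"
    using fin n by (simp_all add: xs_def)
  have dir: "cube_dir \<Lambda> \<xi> j = xs ! (j - 1)" for j
    by (simp add: cube_dir_def xs_def cube_dirs_def)
  have "bij_betw ((!) xs) {..<nat n} (cube_dirs \<Lambda> \<xi>)"
    by (rule bij_betw_nth) (use xs in auto)
  moreover have "bij_betw (\<lambda>j. j - 1) {1..nat n} {..<nat n}"
    by (rule bij_betwI[where g = Suc]) auto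
  ultimately show "bij_betw (cube_dir \<Lambda> \<xi>) {1..nat n} (cube_dirs \<Lambda> \<xi>)"
    using bij_betw_trans by (fastforce simp: dir o_def cong: bij_betw_cong)
  show "card {i \<in> cube_dirs \<Lambda> \<xi>. i \<le> cube_dir \<Lambda> \<xi> j} = j" if j: "j \<in> {1..nat n}"
  proof -
    have "xs ! a \<le> xs ! (j - 1) \<longleftrightarrow> a < j" if "a < nat n" for a
      using that j xs sorted_wrt_nth_less[OF xs(2), of a "j-1"] sorted_wrt_nth_less[OF xs(2), of "j-1" a]
      by (cases a "j - 1" rule: linorder_cases) (auto intro: less_imp_le)
    then have "{i \<in> cube_dirs \<Lambda> \<xi>. i \<le> cube_dir \<Lambda> \<xi> j} = (!) xs ` {..<j}"
      using j xs(4) by (auto simp: dir in_set_conv_nth simp flip: xs(1)) (metis less_le_trans)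
    moreover have "inj_on ((!) xs) {..<j}"
      using j xs by (auto simp: inj_on_def nth_eq_iff_index_eq)
    ultimately show ?thesis by (simp add: card_image)
  qed
qed

lemma cube_dir_in_cube_dirs: "\<xi> \<in> cubes k \<Lambda> n \<Longrightarrow> j \<in> {1..nat n} \<Longrightarrow> cube_dir \<Lambda> \<xi> j \<in> cube_dirs \<Lambda> \<xi>"
  using bij_betw_cube_dir(1) bij_betwE by blast

end

lemma face0_eq: "face0 \<Gamma> j \<xi> = drop_last \<Gamma> (cube_dir \<Gamma> \<xi> j) \<xi>"
  by (simp add: face0_def drop_last_def)

lemma face1_eq: "face1 \<Gamma> j \<xi> = drop_first \<Gamma> (cube_dir \<Gamma> \<xi> j) \<xi>"
  by (simp add: face1_def drop_first_def)

section \<open>The cubical boundary squares to zero\<close>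
definition dir_boundary :: "'a kgraph \<Rightarrow> nat \<Rightarrow> 'a \<Rightarrow> ('a \<Rightarrow>\<^sub>0 int)" where
  "dir_boundary \<Gamma> c \<xi> = frag_of (drop_last \<Gamma> c \<xi>) - frag_of (drop_first \<Gamma> c \<xi>)"

definition dir_sign :: "nat set \<Rightarrow> nat \<Rightarrow> int" where
  "dir_sign D c = (-1) ^ card {i \<in> D. i \<le> c}"

text \<open>
  Removing a direction lowers by one the positions of the larger directions and keeps those of the
  smaller ones. Of the two orders of removing \<open>b\<close> and \<open>c\<close>, exactly one
  therefore sees a shifted position.
\<close>
lemma dir_sign_swap:
  assumes "finite D" "b \<in> D" "c \<in> D" "b \<noteq> c"
  shows "dir_sign D c * dir_sign (D - {c}) b = - (dir_sign D b * dir_sign (D - {b}) c)"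
proof -
  have *: "dir_sign D c * dir_sign (D - {c}) b = - (dir_sign D b * dir_sign (D - {b}) c)"
    if "b < c" "b \<in> D" "c \<in> D" for b c
  proof -
    have "{i \<in> D - {c}. i \<le> b} = {i \<in> D. i \<le> b}" using that by auto
    then have 1: "dir_sign (D - {c}) b = dir_sign D b" by (simp add: dir_sign_def)
    have "{i \<in> D. i \<le> c} = insert b {i \<in> D - {b}. i \<le> c}" using that by auto
    then have "dir_sign D c = - dir_sign (D - {b}) c"
      using assms(1) by (simp add: dir_sign_def)
    with 1 show ?thesis by simp
  qed
  show ?thesis
  proof (cases "b < c")
    case True
    then show ?thesis by (rule *) (fact assms)+
  next
    case False
    then have "c < b" using assms(4) by simp
    from *[OF this assms(3,2)] show ?thesis by (simp only: minus_minus)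
  qed
qed

lemma frag_cmul_diff: "frag_cmul a (x - y) = frag_cmul a x - frag_cmul a y"
  by (simp add: poly_mapping_eqI lookup_minus right_diff_distrib)

lemma frag_eq_uminus_self: "x = 0" if "x = - x" for x :: "'a \<Rightarrow>\<^sub>0 int"
proof (rule poly_mapping_eqI)
  have "x + x = 0" using that by (simp only: eq_neg_iff_add_eq_0)
  then have "Poly_Mapping.lookup (x + x) a = 0" for a by (simp only: lookup_zero)
  then show "Poly_Mapping.lookup x a = Poly_Mapping.lookup 0 a" for a by (simp add: lookup_add)
qed

lemma sum_antisymmetric_frag:
  fixes T :: "nat \<Rightarrow> nat \<Rightarrow> 'a \<Rightarrow>\<^sub>0 int"
  assumes "finite D" "\<And>b c. b \<in> D \<Longrightarrow> c \<in> D \<Longrightarrow> b \<noteq> c \<Longrightarrow> T c b = - T b c"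
  shows "(\<Sum>c\<in>D. \<Sum>b\<in>D - {c}. T c b) = 0"
proof -
  define U where "U c b = (if b = c then 0 else T c b)" for c b
  have U: "U c b = - U b c" if "b \<in> D" "c \<in> D" for b c
    using assms(2)[OF that] by (auto simp: U_def)
  have S: "(\<Sum>c\<in>D. \<Sum>b\<in>D - {c}. T c b) = (\<Sum>c\<in>D. \<Sum>b\<in>D. U c b)" (is "?S = ?U")
    using assms(1) by (intro sum.cong refl sum.mono_neutral_cong_left) (auto simp: U_def)
  have "?U = (\<Sum>c\<in>D. \<Sum>b\<in>D. - U b c)"
    by (intro sum.cong refl) (rule U)
  also have "\<dots> = - ?U"
    by (subst sum.swap) (simp add: sum_negf)
  finally show ?thesis unfolding S by (rule frag_eq_uminus_self)
qed

context k_graph begin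

lemma cube_mor: "\<xi> \<in> cubes k \<Lambda> n \<Longrightarrow> \<xi> \<in> mor \<Lambda>"
  by (simp add: cubes_def)

lemma drop_last_cube:
  assumes "\<xi> \<in> cubes k \<Lambda> n" "c \<in> cube_dirs \<Lambda> \<xi>"
  shows "drop_last \<Lambda> c \<xi> \<in> cubes k \<Lambda> (n - 1)" "cube_dirs \<Lambda> (drop_last \<Lambda> c \<xi>) = cube_dirs \<Lambda> \<xi> - {c}"
proof -
  have "deg \<Lambda> \<xi> c = 1" using assms(2) by (simp add: cube_dirs_def)
  note drop_last_mor[OF cube_mor[OF assms(1)] this]
  then show "drop_last \<Lambda> c \<xi> \<in> cubes k \<Lambda> (n - 1)" "cube_dirs \<Lambda> (drop_last \<Lambda> c \<xi>) = cube_dirs \<Lambda> \<xi> - {c}"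
    using cube_minus[OF assms] cube_dirs_minus[OF _ assms(2)] by blast+
qed

lemma drop_first_cube:
  assumes "\<xi> \<in> cubes k \<Lambda> n" "c \<in> cube_dirs \<Lambda> \<xi>"
  shows "drop_first \<Lambda> c \<xi> \<in> cubes k \<Lambda> (n - 1)" "cube_dirs \<Lambda> (drop_first \<Lambda> c \<xi>) = cube_dirs \<Lambda> \<xi> - {c}"
proof -
  have "deg \<Lambda> \<xi> c = 1" using assms(2) by (simp add: cube_dirs_def)
  note drop_first_mor[OF cube_mor[OF assms(1)] this]
  then show "drop_first \<Lambda> c \<xi> \<in> cubes k \<Lambda> (n - 1)" "cube_dirs \<Lambda> (drop_first \<Lambda> c \<xi>) = cube_dirs \<Lambda> \<xi> - {c}"
    using cube_minus[OF assms] cube_dirs_minus[OF _ assms(2)] by blast+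
qed

lemma face_cube:
  assumes "\<xi> \<in> cubes k \<Lambda> n" "j \<in> {1..nat n}"
  shows "face0 \<Lambda> j \<xi> \<in> cubes k \<Lambda> (n - 1)" "face1 \<Lambda> j \<xi> \<in> cubes k \<Lambda> (n - 1)"
  using drop_last_cube[OF assms(1)] drop_first_cube[OF assms(1)] cube_dir_in_cube_dirs[OF assms]
  by (auto simp: face0_eq face1_eq)

lemma cube_boundary_frag_of:
  "cube_boundary \<Lambda> n (frag_of \<xi>) =
    (\<Sum>j\<in>{1..nat n}. frag_cmul ((-1) ^ j) (frag_of (face0 \<Lambda> j \<xi>) - frag_of (face1 \<Lambda> j \<xi>)))"
proof -
  have "(\<Sum>l\<in>{0..1}. frag_cmul ((-1) ^ (j + l)) (frag_of (face \<Lambda> l j \<xi>))) =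
    frag_cmul ((-1) ^ j) (frag_of (face0 \<Lambda> j \<xi>) - frag_of (face1 \<Lambda> j \<xi>))" for j
  proof -
    have "{0..1} = {0, 1::nat}" by auto
    then show ?thesis
      using minus_frag_cmul[of "(-1) ^ j" "frag_of (face1 \<Lambda> j \<xi>)", symmetric]
      by (simp add: face_def frag_cmul_diff del: minus_frag_cmul)
  qed
  then show ?thesis by (simp only: cube_boundary_def frag_extend_of)
qed

lemma cube_boundary_directions:
  assumes "\<xi> \<in> cubes k \<Lambda> n"
  shows "cube_boundary \<Lambda> n (frag_of \<xi>) =
    (\<Sum>c\<in>cube_dirs \<Lambda> \<xi>. frag_cmul (dir_sign (cube_dirs \<Lambda> \<xi>) c) (dir_boundary \<Lambda> c \<xi>))"
proof -
  let ?D = "cube_dirs \<Lambda> \<xi>"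
  have "(\<Sum>c\<in>?D. frag_cmul (dir_sign ?D c) (dir_boundary \<Lambda> c \<xi>)) =
    (\<Sum>j\<in>{1..nat n}. frag_cmul (dir_sign ?D (cube_dir \<Lambda> \<xi> j)) (dir_boundary \<Lambda> (cube_dir \<Lambda> \<xi> j) \<xi>))"
    by (rule sum.reindex_bij_betw[OF bij_betw_cube_dir(1)[OF assms], symmetric])
  also have "\<dots> = cube_boundary \<Lambda> n (frag_of \<xi>)"
    unfolding cube_boundary_frag_of dir_boundary_def face0_eq face1_eq dir_sign_def
    by (rule sum.cong[OF refl]) (simp only: bij_betw_cube_dir(2)[OF assms])
  finally show ?thesis ..
qed

lemma dir_boundary_commute:
  assumes "\<xi> \<in> cubes k \<Lambda> n" "b \<in> cube_dirs \<Lambda> \<xi>" "c \<in> cube_dirs \<Lambda> \<xi>" "b \<noteq> c"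
  shows "frag_extend (dir_boundary \<Lambda> b) (dir_boundary \<Lambda> c \<xi>) = frag_extend (dir_boundary \<Lambda> c) (dir_boundary \<Lambda> b \<xi>)"
proof -
  have x: "\<xi> \<in> mor \<Lambda>" "deg \<Lambda> \<xi> b = 1" "deg \<Lambda> \<xi> c = 1" using assms by (auto simp: cubes_iff cube_dirs_def)
  show ?thesis
    using drop_last_drop_last[OF x(1) assms(4) x(2,3)] drop_first_drop_first[OF x(1) assms(4) x(2,3)]
      drop_last_drop_first[OF x(1) assms(4) x(2,3)] drop_last_drop_first[OF x(1) assms(4)[symmetric] x(3,2)]
    by (simp add: dir_boundary_def frag_extend_diff)
qed

lemma cube_boundary_diff: "cube_boundary \<Gamma> n (x - y) = cube_boundary \<Gamma> n x - cube_boundary \<Gamma> n y"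
  by (simp add: cube_boundary_def frag_extend_diff)

lemma cube_boundary_sum: "finite I \<Longrightarrow> cube_boundary \<Gamma> n (sum f I) = (\<Sum>i\<in>I. cube_boundary \<Gamma> n (f i))"
  by (simp add: cube_boundary_def frag_extend_sum)

lemma cube_boundary_cmul: "cube_boundary \<Gamma> n (frag_cmul a x) = frag_cmul a (cube_boundary \<Gamma> n x)"
  by (simp add: cube_boundary_def frag_extend_cmul)

lemma cube_boundary_dir_boundary:
  assumes "\<xi> \<in> cubes k \<Lambda> n" "c \<in> cube_dirs \<Lambda> \<xi>"
  shows "cube_boundary \<Lambda> (n - 1) (dir_boundary \<Lambda> c \<xi>) =
    (\<Sum>b\<in>cube_dirs \<Lambda> \<xi> - {c}. frag_cmul (dir_sign (cube_dirs \<Lambda> \<xi> - {c}) b) (frag_extend (dir_boundary \<Lambda> b) (dir_boundary \<Lambda> c \<xi>)))"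
  unfolding dir_boundary_def[of \<Lambda> c]
  using drop_last_cube[OF assms] drop_first_cube[OF assms]
  by (simp add: cube_boundary_diff cube_boundary_directions frag_extend_diff frag_cmul_diff sum_subtractf)

text \<open>
  Written over directions, the double boundary is a sum over ordered pairs of distinct directions.
  Faces in different directions commute while the signs change under exchange of the two directions,
  so the sum is the negative of itself.
\<close>
lemma cube_boundary_cube_boundary:
  assumes "Poly_Mapping.keys x \<subseteq> cubes k \<Lambda> n"
  shows "cube_boundary \<Lambda> (n - 1) (cube_boundary \<Lambda> n x) = 0"
  using assms
proof (induction x rule: frag_induction)
  case zero
  show ?case by (simp add: cube_boundary_def)
next
  case (diff a b)
  then show ?case by (simp add: cube_boundary_diff)
next
  case (one \<xi>)
  let ?D = "cube_dirs \<Lambda> \<xi>"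
  have fin: "finite ?D" using one finite_cube_dirs by (simp add: cubes_iff)
  have "cube_boundary \<Lambda> (n - 1) (cube_boundary \<Lambda> n (frag_of \<xi>)) =
    (\<Sum>c\<in>?D. \<Sum>b\<in>?D - {c}. frag_cmul (dir_sign ?D c * dir_sign (?D - {c}) b)
        (frag_extend (dir_boundary \<Lambda> b) (dir_boundary \<Lambda> c \<xi>)))"
    using one fin
    by (simp add: cube_boundary_directions cube_boundary_sum cube_boundary_cmul cube_boundary_dir_boundary
        frag_cmul_sum)
  also have "\<dots> = 0"
  proof (rule sum_antisymmetric_frag[OF fin])
    fix b c assume bc: "b \<in> ?D" "c \<in> ?D" "b \<noteq> c"
    show "frag_cmul (dir_sign ?D c * dir_sign (?D - {c}) b) (frag_extend (dir_boundary \<Lambda> b) (dir_boundary \<Lambda> c \<xi>)) =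
      - frag_cmul (dir_sign ?D b * dir_sign (?D - {b}) c) (frag_extend (dir_boundary \<Lambda> c) (dir_boundary \<Lambda> b \<xi>))"
      by (simp only: dir_sign_swap[OF fin bc] dir_boundary_commute[OF one bc] minus_frag_cmul)
  qed
  finally show ?case .
qed

lemma cube_face0:
  assumes "\<xi> \<in> cubes k \<Lambda> n" "j \<in> {1..nat n}"
  shows "composable \<Lambda> (face0 \<Lambda> j \<xi>) (last_edge \<Lambda> j \<xi>)"
    "cmp \<Lambda> (face0 \<Lambda> j \<xi>) (last_edge \<Lambda> j \<xi>) = \<xi>"
    "deg \<Lambda> (last_edge \<Lambda> j \<xi>) = unit_deg (cube_dir \<Lambda> \<xi> j)"
proof -
  let ?c = "cube_dir \<Lambda> \<xi> j"
  have d: "deg \<Lambda> \<xi> ?c = 1" "\<xi> \<in> mor \<Lambda>"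
    using cube_dir_in_cube_dirs[OF assms] cube_mor[OF assms(1)] by (simp_all add: cube_dirs_def)
  obtain \<mu> \<nu> where m: "composable \<Lambda> \<mu> \<nu>" "\<xi> = cmp \<Lambda> \<mu> \<nu>"
    "deg \<Lambda> \<mu> = deg \<Lambda> \<xi> - unit_deg ?c" "deg \<Lambda> \<nu> = unit_deg ?c"
    using split_last_edge[OF d(2,1)] by blast
  have "segment \<Lambda> \<xi> (deg \<Lambda> \<mu>) (deg \<Lambda> \<xi>) = \<nu>"
    unfolding m(2) deg_cmp[OF m(1)] by (rule segment_final[OF m(1)])
  then have "last_edge \<Lambda> j \<xi> = \<nu>" unfolding last_edge_def m(3) .
  moreover have "segment \<Lambda> \<xi> 0 (deg \<Lambda> \<mu>) = \<mu>"
    unfolding m(2) by (rule segment_initial[OF m(1)])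
  then have "face0 \<Lambda> j \<xi> = \<mu>" unfolding face0_def m(3) .
  ultimately show "composable \<Lambda> (face0 \<Lambda> j \<xi>) (last_edge \<Lambda> j \<xi>)"
    "cmp \<Lambda> (face0 \<Lambda> j \<xi>) (last_edge \<Lambda> j \<xi>) = \<xi>"
    "deg \<Lambda> (last_edge \<Lambda> j \<xi>) = unit_deg (cube_dir \<Lambda> \<xi> j)" using m by auto
qed

lemma cube_face1:
  assumes "\<xi> \<in> cubes k \<Lambda> n" "j \<in> {1..nat n}"
  obtains \<epsilon> where "composable \<Lambda> \<epsilon> (face1 \<Lambda> j \<xi>)" "cmp \<Lambda> \<epsilon> (face1 \<Lambda> j \<xi>) = \<xi>"
    "deg \<Lambda> \<epsilon> = unit_deg (cube_dir \<Lambda> \<xi> j)"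
proof -
  let ?c = "cube_dir \<Lambda> \<xi> j"
  have d: "deg \<Lambda> \<xi> ?c = 1" "\<xi> \<in> mor \<Lambda>"
    using cube_dir_in_cube_dirs[OF assms] cube_mor[OF assms(1)] by (simp_all add: cube_dirs_def)
  show thesis
    by (rule split_first_edge[OF d(2,1)]) (use drop_first_cmp that face1_eq in metis)
qed

lemma cube_face_src_rng:
  assumes "\<xi> \<in> cubes k \<Lambda> n" "j \<in> {1..nat n}"
  shows "last_edge \<Lambda> j \<xi> \<in> mor \<Lambda>" "rng \<Lambda> (last_edge \<Lambda> j \<xi>) = src \<Lambda> (face0 \<Lambda> j \<xi>)"
    "src \<Lambda> (last_edge \<Lambda> j \<xi>) = src \<Lambda> \<xi>" "src \<Lambda> (face1 \<Lambda> j \<xi>) = src \<Lambda> \<xi>"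
proof -
  show "last_edge \<Lambda> j \<xi> \<in> mor \<Lambda>" "rng \<Lambda> (last_edge \<Lambda> j \<xi>) = src \<Lambda> (face0 \<Lambda> j \<xi>)"
    using composableD[OF cube_face0(1)[OF assms]] by auto
  show "src \<Lambda> (last_edge \<Lambda> j \<xi>) = src \<Lambda> \<xi>"
    using src_cmp[OF cube_face0(1)[OF assms]] cube_face0(2)[OF assms] by simp
  show "src \<Lambda> (face1 \<Lambda> j \<xi>) = src \<Lambda> \<xi>"
    using cube_face1[OF assms] src_cmp by metis
qed

end

section \<open>Faces of cubes of pairs\<close>
lemma tilde_graph_simps:
  "(\<eta>, \<mu>) \<in> mor (tilde_graph \<Lambda> v) \<longleftrightarrow> composable \<Lambda> \<eta> \<mu> \<and> src \<Lambda> \<mu> = v"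
  "src (tilde_graph \<Lambda> v) (\<eta>, \<mu>) = (rng \<Lambda> \<mu>, \<mu>)"
  "rng (tilde_graph \<Lambda> v) (\<eta>, \<mu>) = (rng \<Lambda> \<eta>, cmp \<Lambda> \<eta> \<mu>)"
  "cmp (tilde_graph \<Lambda> v) (\<zeta>, \<nu>) (\<eta>, \<mu>) = (cmp \<Lambda> \<zeta> \<eta>, \<mu>)"
  "deg (tilde_graph \<Lambda> v) (\<eta>, \<mu>) = deg \<Lambda> \<eta>"
  by (simp_all add: tilde_graph_def)

context k_graph begin

lemma tilde_cube_iff:
  "(\<eta>, \<mu>) \<in> cubes k (tilde_graph \<Lambda> v) n \<longleftrightarrow> \<eta> \<in> cubes k \<Lambda> n \<and> composable \<Lambda> \<eta> \<mu> \<and> src \<Lambda> \<mu> = v"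
  by (auto simp: cubes_def tilde_graph_simps composable_def)

text \<open>
  In the graph of pairs, \<open>(\<eta>, \<mu>)\<close> is the composite of
  \<open>(\<zeta>, \<epsilon>\<mu>)\<close> and \<open>(\<epsilon>, \<mu>)\<close> whenever
  \<open>\<eta> = \<zeta>\<epsilon>\<close>. Cutting off the last edge thus pushes that edge into the
  second component, and this is where the last edges in the coefficient formulas come from.
\<close>
lemma tilde_faces:
  assumes "(\<eta>, \<mu>) \<in> cubes k (tilde_graph \<Lambda> v) n" "j \<in> {1..nat n}"
  shows "face0 (tilde_graph \<Lambda> v) j (\<eta>, \<mu>) = (face0 \<Lambda> j \<eta>, cmp \<Lambda> (last_edge \<Lambda> j \<eta>) \<mu>)"
    "face1 (tilde_graph \<Lambda> v) j (\<eta>, \<mu>) = (face1 \<Lambda> j \<eta>, \<mu>)"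
proof -
  let ?G = "tilde_graph \<Lambda> v"
  have e: "\<eta> \<in> cubes k \<Lambda> n" "composable \<Lambda> \<eta> \<mu>" "src \<Lambda> \<mu> = v" using assms by (auto simp: tilde_cube_iff)
  then have "v \<in> obj \<Lambda>" using src_obj by (auto simp: composable_def)
  then interpret G: k_graph k ?G by (rule k_graph_tilde_graph)
  have dir: "cube_dir ?G (\<eta>, \<mu>) j = cube_dir \<Lambda> \<eta> j" by (simp add: cube_dir_def tilde_graph_simps)
  note f0 = cube_face0[OF e(1) assms(2)]
  have lm: "composable \<Lambda> (last_edge \<Lambda> j \<eta>) \<mu>"
    using composable_assoc_right[of "face0 \<Lambda> j \<eta>"] f0 e by simp
  have 1: "composable ?G (face0 \<Lambda> j \<eta>, cmp \<Lambda> (last_edge \<Lambda> j \<eta>) \<mu>) (last_edge \<Lambda> j \<eta>, \<mu>)"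
    using lm f0(1) e(3) composable_cmp_right[OF f0(1) lm] src_cmp[OF lm] composableD(3)[OF f0(1)]
    by (simp add: composable_def[of ?G] tilde_graph_simps rng_cmp[OF lm])
  show "face0 ?G j (\<eta>, \<mu>) = (face0 \<Lambda> j \<eta>, cmp \<Lambda> (last_edge \<Lambda> j \<eta>) \<mu>)"
    using G.drop_last_cmp[OF 1] f0 by (simp add: face0_eq[of ?G] tilde_graph_simps dir)
  obtain \<epsilon> where f1: "composable \<Lambda> \<epsilon> (face1 \<Lambda> j \<eta>)" "cmp \<Lambda> \<epsilon> (face1 \<Lambda> j \<eta>) = \<eta>"
    "deg \<Lambda> \<epsilon> = unit_deg (cube_dir \<Lambda> \<eta> j)" using cube_face1[OF e(1) assms(2)] by blast
  have fm: "composable \<Lambda> (face1 \<Lambda> j \<eta>) \<mu>"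
    using composable_assoc_right[of \<epsilon>] f1 e by simp
  have 2: "composable ?G (\<epsilon>, cmp \<Lambda> (face1 \<Lambda> j \<eta>) \<mu>) (face1 \<Lambda> j \<eta>, \<mu>)"
    using fm f1(1) e(3) composable_cmp_right[OF f1(1) fm] src_cmp[OF fm] composableD(3)[OF f1(1)]
    by (simp add: composable_def[of ?G] tilde_graph_simps rng_cmp[OF fm])
  show "face1 ?G j (\<eta>, \<mu>) = (face1 \<Lambda> j \<eta>, \<mu>)"
    using G.drop_first_cmp[OF 2] f1 by (simp add: face1_eq[of ?G] tilde_graph_simps dir)
qed

end

section \<open>Alternating products in abelian groups\<close>
lemma hom_finprod:
  assumes "comm_group G" "comm_group H" "h \<in> hom G H" "f \<in> A \<rightarrow> carrier G"
  shows "h (finprod G f A) = finprod H (\<lambda>i. h (f i)) A"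
proof -
  interpret G: comm_group G by fact
  interpret H: comm_group H by fact
  interpret group_hom G H h by unfold_locales fact
  from assms(4) show ?thesis
  proof (induction A rule: infinite_finite_induct)
    case (insert x F)
    then have "f \<in> F \<rightarrow> carrier G" "f x \<in> carrier G" "(\<lambda>i. h (f i)) \<in> F \<rightarrow> carrier H"
      by (auto simp: Pi_iff)
    then show ?case using insert by (simp add: G.finprod_closed Pi_iff)
  qed simp_all
qed

text \<open>
  The common shape of all the boundary and coboundary formulas, in multiplicative notation. A
  homomorphism passes through it, so comparing two boundaries amounts to comparing their faces.
\<close>
definition alternating_product :: "('a, 'b) monoid_scheme \<Rightarrow> nat \<Rightarrow> (nat \<Rightarrow> 'a) \<Rightarrow> (nat \<Rightarrow> 'a) \<Rightarrow> 'a" where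
  "alternating_product G n f g = finprod G (\<lambda>i. (f i \<otimes>\<^bsub>G\<^esub> inv\<^bsub>G\<^esub> g i) [^]\<^bsub>G\<^esub> ((-1 :: int) ^ i)) {1..n}"

lemma alternating_product_closed:
  assumes "comm_group G" "f \<in> {1..n} \<rightarrow> carrier G" "g \<in> {1..n} \<rightarrow> carrier G"
  shows "alternating_product G n f g \<in> carrier G"
proof -
  interpret G: comm_group G by fact
  show ?thesis unfolding alternating_product_def
    by (rule G.finprod_closed) (use assms in \<open>auto simp: Pi_iff\<close>)
qed

lemma alternating_product_cong:
  assumes "comm_group G" "f \<in> {1..n} \<rightarrow> carrier G" "g \<in> {1..n} \<rightarrow> carrier G"
    and "\<And>i. i \<in> {1..n} \<Longrightarrow> f' i = f i" "\<And>i. i \<in> {1..n} \<Longrightarrow> g' i = g i"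
  shows "alternating_product G n f' g' = alternating_product G n f g"
proof -
  interpret G: comm_group G by fact
  show ?thesis unfolding alternating_product_def
    by (rule G.finprod_cong') (use assms in \<open>auto simp: Pi_iff\<close>)
qed

lemma hom_alternating_product:
  assumes "comm_group G" "comm_group H" "h \<in> hom G H"
    and fg: "f \<in> {1..n} \<rightarrow> carrier G" "g \<in> {1..n} \<rightarrow> carrier G"
  shows "h (alternating_product G n f g) = alternating_product H n (\<lambda>i. h (f i)) (\<lambda>i. h (g i))"
proof -
  interpret G: comm_group G by fact
  interpret H: comm_group H by fact
  interpret group_hom G H h by unfold_locales fact
  have "h (alternating_product G n f g) =
      finprod H (\<lambda>i. h ((f i \<otimes>\<^bsub>G\<^esub> inv\<^bsub>G\<^esub> g i) [^]\<^bsub>G\<^esub> ((-1 :: int) ^ i))) {1..n}"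
    unfolding alternating_product_def by (rule hom_finprod[OF assms(1-3)]) (use fg in \<open>auto simp: Pi_iff\<close>)
  also have "\<dots> = alternating_product H n (\<lambda>i. h (f i)) (\<lambda>i. h (g i))"
    unfolding alternating_product_def
    by (rule H.finprod_cong') (use fg in \<open>auto simp: hom_int_pow Pi_iff\<close>)
  finally show ?thesis .
qed

lemma finprod_free_Abelian_group:
  assumes "\<And>i. i \<in> A \<Longrightarrow> f i \<in> carrier (free_Abelian_group S)"
  shows "finprod (free_Abelian_group S) f A = sum f A"
proof -
  interpret comm_group "free_Abelian_group S" by (rule abelian_free_Abelian_group)
  show ?thesis using assms
    by (induction A rule: infinite_finite_induct) (auto simp: Pi_iff)
qed

lemma alternating_product_free_Abelian_group:
  assumes "\<And>i. i \<in> {1..n} \<Longrightarrow> f i \<in> S" "\<And>i. i \<in> {1..n} \<Longrightarrow> g i \<in> S"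
  shows "alternating_product (free_Abelian_group S) n (\<lambda>i. frag_of (f i)) (\<lambda>i. frag_of (g i)) =
    (\<Sum>i\<in>{1..n}. frag_cmul ((-1) ^ i) (frag_of (f i) - frag_of (g i)))"
proof -
  have *: "Poly_Mapping.keys (frag_of (f i) - frag_of (g i)) \<subseteq> S" if "i \<in> {1..n}" for i
    using assms that keys_diff[of "frag_of (f i)" "frag_of (g i)"] by auto
  have ***: "frag_cmul a (frag_of (f i) - frag_of (g i)) \<in> carrier (free_Abelian_group S)" if "i \<in> {1..n}" for i a
    using order_trans[OF keys_cmul *[OF that]] by simp
  have **: "(frag_of (f i) \<otimes>\<^bsub>free_Abelian_group S\<^esub> inv\<^bsub>free_Abelian_group S\<^esub> frag_of (g i))
      [^]\<^bsub>free_Abelian_group S\<^esub> ((-1 :: int) ^ i) = frag_cmul ((-1) ^ i) (frag_of (f i) - frag_of (g i))"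
    if "i \<in> {1..n}" for i
    using assms(2)[OF that] *[OF that] by simp
  have "alternating_product (free_Abelian_group S) n (\<lambda>i. frag_of (f i)) (\<lambda>i. frag_of (g i)) =
    finprod (free_Abelian_group S) (\<lambda>i. frag_cmul ((-1) ^ i) (frag_of (f i) - frag_of (g i))) {1..n}"
    unfolding alternating_product_def
    by (rule comm_monoid.finprod_cong'[OF comm_group.axioms(1)[OF abelian_free_Abelian_group]])
      (use *** ** in auto)
  also have "\<dots> = (\<Sum>i\<in>{1..n}. frag_cmul ((-1) ^ i) (frag_of (f i) - frag_of (g i)))"
    by (rule finprod_free_Abelian_group) (use *** in auto)
  finally show ?thesis .
qed

lemma hom_free_Abelian_group_eqI:
  assumes "group G" "h \<in> hom (free_Abelian_group S) G" "h' \<in> hom (free_Abelian_group S) G"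
    and "\<And>s. s \<in> S \<Longrightarrow> h (frag_of s) = h' (frag_of s)" "x \<in> carrier (free_Abelian_group S)"
  shows "h x = h' x"
proof -
  interpret G: group G by fact
  interpret F: group "free_Abelian_group S" by simp
  interpret h: group_hom "free_Abelian_group S" G h
    using assms by (simp add: group_hom_def group_hom_axioms_def)
  interpret h': group_hom "free_Abelian_group S" G h'
    using assms by (simp add: group_hom_def group_hom_axioms_def)
  have x: "Poly_Mapping.keys x \<subseteq> S" using assms(5) by simp
  show ?thesis
  proof (rule free_Abelian_group_induct[OF x])
    show "h 0 = h' 0" using h.hom_one h'.hom_one by simp
    fix y z :: "'c \<Rightarrow>\<^sub>0 int"
    assume yz: "Poly_Mapping.keys y \<subseteq> S" "Poly_Mapping.keys z \<subseteq> S" "h y = h' y" "h z = h' z"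
    then have yz': "y \<in> carrier (free_Abelian_group S)" "z \<in> carrier (free_Abelian_group S)" by simp_all
    have "h (y \<otimes>\<^bsub>free_Abelian_group S\<^esub> inv\<^bsub>free_Abelian_group S\<^esub> z) =
        h' (y \<otimes>\<^bsub>free_Abelian_group S\<^esub> inv\<^bsub>free_Abelian_group S\<^esub> z)"
      by (simp only: yz yz' h.hom_mult h'.hom_mult h.hom_inv h'.hom_inv F.inv_closed)
    then show "h (y - z) = h' (y - z)" using yz by simp
  qed (use assms in auto)
qed

lemma frag_extend_hom:
  assumes "\<And>s. s \<in> S \<Longrightarrow> Poly_Mapping.keys (f s) \<subseteq> T"
  shows "frag_extend f \<in> hom (free_Abelian_group S) (free_Abelian_group T)"
  by (rule homI) (use assms keys_frag_extend[of f] in \<open>auto simp: frag_extend_add, blast\<close>)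

section \<open>Direct sums\<close>
definition sum_gen :: "'i set \<Rightarrow> ('i \<Rightarrow> ('b, 'c) monoid_scheme) \<Rightarrow> 'i \<Rightarrow> 'b \<Rightarrow> 'i \<Rightarrow> 'b" where
  "sum_gen I G i a = (\<lambda>j\<in>I. if j = i then a else \<one>\<^bsub>G j\<^esub>)"

context
  fixes I :: "'i set" and G :: "'i \<Rightarrow> ('b, 'c) monoid_scheme"
  assumes G: "\<And>i. i \<in> I \<Longrightarrow> comm_group (G i)"
begin

lemma group_summand: "i \<in> I \<Longrightarrow> group (G i)"
  using G comm_group.axioms(2) by blast

lemma comm_group_product_group: "comm_group (product_group I G)"
  by (rule group.group_comm_groupI)
    (use G in \<open>auto simp: group_summand PiE_iff intro!: restrict_ext comm_groupE(4)\<close>)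

lemma comm_group_sum_group: "comm_group (sum_group I G)"
  by (rule group.group_comm_groupI)
    (use G in \<open>auto simp: group_summand carrier_sum_group PiE_iff intro!: restrict_ext comm_groupE(4)\<close>)

lemma sum_gen_closed:
  assumes "i \<in> I" "a \<in> carrier (G i)"
  shows "sum_gen I G i a \<in> carrier (sum_group I G)"
proof -
  have "finite {j \<in> I. sum_gen I G i a j \<noteq> \<one>\<^bsub>G j\<^esub>}"
    by (rule finite_subset[of _ "{i}"]) (auto simp: sum_gen_def)
  then show ?thesis using assms group.is_monoid[OF group_summand]
    by (auto simp: carrier_sum_group group_summand sum_gen_def monoid.one_closed)
qed

lemma sum_gen_hom:
  assumes "i \<in> I"
  shows "sum_gen I G i \<in> hom (G i) (sum_group I G)"
proof (rule homI)
  fix a b assume "a \<in> carrier (G i)" "b \<in> carrier (G i)"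
  then show "sum_gen I G i (a \<otimes>\<^bsub>G i\<^esub> b) = sum_gen I G i a \<otimes>\<^bsub>sum_group I G\<^esub> sum_gen I G i b"
    using assms group.is_monoid[OF group_summand]
    by (auto simp: sum_gen_def monoid.l_one monoid.one_closed fun_eq_iff)
qed (use assms sum_gen_closed in auto)

text \<open>
  The equation is checked in each coordinate \<open>j\<close>: the projection to \<open>j\<close> is a
  homomorphism, so it passes through the product and kills every factor but the one at
  \<open>j\<close>.
\<close>
lemma sum_group_expansion:
  assumes "x \<in> carrier (sum_group I G)"
  shows "finprod (sum_group I G) (\<lambda>i. sum_gen I G i (x i)) {i \<in> I. x i \<noteq> \<one>\<^bsub>G i\<^esub>} = x" (is "?p = x")
proof (rule extensionalityI)
  interpret C: comm_group "sum_group I G" by (rule comm_group_sum_group)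
  let ?S = "{i \<in> I. x i \<noteq> \<one>\<^bsub>G i\<^esub>}"
  have x: "x i \<in> carrier (G i)" if "i \<in> I" for i
    using assms that by (auto simp: carrier_sum_group group_summand)
  have fin: "finite ?S" using assms by (simp add: carrier_sum_group group_summand)
  have gen: "(\<lambda>i. sum_gen I G i (x i)) \<in> ?S \<rightarrow> carrier (sum_group I G)"
    using sum_gen_closed x by auto
  have p: "?p \<in> carrier (sum_group I G)" by (rule C.finprod_closed[OF gen])
  then show "?p \<in> extensional I" by (auto simp: carrier_sum_group group_summand PiE_def)
  show "x \<in> extensional I" using assms by (auto simp: carrier_sum_group group_summand PiE_def)
  fix j assume j: "j \<in> I"
  interpret Gj: comm_group "G j" using G j by blast
  have proj: "(\<lambda>x. x j) \<in> hom (sum_group I G) (G j)"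
    by (rule homI) (use j in \<open>auto simp: carrier_sum_group group_summand\<close>)
  have "?p j = finprod (G j) (\<lambda>i. sum_gen I G i (x i) j) ?S"
    by (rule hom_finprod[OF comm_group_sum_group G[OF j] proj gen])
  also have "\<dots> = finprod (G j) (\<lambda>i. if j = i then x i else \<one>\<^bsub>G j\<^esub>) (insert j ?S)"
    using j x[OF j] fin
    \<comment> \<open>the index \<open>j\<close> is added because \<open>x\<close> may be trivial there\<close>
    by (intro Gj.finprod_mono_neutral_cong) (auto simp: sum_gen_def)
  also have "\<dots> = x j"
  proof -
    have "finprod (G j) (\<lambda>i. if j = i then x i else \<one>\<^bsub>G j\<^esub>) (insert j ?S) =
      finprod (G j) (\<lambda>i. if j = i then x j else \<one>\<^bsub>G j\<^esub>) (insert j ?S)"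
      using x[OF j] by (intro Gj.finprod_cong') auto
    also have "\<dots> = x j"
      using fin x[OF j] by (intro Gj.finprod_singleton[where f = "\<lambda>_. x j"]) auto
    finally show ?thesis .
  qed
  finally show "?p j = x j" .
qed

lemma hom_sum_group_expansion:
  assumes "comm_group H" "h \<in> hom (sum_group I G) H" "x \<in> carrier (sum_group I G)"
  shows "h x = finprod H (\<lambda>i. h (sum_gen I G i (x i))) {i \<in> I. x i \<noteq> \<one>\<^bsub>G i\<^esub>}"
proof -
  have "(\<lambda>i. sum_gen I G i (x i)) \<in> {i \<in> I. x i \<noteq> \<one>\<^bsub>G i\<^esub>} \<rightarrow> carrier (sum_group I G)"
    using assms(3) sum_gen_closed by (auto simp: carrier_sum_group group_summand PiE_iff)
  from hom_finprod[OF comm_group_sum_group assms(1,2) this] show ?thesis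
    by (simp add: sum_group_expansion[OF assms(3)])
qed

lemma hom_sum_group_eqI:
  assumes "comm_group H" "h \<in> hom (sum_group I G) H" "h' \<in> hom (sum_group I G) H"
    and "\<And>i a. i \<in> I \<Longrightarrow> a \<in> carrier (G i) \<Longrightarrow> h (sum_gen I G i a) = h' (sum_gen I G i a)"
    and "x \<in> carrier (sum_group I G)"
  shows "h x = h' x"
proof -
  interpret H: comm_group H by fact
  have x: "x i \<in> carrier (G i)" if "i \<in> I" for i
    using assms(5) that by (auto simp: carrier_sum_group group_summand)
  show ?thesis
    unfolding hom_sum_group_expansion[OF assms(1,2,5)] hom_sum_group_expansion[OF assms(1,3,5)]
    by (rule H.finprod_cong') (use assms(4) x hom_in_carrier[OF assms(3) sum_gen_closed] in auto)
qed

lemma sum_group_universal: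
  assumes "comm_group H" "\<And>i. i \<in> I \<Longrightarrow> f i \<in> hom (G i) H"
  obtains h where "h \<in> hom (sum_group I G) H"
    "\<And>i a. i \<in> I \<Longrightarrow> a \<in> carrier (G i) \<Longrightarrow> h (sum_gen I G i a) = f i a"
proof
  interpret H: comm_group H by fact
  let ?h = "\<lambda>x. gfinprod H (\<lambda>i. f i (x i)) I"
  show "?h \<in> hom (sum_group I G) H"
    by (rule H.hom_group_sum) (use assms group_summand in auto)
  fix i a assume i: "i \<in> I" and a: "a \<in> carrier (G i)"
  have fa: "f i a \<in> carrier H" using hom_in_carrier[OF assms(2)[OF i] a] .
  have one: "f j \<one>\<^bsub>G j\<^esub> = \<one>\<^bsub>H\<^esub>" if "j \<in> I" for j
    using hom_one[OF assms(2) group_summand] that H.is_group by blast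
  have "gfinprod H (\<lambda>j. f j (sum_gen I G i a j)) I = gfinprod H (\<lambda>j. f i a) {i}"
    by (rule H.gfinprod_mono_neutral_cong_right) (use i fa one in \<open>auto simp: sum_gen_def\<close>)
  also have "\<dots> = f i a" using fa by (simp add: H.finprod_insert)
  finally show "?h (sum_gen I G i a) = f i a" .
qed

end

section \<open>Tensor products\<close>
definition pure_tensor :: "'a kgraph \<Rightarrow> ('a, 'm) gmodule \<Rightarrow> ('a, 'n) gmodule \<Rightarrow> 'a \<Rightarrow> 'm \<Rightarrow> 'n
    \<Rightarrow> (('a \<times> 'm \<times> 'n) \<Rightarrow>\<^sub>0 int) set" where
  "pure_tensor \<Lambda> M N v m a =
     tensor_kernel \<Lambda> M N #>\<^bsub>free_Abelian_group (tensor_gens \<Lambda> M N)\<^esub> frag_of (v, m, a)"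

text \<open>
  Natural transformations whose components need not be extensional: the boundary maps of
  \<open>\<int>Q\<close> are defined outside the carriers as well.
\<close>
definition module_map :: "'a kgraph \<Rightarrow> ('a, 'm) gmodule \<Rightarrow> ('a, 'l) gmodule \<Rightarrow> ('a \<Rightarrow> 'm \<Rightarrow> 'l) \<Rightarrow> bool" where
  "module_map \<Lambda> M M' \<phi> \<longleftrightarrow>
     (\<forall>v\<in>obj \<Lambda>. \<phi> v \<in> hom (fib M v) (fib M' v)) \<and>
     (\<forall>\<xi>\<in>mor \<Lambda>. \<forall>x\<in>carrier (fib M (rng \<Lambda> \<xi>)). \<phi> (src \<Lambda> \<xi>) (act M \<xi> x) = act M' \<xi> (\<phi> (rng \<Lambda> \<xi>) x))"

lemma right_moduleD:
  assumes "right_module \<Lambda> M"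
  shows "v \<in> obj \<Lambda> \<Longrightarrow> comm_group (fib M v)"
    "\<xi> \<in> mor \<Lambda> \<Longrightarrow> act M \<xi> \<in> hom (fib M (rng \<Lambda> \<xi>)) (fib M (src \<Lambda> \<xi>))"
    "v \<in> obj \<Lambda> \<Longrightarrow> x \<in> carrier (fib M v) \<Longrightarrow> act M v x = x"
    "composable \<Lambda> \<mu> \<nu> \<Longrightarrow> x \<in> carrier (fib M (rng \<Lambda> \<mu>)) \<Longrightarrow> act M (cmp \<Lambda> \<mu> \<nu>) x = act M \<nu> (act M \<mu> x)"
  using assms unfolding right_module_def by blast+

lemma left_moduleD:
  assumes "left_module \<Lambda> N"
  shows "v \<in> obj \<Lambda> \<Longrightarrow> comm_group (fib N v)"
    "\<xi> \<in> mor \<Lambda> \<Longrightarrow> act N \<xi> \<in> hom (fib N (src \<Lambda> \<xi>)) (fib N (rng \<Lambda> \<xi>))"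
    "v \<in> obj \<Lambda> \<Longrightarrow> x \<in> carrier (fib N v) \<Longrightarrow> act N v x = x"
    "composable \<Lambda> \<mu> \<nu> \<Longrightarrow> x \<in> carrier (fib N (src \<Lambda> \<nu>)) \<Longrightarrow> act N (cmp \<Lambda> \<mu> \<nu>) x = act N \<mu> (act N \<nu> x)"
  using assms unfolding left_module_def by blast+

locale tensor_product = k_graph k \<Lambda> for k :: nat and \<Lambda> :: "'a kgraph" +
  fixes M :: "('a, 'm) gmodule" and N :: "('a, 'n) gmodule"
  assumes M: "right_module \<Lambda> M" and N: "left_module \<Lambda> N"
begin

abbreviation "F \<equiv> free_Abelian_group (tensor_gens \<Lambda> M N)"
abbreviation "K \<equiv> tensor_kernel \<Lambda> M N"
abbreviation "T \<equiv> tensor \<Lambda> M N"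
abbreviation "pure \<equiv> pure_tensor \<Lambda> M N"

lemma rels_carrier: "tensor_rels \<Lambda> M N \<subseteq> carrier F"
proof -
  note [simp] = monoid.m_closed[OF group.is_monoid[OF comm_group.axioms(2)[OF right_moduleD(1)[OF M]]]]
    monoid.m_closed[OF group.is_monoid[OF comm_group.axioms(2)[OF left_moduleD(1)[OF N]]]]
    hom_in_carrier[OF right_moduleD(2)[OF M]] hom_in_carrier[OF left_moduleD(2)[OF N]] src_obj rng_obj
  have diff: "x - y \<in> carrier F" if "x \<in> carrier F" "y \<in> carrier F" for x y
    using that keys_diff[of x y] by auto
  have add: "x + y \<in> carrier F" if "x \<in> carrier F" "y \<in> carrier F" for x y
    using that keys_add[of x y] by auto
  have of: "frag_of (v, m, a) \<in> carrier F" if "v \<in> obj \<Lambda>" "m \<in> carrier (fib M v)" "a \<in> carrier (fib N v)" for v m a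
    using that by (simp add: tensor_gens_def)
  show ?thesis unfolding tensor_rels_def
    by (intro Un_least subsetI; clarify; intro diff add of; simp)
qed

lemma kernel_subgroup: "subgroup K F"
  unfolding tensor_kernel_def by (rule group.generate_is_subgroup[OF _ rels_carrier]) simp

lemma kernel_normal: "K \<lhd> F"
  by (rule comm_group.subgroup_imp_normal[OF abelian_free_Abelian_group kernel_subgroup])

lemma comm_group_tensor: "comm_group T"
  unfolding tensor_def by (rule comm_group.abelian_FactGroup[OF abelian_free_Abelian_group kernel_subgroup])

lemma coset_hom: "(\<lambda>x. K #>\<^bsub>F\<^esub> x) \<in> hom F T"
  unfolding tensor_def by (rule normal.r_coset_hom_Mod[OF kernel_normal])

lemma coset_eq_iff:
  assumes "x \<in> carrier F" "y \<in> carrier F"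
  shows "K #>\<^bsub>F\<^esub> x = K #>\<^bsub>F\<^esub> y \<longleftrightarrow> x - y \<in> K"
proof -
  interpret F: group F by simp
  interpret K: subgroup K F by (rule kernel_subgroup)
  have "x - y = x \<otimes>\<^bsub>F\<^esub> inv\<^bsub>F\<^esub> y" using assms by (simp add: inv_free_Abelian_group)
  moreover have "x \<otimes>\<^bsub>F\<^esub> inv\<^bsub>F\<^esub> y \<in> K \<longleftrightarrow> x \<in> K #>\<^bsub>F\<^esub> y"
    using assms K.rcos_module[of y x] F.is_group by simp
  moreover have "x \<in> K #>\<^bsub>F\<^esub> y \<longleftrightarrow> K #>\<^bsub>F\<^esub> x = K #>\<^bsub>F\<^esub> y"
    using F.repr_independence[of x K y] F.rcos_self[of x K] assms kernel_subgroup by metis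
  ultimately show ?thesis by (simp only:)
qed

lemma tensor_gens_iff [simp]:
  "(v, m, a) \<in> tensor_gens \<Lambda> M N \<longleftrightarrow> v \<in> obj \<Lambda> \<and> m \<in> carrier (fib M v) \<and> a \<in> carrier (fib N v)"
  by (simp add: tensor_gens_def)

lemma add_closed: "x \<in> carrier F \<Longrightarrow> y \<in> carrier F \<Longrightarrow> x + y \<in> carrier F"
  using keys_add[of x y] by auto

lemma pure_gen: "v \<in> obj \<Lambda> \<Longrightarrow> m \<in> carrier (fib M v) \<Longrightarrow> a \<in> carrier (fib N v) \<Longrightarrow> frag_of (v, m, a) \<in> carrier F"
  by (simp add: tensor_gens_def)

lemma pure_closed: "v \<in> obj \<Lambda> \<Longrightarrow> m \<in> carrier (fib M v) \<Longrightarrow> a \<in> carrier (fib N v) \<Longrightarrow> pure v m a \<in> carrier T"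
  unfolding pure_tensor_def using hom_in_carrier[OF coset_hom pure_gen] .

lemma rel_kernel: "r \<in> tensor_rels \<Lambda> M N \<Longrightarrow> r \<in> K"
  unfolding tensor_kernel_def by (rule generate.incl)

lemma pure_mult:
  assumes "v \<in> obj \<Lambda>" "m \<in> carrier (fib M v)" "m' \<in> carrier (fib M v)" "a \<in> carrier (fib N v)"
  shows "pure v (m \<otimes>\<^bsub>fib M v\<^esub> m') a = pure v m a \<otimes>\<^bsub>T\<^esub> pure v m' a"
proof -
  interpret Mv: comm_group "fib M v" using right_moduleD(1)[OF M assms(1)] .
  have "frag_of (v, m \<otimes>\<^bsub>fib M v\<^esub> m', a) - (frag_of (v, m, a) + frag_of (v, m', a)) \<in> K"
    by (rule rel_kernel) (use assms in \<open>auto simp: tensor_rels_def\<close>)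
  then have "pure v (m \<otimes>\<^bsub>fib M v\<^esub> m') a = K #>\<^bsub>F\<^esub> (frag_of (v, m, a) \<otimes>\<^bsub>F\<^esub> frag_of (v, m', a))"
    unfolding pure_tensor_def
    by (subst coset_eq_iff) (use assms in \<open>auto intro!: add_closed simp del: carrier_free_Abelian_group_iff\<close>)
  also have "\<dots> = pure v m a \<otimes>\<^bsub>T\<^esub> pure v m' a"
    unfolding pure_tensor_def by (rule hom_mult[OF coset_hom]) (use assms pure_gen in auto)
  finally show ?thesis .
qed

lemma pure_mult_right:
  assumes "v \<in> obj \<Lambda>" "m \<in> carrier (fib M v)" "a \<in> carrier (fib N v)" "a' \<in> carrier (fib N v)"
  shows "pure v m (a \<otimes>\<^bsub>fib N v\<^esub> a') = pure v m a \<otimes>\<^bsub>T\<^esub> pure v m a'"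
proof -
  interpret Nv: comm_group "fib N v" using left_moduleD(1)[OF N assms(1)] .
  have "frag_of (v, m, a \<otimes>\<^bsub>fib N v\<^esub> a') - (frag_of (v, m, a) + frag_of (v, m, a')) \<in> K"
    by (rule rel_kernel) (use assms in \<open>auto simp: tensor_rels_def\<close>)
  then have "pure v m (a \<otimes>\<^bsub>fib N v\<^esub> a') = K #>\<^bsub>F\<^esub> (frag_of (v, m, a) \<otimes>\<^bsub>F\<^esub> frag_of (v, m, a'))"
    unfolding pure_tensor_def
    by (subst coset_eq_iff) (use assms in \<open>auto intro!: add_closed simp del: carrier_free_Abelian_group_iff\<close>)
  also have "\<dots> = pure v m a \<otimes>\<^bsub>T\<^esub> pure v m a'"
    unfolding pure_tensor_def by (rule hom_mult[OF coset_hom]) (use assms pure_gen in auto)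
  finally show ?thesis .
qed

lemma pure_hom_left: "v \<in> obj \<Lambda> \<Longrightarrow> a \<in> carrier (fib N v) \<Longrightarrow> (\<lambda>m. pure v m a) \<in> hom (fib M v) T"
  by (rule homI) (auto simp: pure_closed pure_mult)

lemma pure_hom_right: "v \<in> obj \<Lambda> \<Longrightarrow> m \<in> carrier (fib M v) \<Longrightarrow> pure v m \<in> hom (fib N v) T"
  by (rule homI) (auto simp: pure_closed pure_mult_right)

lemma pure_act:
  assumes "\<xi> \<in> mor \<Lambda>" "m \<in> carrier (fib M (rng \<Lambda> \<xi>))" "a \<in> carrier (fib N (src \<Lambda> \<xi>))"
  shows "pure (src \<Lambda> \<xi>) (act M \<xi> m) a = pure (rng \<Lambda> \<xi>) m (act N \<xi> a)"
proof -
  have "frag_of (src \<Lambda> \<xi>, act M \<xi> m, a) - frag_of (rng \<Lambda> \<xi>, m, act N \<xi> a) \<in> K"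
    by (rule rel_kernel) (use assms in \<open>auto simp: tensor_rels_def\<close>)
  then show ?thesis unfolding pure_tensor_def
    by (subst coset_eq_iff)
      (use assms src_obj rng_obj hom_in_carrier[OF right_moduleD(2)[OF M]] hom_in_carrier[OF left_moduleD(2)[OF N]]
        in auto)
qed

lemma hom_tensor_eqI:
  assumes "group H" "h \<in> hom T H" "h' \<in> hom T H"
    and eq: "\<And>v m a. v \<in> obj \<Lambda> \<Longrightarrow> m \<in> carrier (fib M v) \<Longrightarrow> a \<in> carrier (fib N v) \<Longrightarrow> h (pure v m a) = h' (pure v m a)"
    and "X \<in> carrier T"
  shows "h X = h' X"
proof -
  obtain x where x: "x \<in> carrier F" "X = K #>\<^bsub>F\<^esub> x"
    using assms(5) by (auto simp: tensor_def carrier_FactGroup)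
  have "(h \<circ> (\<lambda>x. K #>\<^bsub>F\<^esub> x)) x = (h' \<circ> (\<lambda>x. K #>\<^bsub>F\<^esub> x)) x"
    by (rule hom_free_Abelian_group_eqI[OF assms(1) hom_compose[OF coset_hom assms(2)] hom_compose[OF coset_hom assms(3)] _ x(1)])
      (use eq in \<open>auto simp: tensor_gens_def pure_tensor_def\<close>)
  then show ?thesis using x by simp
qed

text \<open>
  Freeness gives a homomorphism with the prescribed values on generators. Additivity in each variable
  and the compatibility with the action say that it sends the three kinds of relations to the unit, so
  it factors through the quotient.
\<close>
lemma tensor_universal:
  assumes H: "comm_group H"
    and left: "\<And>v a. v \<in> obj \<Lambda> \<Longrightarrow> a \<in> carrier (fib N v) \<Longrightarrow> (\<lambda>m. f v m a) \<in> hom (fib M v) H"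
    and right: "\<And>v m. v \<in> obj \<Lambda> \<Longrightarrow> m \<in> carrier (fib M v) \<Longrightarrow> f v m \<in> hom (fib N v) H"
    and act: "\<And>\<xi> m a. \<xi> \<in> mor \<Lambda> \<Longrightarrow> m \<in> carrier (fib M (rng \<Lambda> \<xi>)) \<Longrightarrow> a \<in> carrier (fib N (src \<Lambda> \<xi>)) \<Longrightarrow>
      f (src \<Lambda> \<xi>) (act M \<xi> m) a = f (rng \<Lambda> \<xi>) m (act N \<xi> a)"
  obtains h where "h \<in> hom T H"
    "\<And>v m a. v \<in> obj \<Lambda> \<Longrightarrow> m \<in> carrier (fib M v) \<Longrightarrow> a \<in> carrier (fib N v) \<Longrightarrow> h (pure v m a) = f v m a"
proof -
  interpret H: comm_group H by fact
  have "(\<lambda>(v, m, a). f v m a) ` tensor_gens \<Lambda> M N \<subseteq> carrier H"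
    using hom_in_carrier[OF right] by (auto simp: tensor_gens_def)
  then obtain g where g: "g \<in> hom F H" "\<And>p. p \<in> tensor_gens \<Lambda> M N \<Longrightarrow> g (frag_of p) = (\<lambda>(v, m, a). f v m a) p"
    using H.free_Abelian_group_universal by blast
  interpret g: group_hom F H g using g by (simp add: group_hom_def group_hom_axioms_def H.is_group)
  have gp: "g (frag_of (v, m, a)) = f v m a"
    if "v \<in> obj \<Lambda>" "m \<in> carrier (fib M v)" "a \<in> carrier (fib N v)" for v m a
    using g(2)[of "(v, m, a)"] that by (simp add: tensor_gens_def)
  have fcl: "f v m a \<in> carrier H"
    if "v \<in> obj \<Lambda>" "m \<in> carrier (fib M v)" "a \<in> carrier (fib N v)" for v m a
    using hom_in_carrier[OF right] that by blast
  have gadd: "g (x + y) = g x \<otimes>\<^bsub>H\<^esub> g y" if "x \<in> carrier F" "y \<in> carrier F" for x y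
    using g.hom_mult[OF that] by simp
  have gdiff: "g (x - y) = g x \<otimes>\<^bsub>H\<^esub> inv\<^bsub>H\<^esub> g y" if "x \<in> carrier F" "y \<in> carrier F" for x y
    using g.hom_mult[OF that(1) group.inv_closed[OF group_free_Abelian_group that(2)]] g.hom_inv[OF that(2)] that
    by simp
  have "g r = \<one>\<^bsub>H\<^esub>" if r: "r \<in> tensor_rels \<Lambda> M N" for r
  proof -
    consider
      (left) v m m' a where "r = frag_of (v, m \<otimes>\<^bsub>fib M v\<^esub> m', a) - (frag_of (v, m, a) + frag_of (v, m', a))"
        "v \<in> obj \<Lambda>" "m \<in> carrier (fib M v)" "m' \<in> carrier (fib M v)" "a \<in> carrier (fib N v)"
    | (right) v m a a' where "r = frag_of (v, m, a \<otimes>\<^bsub>fib N v\<^esub> a') - (frag_of (v, m, a) + frag_of (v, m, a'))"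
        "v \<in> obj \<Lambda>" "m \<in> carrier (fib M v)" "a \<in> carrier (fib N v)" "a' \<in> carrier (fib N v)"
    | (act) \<xi> m a where "r = frag_of (src \<Lambda> \<xi>, act M \<xi> m, a) - frag_of (rng \<Lambda> \<xi>, m, act N \<xi> a)"
        "\<xi> \<in> mor \<Lambda>" "m \<in> carrier (fib M (rng \<Lambda> \<xi>))" "a \<in> carrier (fib N (src \<Lambda> \<xi>))"
      using r unfolding tensor_rels_def by blast
    then show ?thesis
    proof cases
      case left
      interpret Mv: comm_group "fib M v" using right_moduleD(1)[OF M left(2)] .
      have "g r = f v (m \<otimes>\<^bsub>fib M v\<^esub> m') a \<otimes>\<^bsub>H\<^esub> inv\<^bsub>H\<^esub> (f v m a \<otimes>\<^bsub>H\<^esub> f v m' a)"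
        unfolding left(1) using left(2-)
        by (subst gdiff) (auto intro!: add_closed simp: gadd gp simp del: carrier_free_Abelian_group_iff)
      then show ?thesis using hom_mult[OF assms(2)[OF left(2,5)] left(3,4)] left fcl by simp
    next
      case right
      interpret Nv: comm_group "fib N v" using left_moduleD(1)[OF N right(2)] .
      have "g r = f v m (a \<otimes>\<^bsub>fib N v\<^esub> a') \<otimes>\<^bsub>H\<^esub> inv\<^bsub>H\<^esub> (f v m a \<otimes>\<^bsub>H\<^esub> f v m a')"
        unfolding right(1) using right(2-)
        by (subst gdiff) (auto intro!: add_closed simp: gadd gp simp del: carrier_free_Abelian_group_iff)
      then show ?thesis using hom_mult[OF assms(3)[OF right(2,3)] right(4,5)] right fcl by simp
    next
      case act
      have c: "act M \<xi> m \<in> carrier (fib M (src \<Lambda> \<xi>))" "act N \<xi> a \<in> carrier (fib N (rng \<Lambda> \<xi>))"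
        using hom_in_carrier[OF right_moduleD(2)[OF M]] hom_in_carrier[OF left_moduleD(2)[OF N]] act by blast+
      have "g r = f (src \<Lambda> \<xi>) (act M \<xi> m) a \<otimes>\<^bsub>H\<^esub> inv\<^bsub>H\<^esub> f (rng \<Lambda> \<xi>) m (act N \<xi> a)"
        unfolding act(1) using act(2-) c src_obj rng_obj
        by (subst gdiff) (auto simp: gp simp del: carrier_free_Abelian_group_iff)
      then show ?thesis using assms(4)[OF act(2-)] fcl[OF rng_obj[OF act(2)] act(3) c(2)] by simp
    qed
  qed
  then have "tensor_rels \<Lambda> M N \<subseteq> kernel F H g"
    using rels_carrier by (auto simp: kernel_def simp del: carrier_free_Abelian_group_iff)
  then have kernel: "K \<subseteq> kernel F H g"
    unfolding tensor_kernel_def by (rule g.generate_subgroup_incl[OF _ g.subgroup_kernel])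
  obtain h where "h \<in> hom T H" "\<And>x. x \<in> carrier F \<Longrightarrow> h (K #>\<^bsub>F\<^esub> x) = g x"
  proof (rule FactGroup_universal[OF g(1) kernel_normal])
    fix x y assume xy: "x \<in> carrier F" "y \<in> carrier F" "K #>\<^bsub>F\<^esub> x = K #>\<^bsub>F\<^esub> y"
    then have "x - y \<in> kernel F H g" using kernel coset_eq_iff by blast
    then have "g x \<otimes>\<^bsub>H\<^esub> inv\<^bsub>H\<^esub> g y = \<one>\<^bsub>H\<^esub>" using gdiff xy by (simp add: kernel_def)
    then show "g x = g y" using xy g.hom_closed H.inv_equality H.inv_inv H.inv_closed by metis
  qed (use that in \<open>auto simp: tensor_def\<close>)
  then show thesis using that gp pure_gen by (simp add: pure_tensor_def del: carrier_free_Abelian_group_iff)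
qed

end

text \<open>
  By the universal property there is a homomorphism with the required values on pure tensors. The
  direct definition by representatives agrees with it, and this also shows that the image of a coset
  is independent of the representative.
\<close>
lemma tensor_map_properties:
  assumes "k_graph k \<Lambda>" "right_module \<Lambda> M" "right_module \<Lambda> M'" "left_module \<Lambda> N" and \<phi>: "module_map \<Lambda> M M' \<phi>"
  shows "tensor_map \<Lambda> M M' N \<phi> \<in> hom (tensor \<Lambda> M N) (tensor \<Lambda> M' N)"
    and "\<And>v m a. v \<in> obj \<Lambda> \<Longrightarrow> m \<in> carrier (fib M v) \<Longrightarrow> a \<in> carrier (fib N v) \<Longrightarrow>
      tensor_map \<Lambda> M M' N \<phi> (pure_tensor \<Lambda> M N v m a) = pure_tensor \<Lambda> M' N v (\<phi> v m) a"
proof -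
  interpret k_graph k \<Lambda> by fact
  interpret MN: tensor_product k \<Lambda> M N by unfold_locales fact+
  interpret MN': tensor_product k \<Lambda> M' N by unfold_locales fact+
  have \<phi>hom: "\<phi> v \<in> hom (fib M v) (fib M' v)" if "v \<in> obj \<Lambda>" for v
    using \<phi> that by (simp add: module_map_def)
  obtain g where g: "g \<in> hom MN.T MN'.T"
    "\<And>v m a. v \<in> obj \<Lambda> \<Longrightarrow> m \<in> carrier (fib M v) \<Longrightarrow> a \<in> carrier (fib N v) \<Longrightarrow>
      g (MN.pure v m a) = MN'.pure v (\<phi> v m) a"
  proof (rule MN.tensor_universal[OF MN'.comm_group_tensor, where f = "\<lambda>v m a. MN'.pure v (\<phi> v m) a"])
    show "(\<lambda>m. MN'.pure v (\<phi> v m) a) \<in> hom (fib M v) MN'.T" if "v \<in> obj \<Lambda>" "a \<in> carrier (fib N v)" for v a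
      using hom_compose[OF \<phi>hom[OF that(1)] MN'.pure_hom_left[OF that]] by (simp add: o_def)
    show "MN'.pure v (\<phi> v m) \<in> hom (fib N v) MN'.T" if "v \<in> obj \<Lambda>" "m \<in> carrier (fib M v)" for v m
      using MN'.pure_hom_right[OF that(1) hom_in_carrier[OF \<phi>hom[OF that(1)] that(2)]] .
    fix \<xi> m a assume *: "\<xi> \<in> mor \<Lambda>" "m \<in> carrier (fib M (rng \<Lambda> \<xi>))" "a \<in> carrier (fib N (src \<Lambda> \<xi>))"
    then have "\<phi> (src \<Lambda> \<xi>) (act M \<xi> m) = act M' \<xi> (\<phi> (rng \<Lambda> \<xi>) m)"
      using \<phi> by (simp add: module_map_def)
    then show "MN'.pure (src \<Lambda> \<xi>) (\<phi> (src \<Lambda> \<xi>) (act M \<xi> m)) a = MN'.pure (rng \<Lambda> \<xi>) (\<phi> (rng \<Lambda> \<xi>) m) (act N \<xi> a)"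
      using MN'.pure_act[OF *(1) hom_in_carrier[OF \<phi>hom[OF rng_obj[OF *(1)]] *(2)] *(3)] by simp
  qed auto
  let ?push = "frag_extend (\<lambda>(v, m, a). frag_of (v, \<phi> v m, a))"
  have push: "?push \<in> hom MN.F MN'.F"
    by (rule frag_extend_hom) (use hom_in_carrier[OF \<phi>hom] in \<open>auto simp: tensor_gens_def\<close>)
  have eq: "g (MN.K #>\<^bsub>MN.F\<^esub> x) = MN'.K #>\<^bsub>MN'.F\<^esub> ?push x" if "x \<in> carrier MN.F" for x
  proof -
    have "(g \<circ> (\<lambda>x. MN.K #>\<^bsub>MN.F\<^esub> x)) x = ((\<lambda>x. MN'.K #>\<^bsub>MN'.F\<^esub> x) \<circ> ?push) x"
      by (rule hom_free_Abelian_group_eqI[OF comm_group.axioms(2)[OF MN'.comm_group_tensor]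
            hom_compose[OF MN.coset_hom g(1)] hom_compose[OF push MN'.coset_hom] _ that])
        (use g(2) in \<open>auto simp: tensor_gens_def pure_tensor_def\<close>)
    then show ?thesis by simp
  qed
  have map: "tensor_map \<Lambda> M M' N \<phi> X = g X" if X: "X \<in> carrier MN.T" for X
  proof -
    obtain x where x: "x \<in> carrier MN.F" "X = MN.K #>\<^bsub>MN.F\<^esub> x"
      using X by (auto simp: tensor_def carrier_FactGroup)
    have "MN'.K #>\<^bsub>MN'.F\<^esub> ?push y = g X" if "y \<in> X" for y
    proof -
      have "X = MN.K #>\<^bsub>MN.F\<^esub> y"
        using group.repr_independence[OF group_free_Abelian_group _ x(1) MN.kernel_subgroup] that x by auto
      moreover have "y \<in> carrier MN.F"
        using that x subgroup.elemrcos_carrier[OF MN.kernel_subgroup group_free_Abelian_group x(1)] by blast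
      ultimately show ?thesis using eq by simp
    qed
    moreover have "x \<in> X"
      using group.rcos_self[OF group_free_Abelian_group x(1) MN.kernel_subgroup] x by simp
    ultimately have "(\<lambda>y. MN'.K #>\<^bsub>MN'.F\<^esub> ?push y) ` X = {g X}" by blast
    then show ?thesis by (simp add: tensor_map_def)
  qed
  show "tensor_map \<Lambda> M M' N \<phi> \<in> hom MN.T MN'.T"
    using g(1) map monoid.m_closed[OF group.is_monoid[OF comm_group.axioms(2)[OF MN.comm_group_tensor]]]
    by (auto simp: hom_def Pi_iff)
  show "tensor_map \<Lambda> M M' N \<phi> (MN.pure v m a) = MN'.pure v (\<phi> v m) a"
    if "v \<in> obj \<Lambda>" "m \<in> carrier (fib M v)" "a \<in> carrier (fib N v)" for v m a
    using map[OF MN.pure_closed[OF that]] g(2)[OF that] by simp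
qed

section \<open>Groups of module maps\<close>
lemma module_mapI:
  assumes "\<And>v. v \<in> obj \<Lambda> \<Longrightarrow> f v \<in> hom (fib M v) (fib N v)"
    and "\<And>\<xi> x. \<xi> \<in> mor \<Lambda> \<Longrightarrow> x \<in> carrier (fib M (rng \<Lambda> \<xi>)) \<Longrightarrow>
      f (src \<Lambda> \<xi>) (act M \<xi> x) = act N \<xi> (f (rng \<Lambda> \<xi>) x)"
  shows "module_map \<Lambda> M N f"
  using assms by (simp add: module_map_def)

lemma module_mapD:
  assumes "module_map \<Lambda> M N f"
  shows "v \<in> obj \<Lambda> \<Longrightarrow> f v \<in> hom (fib M v) (fib N v)"
    "\<xi> \<in> mor \<Lambda> \<Longrightarrow> x \<in> carrier (fib M (rng \<Lambda> \<xi>)) \<Longrightarrow> f (src \<Lambda> \<xi>) (act M \<xi> x) = act N \<xi> (f (rng \<Lambda> \<xi>) x)"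
  using assms by (simp_all add: module_map_def)

lemma module_map_compose:
  assumes "k_graph k \<Lambda>" "module_map \<Lambda> L M f" "module_map \<Lambda> M N g"
  shows "module_map \<Lambda> L N (\<lambda>v x. g v (f v x))"
proof (rule module_mapI)
  fix v assume "v \<in> obj \<Lambda>"
  then show "(\<lambda>x. g v (f v x)) \<in> hom (fib L v) (fib N v)"
    using hom_compose[OF module_mapD(1)[OF assms(2)] module_mapD(1)[OF assms(3)]] by (simp add: o_def)
next
  fix \<xi> x assume "\<xi> \<in> mor \<Lambda>" "x \<in> carrier (fib L (rng \<Lambda> \<xi>))"
  then show "g (src \<Lambda> \<xi>) (f (src \<Lambda> \<xi>) (act L \<xi> x)) = act N \<xi> (g (rng \<Lambda> \<xi>) (f (rng \<Lambda> \<xi>) x))"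
    using module_mapD(2)[OF assms(2)] module_mapD(2)[OF assms(3)]
      hom_in_carrier[OF module_mapD(1)[OF assms(2)]] k_graph.rng_obj[OF assms(1)] by simp
qed

locale module_pair = k_graph k \<Lambda> for k :: nat and \<Lambda> :: "'a kgraph" +
  fixes M :: "('a, 'm) gmodule" and N :: "('a, 'n) gmodule"
  assumes M: "right_module \<Lambda> M" and N: "right_module \<Lambda> N"
begin

abbreviation "H \<equiv> right_Hom \<Lambda> M N"

lemma right_Hom_module_map: "f \<in> carrier H \<Longrightarrow> module_map \<Lambda> M N f"
  by (auto simp: right_Hom_def module_map_def PiE_iff)

lemma right_Hom_eqI:
  assumes "f \<in> carrier H" "g \<in> carrier H"
    and "\<And>v x. v \<in> obj \<Lambda> \<Longrightarrow> x \<in> carrier (fib M v) \<Longrightarrow> f v x = g v x"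
  shows "f = g"
proof (rule extensionalityI)
  show "f \<in> extensional (obj \<Lambda>)" "g \<in> extensional (obj \<Lambda>)"
    using assms by (auto simp: right_Hom_def PiE_iff)
  show "f v = g v" if "v \<in> obj \<Lambda>" for v
    by (rule extensionalityI[where A = "carrier (fib M v)"])
      (use assms that in \<open>auto simp: right_Hom_def PiE_iff\<close>)
qed

lemma act_closed:
  "\<xi> \<in> mor \<Lambda> \<Longrightarrow> x \<in> carrier (fib M (rng \<Lambda> \<xi>)) \<Longrightarrow> act M \<xi> x \<in> carrier (fib M (src \<Lambda> \<xi>))"
  using hom_in_carrier[OF right_moduleD(2)[OF M]] .

lemma restrict_in_right_Hom:
  assumes "module_map \<Lambda> M N f"
  shows "(\<lambda>v\<in>obj \<Lambda>. \<lambda>x\<in>carrier (fib M v). f v x) \<in> carrier H"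
proof -
  have "(\<lambda>x\<in>carrier (fib M v). f v x) \<in> hom (fib M v) (fib N v)" if "v \<in> obj \<Lambda>" for v
    using module_mapD(1)[OF assms that] monoid.m_closed[OF group.is_monoid[OF comm_group.axioms(2)[OF right_moduleD(1)[OF M that]]]]
    by (auto simp: hom_def)
  then show ?thesis
    using module_mapD(2)[OF assms] act_closed by (auto simp: right_Hom_def src_obj rng_obj)
qed

lemma comm_group_fib: "v \<in> obj \<Lambda> \<Longrightarrow> comm_group (fib N v)"
  using right_moduleD(1)[OF N] .

lemma right_Hom_closed:
  "f \<in> carrier H \<Longrightarrow> v \<in> obj \<Lambda> \<Longrightarrow> x \<in> carrier (fib M v) \<Longrightarrow> f v x \<in> carrier (fib N v)"
  using hom_in_carrier[OF module_mapD(1)[OF right_Hom_module_map]] .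

lemma right_Hom_mult:
  "f \<otimes>\<^bsub>H\<^esub> g = (\<lambda>v\<in>obj \<Lambda>. \<lambda>x\<in>carrier (fib M v). f v x \<otimes>\<^bsub>fib N v\<^esub> g v x)"
  by (simp add: right_Hom_def)

lemma right_Hom_one:
  "\<one>\<^bsub>H\<^esub> = (\<lambda>v\<in>obj \<Lambda>. \<lambda>x\<in>carrier (fib M v). \<one>\<^bsub>fib N v\<^esub>)"
  by (simp add: right_Hom_def)

lemma module_map_mult:
  assumes "module_map \<Lambda> M N f" "module_map \<Lambda> M N g"
  shows "module_map \<Lambda> M N (\<lambda>v x. f v x \<otimes>\<^bsub>fib N v\<^esub> g v x)"
proof (rule module_mapI)
  fix v assume "v \<in> obj \<Lambda>"
  then show "(\<lambda>x. f v x \<otimes>\<^bsub>fib N v\<^esub> g v x) \<in> hom (fib M v) (fib N v)"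
    using comm_group.hom_group_mult[OF comm_group_fib] module_mapD(1)[OF assms(1)] module_mapD(1)[OF assms(2)]
    by blast
next
  fix \<xi> x assume x: "\<xi> \<in> mor \<Lambda>" "x \<in> carrier (fib M (rng \<Lambda> \<xi>))"
  then have "f (rng \<Lambda> \<xi>) x \<in> carrier (fib N (rng \<Lambda> \<xi>))" "g (rng \<Lambda> \<xi>) x \<in> carrier (fib N (rng \<Lambda> \<xi>))"
    using hom_in_carrier[OF module_mapD(1)[OF assms(1)]] hom_in_carrier[OF module_mapD(1)[OF assms(2)]] rng_obj
    by blast+
  then show "f (src \<Lambda> \<xi>) (act M \<xi> x) \<otimes>\<^bsub>fib N (src \<Lambda> \<xi>)\<^esub> g (src \<Lambda> \<xi>) (act M \<xi> x) =
    act N \<xi> (f (rng \<Lambda> \<xi>) x \<otimes>\<^bsub>fib N (rng \<Lambda> \<xi>)\<^esub> g (rng \<Lambda> \<xi>) x)"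
    using module_mapD(2)[OF assms(1) x] module_mapD(2)[OF assms(2) x] hom_mult[OF right_moduleD(2)[OF N x(1)]] by simp
qed

lemma module_map_one: "module_map \<Lambda> M N (\<lambda>v x. \<one>\<^bsub>fib N v\<^esub>)"
proof (rule module_mapI)
  fix v assume "v \<in> obj \<Lambda>"
  then interpret comm_group "fib N v" by (rule comm_group_fib)
  show "(\<lambda>x. \<one>\<^bsub>fib N v\<^esub>) \<in> hom (fib M v) (fib N v)" by (simp add: hom_def)
next
  fix \<xi> x assume x: "\<xi> \<in> mor \<Lambda>" "x \<in> carrier (fib M (rng \<Lambda> \<xi>))"
  then show "\<one>\<^bsub>fib N (src \<Lambda> \<xi>)\<^esub> = act N \<xi> \<one>\<^bsub>fib N (rng \<Lambda> \<xi>)\<^esub>"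
    using hom_one[OF right_moduleD(2)[OF N x(1)]] comm_group_fib src_obj rng_obj comm_group.axioms(2) by metis
qed

lemma module_map_inv:
  assumes "module_map \<Lambda> M N f"
  shows "module_map \<Lambda> M N (\<lambda>v x. inv\<^bsub>fib N v\<^esub> f v x)"
proof (rule module_mapI)
  fix v assume v: "v \<in> obj \<Lambda>"
  then interpret Nv: comm_group "fib N v" by (rule comm_group_fib)
  show "(\<lambda>x. inv\<^bsub>fib N v\<^esub> f v x) \<in> hom (fib M v) (fib N v)"
    using module_mapD(1)[OF assms v] by (auto simp: hom_def Pi_iff Nv.inv_mult)
next
  fix \<xi> x assume x: "\<xi> \<in> mor \<Lambda>" "x \<in> carrier (fib M (rng \<Lambda> \<xi>))"
  then interpret group_hom "fib N (rng \<Lambda> \<xi>)" "fib N (src \<Lambda> \<xi>)" "act N \<xi>"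
    using right_moduleD(2)[OF N x(1)] comm_group.axioms(2)[OF comm_group_fib] src_obj rng_obj
    by (simp add: group_hom_def group_hom_axioms_def)
  show "inv\<^bsub>fib N (src \<Lambda> \<xi>)\<^esub> f (src \<Lambda> \<xi>) (act M \<xi> x) = act N \<xi> (inv\<^bsub>fib N (rng \<Lambda> \<xi>)\<^esub> f (rng \<Lambda> \<xi>) x)"
    using module_mapD(2)[OF assms x] hom_in_carrier[OF module_mapD(1)[OF assms] x(2)] rng_obj[OF x(1)] by simp
qed

lemma right_Hom_mult_closed: "f \<in> carrier H \<Longrightarrow> g \<in> carrier H \<Longrightarrow> f \<otimes>\<^bsub>H\<^esub> g \<in> carrier H"
  unfolding right_Hom_mult
  by (rule restrict_in_right_Hom[OF module_map_mult]) (auto intro: right_Hom_module_map)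

lemma right_Hom_one_closed: "\<one>\<^bsub>H\<^esub> \<in> carrier H"
  unfolding right_Hom_one by (rule restrict_in_right_Hom[OF module_map_one])

lemma comm_group_right_Hom: "comm_group H"
proof (rule comm_groupI)
  fix f g h assume fgh: "f \<in> carrier H" "g \<in> carrier H" "h \<in> carrier H"
  show "f \<otimes>\<^bsub>H\<^esub> g \<otimes>\<^bsub>H\<^esub> h = f \<otimes>\<^bsub>H\<^esub> (g \<otimes>\<^bsub>H\<^esub> h)"
    by (rule right_Hom_eqI[OF right_Hom_mult_closed[OF right_Hom_mult_closed]
          right_Hom_mult_closed[OF _ right_Hom_mult_closed]])
      (use fgh right_Hom_closed comm_groupE(3)[OF comm_group_fib] in \<open>auto simp: right_Hom_mult\<close>)
next
  fix f g assume fg: "f \<in> carrier H" "g \<in> carrier H"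
  show "f \<otimes>\<^bsub>H\<^esub> g = g \<otimes>\<^bsub>H\<^esub> f"
    unfolding right_Hom_mult
    by (intro restrict_ext comm_groupE(4)[OF comm_group_fib]) (use fg right_Hom_closed in auto)
next
  fix f assume f: "f \<in> carrier H"
  show "\<one>\<^bsub>H\<^esub> \<otimes>\<^bsub>H\<^esub> f = f"
    by (rule right_Hom_eqI[OF right_Hom_mult_closed[OF right_Hom_one_closed f] f])
      (use f right_Hom_closed comm_groupE(5)[OF comm_group_fib] in \<open>auto simp: right_Hom_mult right_Hom_one\<close>)
  let ?i = "\<lambda>v\<in>obj \<Lambda>. \<lambda>x\<in>carrier (fib M v). inv\<^bsub>fib N v\<^esub> f v x"
  have i: "?i \<in> carrier H" by (rule restrict_in_right_Hom[OF module_map_inv[OF right_Hom_module_map[OF f]]])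
  have "?i \<otimes>\<^bsub>H\<^esub> f = \<one>\<^bsub>H\<^esub>"
    by (rule right_Hom_eqI[OF right_Hom_mult_closed[OF i f] right_Hom_one_closed])
      (use f right_Hom_closed group.l_inv[OF comm_group.axioms(2)[OF comm_group_fib]]
        in \<open>auto simp: right_Hom_mult right_Hom_one\<close>)
  with i show "\<exists>y\<in>carrier H. y \<otimes>\<^bsub>H\<^esub> f = \<one>\<^bsub>H\<^esub>" by blast
qed (simp_all add: right_Hom_mult_closed right_Hom_one_closed)

end

lemma Hom_precomp_hom:
  assumes "k_graph k \<Lambda>" "right_module \<Lambda> L" "right_module \<Lambda> M" "right_module \<Lambda> N" and \<phi>: "module_map \<Lambda> L M \<phi>"
  shows "Hom_precomp \<Lambda> L \<phi> \<in> hom (right_Hom \<Lambda> M N) (right_Hom \<Lambda> L N)"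
proof -
  interpret k_graph k \<Lambda> by fact
  interpret MN: module_pair k \<Lambda> M N by unfold_locales fact+
  interpret LN: module_pair k \<Lambda> L N by unfold_locales fact+
  have \<phi>_closed: "\<phi> v x \<in> carrier (fib M v)" if "v \<in> obj \<Lambda>" "x \<in> carrier (fib L v)" for v x
    using hom_in_carrier[OF module_mapD(1)[OF \<phi> that(1)] that(2)] .
  show ?thesis
  proof (rule homI)
    show "Hom_precomp \<Lambda> L \<phi> f \<in> carrier LN.H" if "f \<in> carrier MN.H" for f
      unfolding Hom_precomp_def
      by (rule LN.restrict_in_right_Hom[OF module_map_compose[OF assms(1) \<phi> MN.right_Hom_module_map[OF that]]])
    show "Hom_precomp \<Lambda> L \<phi> (f \<otimes>\<^bsub>MN.H\<^esub> g) = Hom_precomp \<Lambda> L \<phi> f \<otimes>\<^bsub>LN.H\<^esub> Hom_precomp \<Lambda> L \<phi> g" for f g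
      unfolding Hom_precomp_def MN.right_Hom_mult LN.right_Hom_mult
      by (intro restrict_ext) (simp add: \<phi>_closed)
  qed
qed

section \<open>The complex of right modules of cubes\<close>
lemma fib_ZQ [simp]: "fib (ZQ k \<Lambda> n) v = free_Abelian_group (cubes k (tilde_graph \<Lambda> v) n)"
  by (simp add: ZQ_def)

lemma act_ZQ_frag_of [simp]: "act (ZQ k \<Lambda> n) \<xi> (frag_of (\<eta>, \<mu>)) = frag_of (\<eta>, cmp \<Lambda> \<mu> \<xi>)"
  by (simp add: ZQ_def)

context k_graph begin

lemma cube_src_obj: "\<xi> \<in> cubes k \<Lambda> n \<Longrightarrow> src \<Lambda> \<xi> \<in> obj \<Lambda>"
  by (simp add: cube_mor src_obj)

lemma basis_cube: "\<xi> \<in> cubes k \<Lambda> n \<Longrightarrow> (\<xi>, src \<Lambda> \<xi>) \<in> cubes k (tilde_graph \<Lambda> (src \<Lambda> \<xi>)) n"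
  by (simp add: tilde_cube_iff composable_src cube_mor src_of_obj src_obj)

text \<open>
  This is what makes the module of \<open>n\<close>-cubes free: every basis element of every fibre is the
  translate of a unique \<open>(\<eta>, s(\<eta>))\<close>, by the unique morphism \<open>\<mu>\<close>.
\<close>
lemma tilde_cube_act:
  assumes "(\<eta>, \<mu>) \<in> cubes k (tilde_graph \<Lambda> v) n"
  shows "frag_of (\<eta>, \<mu>) = act (ZQ k \<Lambda> m) \<mu> (frag_of (\<eta>, src \<Lambda> \<eta>))"
  using assms cmp_rng[of \<mu>] by (auto simp: tilde_cube_iff composable_def)

lemma tilde_face_cube:
  assumes "(\<eta>, \<mu>) \<in> cubes k (tilde_graph \<Lambda> v) n" "j \<in> {1..nat n}"
  shows "(face0 \<Lambda> j \<eta>, cmp \<Lambda> (last_edge \<Lambda> j \<eta>) \<mu>) \<in> cubes k (tilde_graph \<Lambda> v) (n - 1)"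
    "(face1 \<Lambda> j \<eta>, \<mu>) \<in> cubes k (tilde_graph \<Lambda> v) (n - 1)"
proof -
  have "v \<in> obj \<Lambda>" using assms src_obj by (auto simp: tilde_cube_iff composable_def)
  then interpret G: k_graph k "tilde_graph \<Lambda> v" by (rule k_graph_tilde_graph)
  show "(face0 \<Lambda> j \<eta>, cmp \<Lambda> (last_edge \<Lambda> j \<eta>) \<mu>) \<in> cubes k (tilde_graph \<Lambda> v) (n - 1)"
    "(face1 \<Lambda> j \<eta>, \<mu>) \<in> cubes k (tilde_graph \<Lambda> v) (n - 1)"
    using G.face_cube[OF assms] by (simp_all add: tilde_faces[OF assms])
qed

lemma ZQ_boundary_frag_of:
  assumes "(\<eta>, \<mu>) \<in> cubes k (tilde_graph \<Lambda> v) n"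
  shows "ZQ_boundary \<Lambda> n v (frag_of (\<eta>, \<mu>)) = alternating_product (fib (ZQ k \<Lambda> (n - 1)) v) (nat n)
    (\<lambda>i. frag_of (face0 \<Lambda> i \<eta>, cmp \<Lambda> (last_edge \<Lambda> i \<eta>) \<mu>)) (\<lambda>i. frag_of (face1 \<Lambda> i \<eta>, \<mu>))"
proof -
  have "v \<in> obj \<Lambda>" using assms src_obj by (auto simp: tilde_cube_iff composable_def)
  then interpret G: k_graph k "tilde_graph \<Lambda> v" by (rule k_graph_tilde_graph)
  have "ZQ_boundary \<Lambda> n v (frag_of (\<eta>, \<mu>)) = (\<Sum>i\<in>{1..nat n}. frag_cmul ((-1) ^ i)
      (frag_of (face0 \<Lambda> i \<eta>, cmp \<Lambda> (last_edge \<Lambda> i \<eta>) \<mu>) - frag_of (face1 \<Lambda> i \<eta>, \<mu>)))"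
    unfolding ZQ_boundary_def G.cube_boundary_frag_of
    by (rule sum.cong[OF refl]) (simp only: tilde_faces[OF assms])
  also have "\<dots> = alternating_product (fib (ZQ k \<Lambda> (n - 1)) v) (nat n)
    (\<lambda>i. frag_of (face0 \<Lambda> i \<eta>, cmp \<Lambda> (last_edge \<Lambda> i \<eta>) \<mu>)) (\<lambda>i. frag_of (face1 \<Lambda> i \<eta>, \<mu>))"
    unfolding fib_ZQ
    by (rule alternating_product_free_Abelian_group[symmetric]) (fact tilde_face_cube[OF assms])+
  finally show ?thesis .
qed

text \<open>
  The action changes second components on the right only, whereas taking faces multiplies them on the
  left; the two commute by associativity.
\<close>
lemma module_map_ZQ_boundary: "module_map \<Lambda> (ZQ k \<Lambda> n) (ZQ k \<Lambda> (n - 1)) (ZQ_boundary \<Lambda> n)"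
proof (rule module_mapI)
  let ?Q = "ZQ k \<Lambda> n" and ?R = "ZQ k \<Lambda> (n - 1)"
  have ab: "comm_group (fib ?R v)" for v by (simp add: abelian_free_Abelian_group)
  have hom: "ZQ_boundary \<Lambda> n v \<in> hom (fib ?Q v) (fib ?R v)" for v
    unfolding ZQ_boundary_def cube_boundary_def fib_ZQ
  proof (rule frag_extend_hom)
    fix p assume p: "p \<in> cubes k (tilde_graph \<Lambda> v) n"
    obtain \<eta> \<mu> where e: "p = (\<eta>, \<mu>)" by (cases p)
    have "ZQ_boundary \<Lambda> n v (frag_of p) \<in> carrier (fib ?R v)"
      unfolding e ZQ_boundary_frag_of[OF p[unfolded e]]
      by (rule alternating_product_closed[OF ab]) (use tilde_face_cube[OF p[unfolded e]] in auto)
    then show "Poly_Mapping.keys (\<Sum>j = 1..nat n. \<Sum>l = 0..1. frag_cmul ((- 1) ^ (j + l))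
        (frag_of (face (tilde_graph \<Lambda> v) l j p))) \<subseteq> cubes k (tilde_graph \<Lambda> v) (n - 1)"
      by (simp only: ZQ_boundary_def cube_boundary_def frag_extend_of fib_ZQ carrier_free_Abelian_group_iff)
  qed
  show "ZQ_boundary \<Lambda> n v \<in> hom (fib ?Q v) (fib ?R v)" if "v \<in> obj \<Lambda>" for v by (rule hom)
  fix \<xi> x assume \<xi>: "\<xi> \<in> mor \<Lambda>" and x: "x \<in> carrier (fib ?Q (rng \<Lambda> \<xi>))"
  have act: "act ?Q \<xi> \<in> hom (fib ?Q (rng \<Lambda> \<xi>)) (fib ?Q (src \<Lambda> \<xi>))"
    "act ?R \<xi> \<in> hom (fib ?R (rng \<Lambda> \<xi>)) (fib ?R (src \<Lambda> \<xi>))"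
    using right_moduleD(2)[OF right_module_ZQ \<xi>] by blast+
  have "(ZQ_boundary \<Lambda> n (src \<Lambda> \<xi>) \<circ> act ?Q \<xi>) x = (act ?R \<xi> \<circ> ZQ_boundary \<Lambda> n (rng \<Lambda> \<xi>)) x"
  proof (rule hom_free_Abelian_group_eqI[OF comm_group.axioms(2)[OF ab[of "src \<Lambda> \<xi>"]],
        where S = "cubes k (tilde_graph \<Lambda> (rng \<Lambda> \<xi>)) n" and x = x])
    show "ZQ_boundary \<Lambda> n (src \<Lambda> \<xi>) \<circ> act ?Q \<xi> \<in>
        hom (free_Abelian_group (cubes k (tilde_graph \<Lambda> (rng \<Lambda> \<xi>)) n)) (fib ?R (src \<Lambda> \<xi>))"
      using hom_compose[OF act(1) hom] by simp
    show "act ?R \<xi> \<circ> ZQ_boundary \<Lambda> n (rng \<Lambda> \<xi>) \<in>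
        hom (free_Abelian_group (cubes k (tilde_graph \<Lambda> (rng \<Lambda> \<xi>)) n)) (fib ?R (src \<Lambda> \<xi>))"
      using hom_compose[OF hom act(2)] by simp
    show "x \<in> carrier (free_Abelian_group (cubes k (tilde_graph \<Lambda> (rng \<Lambda> \<xi>)) n))" using x by simp
    fix p assume p: "p \<in> cubes k (tilde_graph \<Lambda> (rng \<Lambda> \<xi>)) n"
    obtain \<eta> \<mu> where e: "p = (\<eta>, \<mu>)" by (cases p)
    note p = p[unfolded e]
    have c: "\<eta> \<in> cubes k \<Lambda> n" "composable \<Lambda> \<eta> \<mu>" "composable \<Lambda> \<mu> \<xi>"
      using p \<xi> by (auto simp: tilde_cube_iff composable_def)
    have p': "(\<eta>, cmp \<Lambda> \<mu> \<xi>) \<in> cubes k (tilde_graph \<Lambda> (src \<Lambda> \<xi>)) n"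
      using c composable_cmp_right src_cmp by (simp add: tilde_cube_iff)
    have "act ?R \<xi> (ZQ_boundary \<Lambda> n (rng \<Lambda> \<xi>) (frag_of p)) =
      alternating_product (fib ?R (src \<Lambda> \<xi>)) (nat n)
        (\<lambda>i. act ?R \<xi> (frag_of (face0 \<Lambda> i \<eta>, cmp \<Lambda> (last_edge \<Lambda> i \<eta>) \<mu>))) (\<lambda>i. act ?R \<xi> (frag_of (face1 \<Lambda> i \<eta>, \<mu>)))"
      unfolding e ZQ_boundary_frag_of[OF p]
      by (rule hom_alternating_product[OF ab ab act(2)]) (use tilde_face_cube[OF p] in auto)
    also have "\<dots> = ZQ_boundary \<Lambda> n (src \<Lambda> \<xi>) (act ?Q \<xi> (frag_of p))"
      unfolding e act_ZQ_frag_of ZQ_boundary_frag_of[OF p']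
    proof (rule alternating_product_cong[OF ab])
      fix i assume i: "i \<in> {1..nat n}"
      have "composable \<Lambda> (last_edge \<Lambda> i \<eta>) \<mu>"
        using cube_face_src_rng[OF c(1) i] c(2) by (simp add: composable_def)
      then show "frag_of (face0 \<Lambda> i \<eta>, cmp \<Lambda> (cmp \<Lambda> (last_edge \<Lambda> i \<eta>) \<mu>) \<xi>) =
          frag_of (face0 \<Lambda> i \<eta>, cmp \<Lambda> (last_edge \<Lambda> i \<eta>) (cmp \<Lambda> \<mu> \<xi>))"
        using cmp_assoc c(3) by simp
    qed (use tilde_face_cube[OF p'] in auto)
    finally show "(ZQ_boundary \<Lambda> n (src \<Lambda> \<xi>) \<circ> act ?Q \<xi>) (frag_of p) =
        (act ?R \<xi> \<circ> ZQ_boundary \<Lambda> n (rng \<Lambda> \<xi>)) (frag_of p)" by simp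
  qed
  then show "ZQ_boundary \<Lambda> n (src \<Lambda> \<xi>) (act ?Q \<xi> x) = act ?R \<xi> (ZQ_boundary \<Lambda> n (rng \<Lambda> \<xi>) x)" by simp
qed

lemma ZQ_boundary_ZQ_boundary:
  assumes "v \<in> obj \<Lambda>" "x \<in> carrier (fib (ZQ k \<Lambda> n) v)"
  shows "ZQ_boundary \<Lambda> (n - 1) v (ZQ_boundary \<Lambda> n v x) = 0"
  using k_graph.cube_boundary_cube_boundary[OF k_graph_tilde_graph[OF assms(1)]] assms(2)
  by (simp add: ZQ_boundary_def)

end

section \<open>Transport of complexes along isomorphisms\<close>
text \<open>
  It suffices that \<open>d\<close> lands in the right group and corresponds to \<open>d'\<close>: since
  \<open>\<phi>\<close> is injective, additivity of \<open>d\<close> and \<open>d d = 0\<close> can be checked in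
  the complex \<open>D\<close>.
\<close>
lemma chain_isomorphicI:
  assumes "\<And>n. comm_group (C n)" "chain_complex D d'"
    and iso: "\<And>n. \<phi> n \<in> iso (C n) (D n)"
    and closed: "\<And>n x. x \<in> carrier (C n) \<Longrightarrow> d n x \<in> carrier (C (n - 1))"
    and comm: "\<And>n x. x \<in> carrier (C n) \<Longrightarrow> \<phi> (n - 1) (d n x) = d' n (\<phi> n x)"
  shows "chain_isomorphic C d D d'"
proof -
  have \<phi>: "\<phi> n \<in> hom (C n) (D n)" and inj: "inj_on (\<phi> n) (carrier (C n))" for n
    using iso[of n] by (auto simp: iso_iff)
  have C: "group (C n)" and D: "group (D n)" for n
    using assms(1,2) comm_group.axioms(2) by (auto simp: chain_complex_def)
  have d': "d' n \<in> hom (D n) (D (n - 1))" "\<And>y. y \<in> carrier (D n) \<Longrightarrow> d' (n - 1) (d' n y) = \<one>\<^bsub>D (n - 1 - 1)\<^esub>" for n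
    using assms(2) by (auto simp: chain_complex_def)
  have mult: "x \<otimes>\<^bsub>C n\<^esub> y \<in> carrier (C n)" if "x \<in> carrier (C n)" "y \<in> carrier (C n)" for n x y
    using monoid.m_closed[OF group.is_monoid[OF C] that] .
  have "d n \<in> hom (C n) (C (n - 1))" for n
  proof (rule homI)
    fix x y assume xy: "x \<in> carrier (C n)" "y \<in> carrier (C n)"
    have "\<phi> (n - 1) (d n (x \<otimes>\<^bsub>C n\<^esub> y)) = \<phi> (n - 1) (d n x \<otimes>\<^bsub>C (n - 1)\<^esub> d n y)"
      using xy mult closed hom_in_carrier[OF \<phi>]
      by (simp add: comm hom_mult[OF \<phi>] hom_mult[OF d'(1)])
    then show "d n (x \<otimes>\<^bsub>C n\<^esub> y) = d n x \<otimes>\<^bsub>C (n - 1)\<^esub> d n y"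
      using inj_onD[OF inj] xy mult closed by blast
  qed (rule closed)
  moreover have "d (n - 1) (d n x) = \<one>\<^bsub>C (n - 1 - 1)\<^esub>" if x: "x \<in> carrier (C n)" for n x
  proof -
    have "\<phi> (n - 1 - 1) (d (n - 1) (d n x)) = \<phi> (n - 1 - 1) \<one>\<^bsub>C (n - 1 - 1)\<^esub>"
      unfolding comm[OF closed[OF x]] comm[OF x] hom_one[OF \<phi> C D]
      by (rule d'(2)[OF hom_in_carrier[OF \<phi> x]])
    then show ?thesis
      using inj_onD[OF inj] closed x monoid.one_closed[OF group.is_monoid[OF C]] by blast
  qed
  ultimately have "chain_complex C d" using assms(1) by (simp add: chain_complex_def)
  then show ?thesis using assms(2) iso comm unfolding chain_isomorphic_def by blast
qed

text \<open>
  The isomorphism is given in the direction from \<open>D\<close> to \<open>C\<close>. For cochains this is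
  the explicit direction: restricting a module map to a basis is a formula, extending it is not.
\<close>
lemma cochain_isomorphicI:
  assumes "\<And>n. comm_group (C n)" "cochain_complex D d'"
    and iso: "\<And>n. \<psi> n \<in> iso (D n) (C n)"
    and comm: "\<And>n y. y \<in> carrier (D n) \<Longrightarrow> \<psi> (n + 1) (d' n y) = d n (\<psi> n y)"
  shows "cochain_isomorphic C d D d'"
proof -
  have \<psi>: "\<psi> n \<in> hom (D n) (C n)" and bij: "bij_betw (\<psi> n) (carrier (D n)) (carrier (C n))" for n
    using iso[of n] by (auto simp: iso_def)
  have C: "group (C n)" and D: "group (D n)" for n
    using assms(1,2) comm_group.axioms(2) by (auto simp: cochain_complex_def)
  have d': "d' n \<in> hom (D n) (D (n + 1))" "\<And>y. y \<in> carrier (D n) \<Longrightarrow> d' (n + 1) (d' n y) = \<one>\<^bsub>D (n + 1 + 1)\<^esub>" for n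
    using assms(2) by (auto simp: cochain_complex_def)
  define \<phi> where "\<phi> n = inv_into (carrier (D n)) (\<psi> n)" for n
  have \<phi>: "\<phi> n \<in> iso (C n) (D n)" for n
    unfolding \<phi>_def by (rule group.iso_set_sym[OF D iso])
  have \<phi>_closed: "\<phi> n x \<in> carrier (D n)" and \<psi>\<phi>: "\<psi> n (\<phi> n x) = x" if "x \<in> carrier (C n)" for n x
    using that bij[of n] by (auto simp: \<phi>_def bij_betw_def inv_into_into f_inv_into_f)
  have \<phi>\<psi>: "\<phi> n (\<psi> n y) = y" if "y \<in> carrier (D n)" for n y
    using that bij[of n] by (simp add: \<phi>_def bij_betw_def)
  have d: "d n x = \<psi> (n + 1) (d' n (\<phi> n x))" if "x \<in> carrier (C n)" for n x
    using comm[OF \<phi>_closed[OF that]] \<psi>\<phi>[OF that] by simp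
  have closed: "d n x \<in> carrier (C (n + 1))" if "x \<in> carrier (C n)" for n x
    using d[OF that] \<phi>_closed[OF that] hom_in_carrier[OF d'(1)] hom_in_carrier[OF \<psi>] by simp
  have \<phi>_comm: "\<phi> (n + 1) (d n x) = d' n (\<phi> n x)" if "x \<in> carrier (C n)" for n x
    unfolding d[OF that] by (rule \<phi>\<psi>) (use \<phi>_closed[OF that] hom_in_carrier[OF d'(1)] in blast)
  have "d n \<in> hom (C n) (C (n + 1))" for n
  proof (rule homI)
    fix x y assume xy: "x \<in> carrier (C n)" "y \<in> carrier (C n)"
    have "\<phi> n (x \<otimes>\<^bsub>C n\<^esub> y) = \<phi> n x \<otimes>\<^bsub>D n\<^esub> \<phi> n y"
      using \<phi>[of n] xy by (simp add: iso_def hom_mult)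
    then show "d n (x \<otimes>\<^bsub>C n\<^esub> y) = d n x \<otimes>\<^bsub>C (n + 1)\<^esub> d n y"
      using xy \<phi>_closed hom_in_carrier[OF d'(1)] monoid.m_closed[OF group.is_monoid[OF C] xy]
      by (simp add: d hom_mult[OF d'(1)] hom_mult[OF \<psi>])
  qed (rule closed)
  moreover have "d (n + 1) (d n x) = \<one>\<^bsub>C (n + 1 + 1)\<^esub>" if x: "x \<in> carrier (C n)" for n x
    using d[OF closed[OF x]] \<phi>_comm[OF x] d'(2)[OF \<phi>_closed[OF x]] hom_one[OF \<psi> D C] by simp
  ultimately have "cochain_complex C d" using assms(1) by (simp add: cochain_complex_def)
  then show ?thesis using assms(2) \<phi> \<phi>_comm unfolding cochain_isomorphic_def by blast
qed

section \<open>Chains with coefficients\<close>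
lemma cub_gen_eq: "cub_gen k \<Lambda> N n = sum_gen (cubes k \<Lambda> n) (\<lambda>\<xi>. fib N (src \<Lambda> \<xi>))"
  by (simp add: cub_gen_def sum_gen_def fun_eq_iff)

lemma cub_boundary_gen_eq:
  "cub_boundary_gen k \<Lambda> N n \<xi> a = alternating_product (cub_chains k \<Lambda> N (n - 1)) (nat n)
    (\<lambda>i. cub_gen k \<Lambda> N (n - 1) (face0 \<Lambda> i \<xi>) (act N (last_edge \<Lambda> i \<xi>) a))
    (\<lambda>i. cub_gen k \<Lambda> N (n - 1) (face1 \<Lambda> i \<xi>) a)"
  by (simp add: cub_boundary_gen_def alternating_product_def Let_def)

locale left_module_kgraph = k_graph k \<Lambda> for k :: nat and \<Lambda> :: "'a kgraph" +
  fixes N :: "('a, 'n) gmodule"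
  assumes N: "left_module \<Lambda> N"
begin

abbreviation "C \<equiv> cub_chains k \<Lambda> N"
abbreviation "gen \<equiv> cub_gen k \<Lambda> N"
abbreviation "Q \<equiv> ZQ k \<Lambda>"
abbreviation "T n \<equiv> tensor \<Lambda> (Q n) N"
abbreviation "pure n \<equiv> pure_tensor \<Lambda> (Q n) N"

lemma tensor_product_ZQ: "tensor_product k \<Lambda> (Q n) N"
  by unfold_locales (rule right_module_ZQ, rule N)

lemma comm_group_summand: "\<xi> \<in> cubes k \<Lambda> n \<Longrightarrow> comm_group (fib N (src \<Lambda> \<xi>))"
  using left_moduleD(1)[OF N cube_src_obj] .

lemma comm_group_chains: "comm_group (C n)"
  unfolding cub_chains_def by (rule comm_group_sum_group) (rule comm_group_summand)

lemma gen_hom: "\<xi> \<in> cubes k \<Lambda> n \<Longrightarrow> gen n \<xi> \<in> hom (fib N (src \<Lambda> \<xi>)) (C n)"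
  unfolding cub_chains_def cub_gen_eq by (rule sum_gen_hom) (rule comm_group_summand)

lemmas gen_closed = hom_in_carrier[OF gen_hom]

lemma act_closed: "\<xi> \<in> mor \<Lambda> \<Longrightarrow> a \<in> carrier (fib N (src \<Lambda> \<xi>)) \<Longrightarrow> act N \<xi> a \<in> carrier (fib N (rng \<Lambda> \<xi>))"
  using hom_in_carrier[OF left_moduleD(2)[OF N]] .

lemma cube_gen_hom:
  assumes "v \<in> obj \<Lambda>" "a \<in> carrier (fib N v)"
  shows "\<exists>h. h \<in> hom (fib (Q n) v) (C n) \<and>
    (\<forall>(\<eta>, \<mu>) \<in> cubes k (tilde_graph \<Lambda> v) n. h (frag_of (\<eta>, \<mu>)) = gen n \<eta> (act N \<mu> a))"
proof -
  have "(\<lambda>(\<eta>, \<mu>). gen n \<eta> (act N \<mu> a)) ` cubes k (tilde_graph \<Lambda> v) n \<subseteq> carrier (C n)"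
    using assms by (auto simp: tilde_cube_iff composable_def intro!: gen_closed act_closed)
  then obtain h where "h \<in> hom (free_Abelian_group (cubes k (tilde_graph \<Lambda> v) n)) (C n)"
    "\<And>p. p \<in> cubes k (tilde_graph \<Lambda> v) n \<Longrightarrow> h (frag_of p) = (\<lambda>(\<eta>, \<mu>). gen n \<eta> (act N \<mu> a)) p"
    using comm_group.free_Abelian_group_universal[OF comm_group_chains] by blast
  then show ?thesis by (intro exI[of _ h]) auto
qed

text \<open>
  The inverse isomorphism: it sends \<open>(\<eta>, \<mu>) \<otimes> a\<close> to
  \<open>(\<eta>, \<mu> \<cdot> a)\<close>. For fixed \<open>a\<close> this is extended linearly from
  the basis of pairs. Additivity in \<open>a\<close> and compatibility with the action are equations
  between homomorphisms in the first factor, so they only need to be checked on pairs.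
\<close>
lemma tensor_to_chains:
  obtains \<psi> where "\<psi> \<in> hom (T n) (C n)"
    "\<And>v \<eta> \<mu> a. (\<eta>, \<mu>) \<in> cubes k (tilde_graph \<Lambda> v) n \<Longrightarrow> a \<in> carrier (fib N v) \<Longrightarrow>
      \<psi> (pure n v (frag_of (\<eta>, \<mu>)) a) = gen n \<eta> (act N \<mu> a)"
proof -
  interpret TQ: tensor_product k \<Lambda> "Q n" N by (rule tensor_product_ZQ)
  interpret C: comm_group "C n" by (rule comm_group_chains)
  obtain g where g: "g v a \<in> hom (fib (Q n) v) (C n)"
    and g_cube: "(\<eta>, \<mu>) \<in> cubes k (tilde_graph \<Lambda> v) n \<Longrightarrow> g v a (frag_of (\<eta>, \<mu>)) = gen n \<eta> (act N \<mu> a)"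
    if "v \<in> obj \<Lambda>" "a \<in> carrier (fib N v)" for v a \<eta> \<mu>
  proof -
    have "\<exists>g. \<forall>v a. v \<in> obj \<Lambda> \<longrightarrow> a \<in> carrier (fib N v) \<longrightarrow> g v a \<in> hom (fib (Q n) v) (C n) \<and>
      (\<forall>(\<eta>, \<mu>) \<in> cubes k (tilde_graph \<Lambda> v) n. g v a (frag_of (\<eta>, \<mu>)) = gen n \<eta> (act N \<mu> a))"
      using cube_gen_hom[of _ _ n] by (intro choice allI) (blast intro: choice)
    then show thesis using that by fast
  qed
  have ext: "h m = h' m"
    if "h \<in> hom (fib (Q n) v) (C n)" "h' \<in> hom (fib (Q n) v) (C n)" "m \<in> carrier (fib (Q n) v)"
      and "\<And>\<eta> \<mu>. (\<eta>, \<mu>) \<in> cubes k (tilde_graph \<Lambda> v) n \<Longrightarrow> h (frag_of (\<eta>, \<mu>)) = h' (frag_of (\<eta>, \<mu>))"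
    for h h' v m
    by (rule hom_free_Abelian_group_eqI[OF C.is_group that(1,2)[unfolded fib_ZQ] _ that(3)[unfolded fib_ZQ]])
      (use that(4) in force)
  obtain \<psi> where \<psi>: "\<psi> \<in> hom (T n) (C n)"
    "\<And>v m a. v \<in> obj \<Lambda> \<Longrightarrow> m \<in> carrier (fib (Q n) v) \<Longrightarrow> a \<in> carrier (fib N v) \<Longrightarrow> \<psi> (pure n v m a) = g v a m"
  proof (rule TQ.tensor_universal[OF comm_group_chains, where f = "\<lambda>v m a. g v a m"])
    show "(\<lambda>m. g v a m) \<in> hom (fib (Q n) v) (C n)" if "v \<in> obj \<Lambda>" "a \<in> carrier (fib N v)" for v a
      using g[OF that] .
    show "(\<lambda>a. g v a m) \<in> hom (fib N v) (C n)" if v: "v \<in> obj \<Lambda>" and m: "m \<in> carrier (fib (Q n) v)" for v m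
    proof (rule homI)
      show "g v a m \<in> carrier (C n)" if "a \<in> carrier (fib N v)" for a
        using hom_in_carrier[OF g[OF v that] m] .
      fix a b assume ab: "a \<in> carrier (fib N v)" "b \<in> carrier (fib N v)"
      have ab': "a \<otimes>\<^bsub>fib N v\<^esub> b \<in> carrier (fib N v)"
        using comm_groupE(1)[OF left_moduleD(1)[OF N v] ab] .
      show "g v (a \<otimes>\<^bsub>fib N v\<^esub> b) m = g v a m \<otimes>\<^bsub>C n\<^esub> g v b m"
      proof (rule ext[OF g[OF v ab'] C.hom_group_mult[OF g[OF v ab(1)] g[OF v ab(2)]] m])
        fix \<eta> \<mu> assume p: "(\<eta>, \<mu>) \<in> cubes k (tilde_graph \<Lambda> v) n"
        then have c: "\<eta> \<in> cubes k \<Lambda> n" "\<mu> \<in> mor \<Lambda>" "src \<Lambda> \<mu> = v" "rng \<Lambda> \<mu> = src \<Lambda> \<eta>"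
          by (auto simp: tilde_cube_iff composable_def)
        have "act N \<mu> (a \<otimes>\<^bsub>fib N v\<^esub> b) = act N \<mu> a \<otimes>\<^bsub>fib N (src \<Lambda> \<eta>)\<^esub> act N \<mu> b"
          using hom_mult[OF left_moduleD(2)[OF N c(2)], of a b] ab c by simp
        then show "g v (a \<otimes>\<^bsub>fib N v\<^esub> b) (frag_of (\<eta>, \<mu>)) = g v a (frag_of (\<eta>, \<mu>)) \<otimes>\<^bsub>C n\<^esub> g v b (frag_of (\<eta>, \<mu>))"
          using hom_mult[OF gen_hom[OF c(1)], of "act N \<mu> a" "act N \<mu> b"] act_closed[OF c(2)] ab c
          by (simp add: g_cube[OF v _ p] ab')
      qed
    qed
    fix \<xi> m a assume *: "\<xi> \<in> mor \<Lambda>" "m \<in> carrier (fib (Q n) (rng \<Lambda> \<xi>))" "a \<in> carrier (fib N (src \<Lambda> \<xi>))"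
    have v: "src \<Lambda> \<xi> \<in> obj \<Lambda>" "rng \<Lambda> \<xi> \<in> obj \<Lambda>" using src_obj rng_obj * by auto
    have "(g (src \<Lambda> \<xi>) a \<circ> act (Q n) \<xi>) m = g (rng \<Lambda> \<xi>) (act N \<xi> a) m"
    proof (rule ext[OF hom_compose[OF right_moduleD(2)[OF right_module_ZQ *(1)] g[OF v(1) *(3)]]
            g[OF v(2) act_closed[OF *(1,3)]] *(2)])
      fix \<eta> \<mu> assume p: "(\<eta>, \<mu>) \<in> cubes k (tilde_graph \<Lambda> (rng \<Lambda> \<xi>)) n"
      then have c: "\<eta> \<in> cubes k \<Lambda> n" "composable \<Lambda> \<eta> \<mu>" "composable \<Lambda> \<mu> \<xi>"
        using *(1) by (auto simp: tilde_cube_iff composable_def)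
      have p': "(\<eta>, cmp \<Lambda> \<mu> \<xi>) \<in> cubes k (tilde_graph \<Lambda> (src \<Lambda> \<xi>)) n"
        using c composable_cmp_right src_cmp by (simp add: tilde_cube_iff)
      show "(g (src \<Lambda> \<xi>) a \<circ> act (Q n) \<xi>) (frag_of (\<eta>, \<mu>)) = g (rng \<Lambda> \<xi>) (act N \<xi> a) (frag_of (\<eta>, \<mu>))"
        using left_moduleD(4)[OF N c(3) *(3)]
        by (simp add: g_cube[OF v(1) *(3) p'] g_cube[OF v(2) act_closed[OF *(1,3)] p])
    qed
    then show "g (src \<Lambda> \<xi>) a (act (Q n) \<xi> m) = g (rng \<Lambda> \<xi>) (act N \<xi> a) m" by simp
  qed auto
  show thesis
  proof (rule that[OF \<psi>(1)])
    fix v \<eta> \<mu> a assume p: "(\<eta>, \<mu>) \<in> cubes k (tilde_graph \<Lambda> v) n" and a: "a \<in> carrier (fib N v)"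
    have v: "v \<in> obj \<Lambda>" using p src_obj by (auto simp: tilde_cube_iff composable_def)
    show "\<psi> (pure n v (frag_of (\<eta>, \<mu>)) a) = gen n \<eta> (act N \<mu> a)"
      using \<psi>(2)[OF v _ a, of "frag_of (\<eta>, \<mu>)"] g_cube[OF v a p] p by simp
  qed
qed

lemma pure_cube:
  assumes "(\<eta>, \<mu>) \<in> cubes k (tilde_graph \<Lambda> v) n" "a \<in> carrier (fib N v)"
  shows "pure n v (frag_of (\<eta>, \<mu>)) a = pure n (src \<Lambda> \<eta>) (frag_of (\<eta>, src \<Lambda> \<eta>)) (act N \<mu> a)"
proof -
  interpret TQ: tensor_product k \<Lambda> "Q n" N by (rule tensor_product_ZQ)
  have c: "\<eta> \<in> cubes k \<Lambda> n" "\<mu> \<in> mor \<Lambda>" "src \<Lambda> \<mu> = v" "rng \<Lambda> \<mu> = src \<Lambda> \<eta>"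
    using assms by (auto simp: tilde_cube_iff composable_def)
  have "pure n (src \<Lambda> \<mu>) (act (Q n) \<mu> (frag_of (\<eta>, src \<Lambda> \<eta>))) a =
    pure n (rng \<Lambda> \<mu>) (frag_of (\<eta>, src \<Lambda> \<eta>)) (act N \<mu> a)"
    by (rule TQ.pure_act[OF c(2)]) (use c basis_cube assms(2) in auto)
  then show ?thesis using tilde_cube_act[OF assms(1), of n] c by simp
qed

text \<open>
  Both composites are checked on generators. For pure tensors with a pair as first factor, the
  composite is the identity because \<open>\<mu>\<close> can be moved across the tensor sign.
\<close>
lemma chains_iso_tensor:
  obtains \<phi> where "\<phi> \<in> iso (C n) (T n)"
    "\<And>\<xi> a. \<xi> \<in> cubes k \<Lambda> n \<Longrightarrow> a \<in> carrier (fib N (src \<Lambda> \<xi>)) \<Longrightarrow>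
      \<phi> (gen n \<xi> a) = pure n (src \<Lambda> \<xi>) (frag_of (\<xi>, src \<Lambda> \<xi>)) a"
proof -
  interpret TQ: tensor_product k \<Lambda> "Q n" N by (rule tensor_product_ZQ)
  obtain \<phi> where \<phi>: "\<phi> \<in> hom (C n) (T n)"
    "\<And>\<xi> a. \<xi> \<in> cubes k \<Lambda> n \<Longrightarrow> a \<in> carrier (fib N (src \<Lambda> \<xi>)) \<Longrightarrow>
      \<phi> (gen n \<xi> a) = pure n (src \<Lambda> \<xi>) (frag_of (\<xi>, src \<Lambda> \<xi>)) a"
  proof -
    have pure_hom: "pure n (src \<Lambda> \<xi>) (frag_of (\<xi>, src \<Lambda> \<xi>)) \<in> hom (fib N (src \<Lambda> \<xi>)) (T n)"
      if "\<xi> \<in> cubes k \<Lambda> n" for \<xi>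
      by (rule TQ.pure_hom_right) (use that basis_cube cube_src_obj in auto)
    show thesis
      by (rule sum_group_universal[where I = "cubes k \<Lambda> n" and G = "\<lambda>\<xi>. fib N (src \<Lambda> \<xi>)"
            and H = "T n" and f = "\<lambda>\<xi>. pure n (src \<Lambda> \<xi>) (frag_of (\<xi>, src \<Lambda> \<xi>))"])
        (use comm_group_summand TQ.comm_group_tensor pure_hom that in \<open>auto simp: cub_chains_def cub_gen_eq\<close>)
  qed
  obtain \<psi> where \<psi>: "\<psi> \<in> hom (T n) (C n)"
    "\<And>v \<eta> \<mu> a. (\<eta>, \<mu>) \<in> cubes k (tilde_graph \<Lambda> v) n \<Longrightarrow> a \<in> carrier (fib N v) \<Longrightarrow>
      \<psi> (pure n v (frag_of (\<eta>, \<mu>)) a) = gen n \<eta> (act N \<mu> a)"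
    using tensor_to_chains by blast
  have "bij_betw \<phi> (carrier (C n)) (carrier (T n))"
  proof (rule bij_betwI[where g = \<psi>])
    show "\<phi> \<in> carrier (C n) \<rightarrow> carrier (T n)" "\<psi> \<in> carrier (T n) \<rightarrow> carrier (C n)"
      using \<phi>(1) \<psi>(1) by (auto simp: hom_def)
    fix x assume x: "x \<in> carrier (C n)"
    have "(\<psi> \<circ> \<phi>) x = (\<lambda>x. x) x"
      unfolding cub_chains_def
    proof (rule hom_sum_group_eqI[where I = "cubes k \<Lambda> n" and G = "\<lambda>\<xi>. fib N (src \<Lambda> \<xi>)" and H = "C n" and x = x])
      show "\<psi> \<circ> \<phi> \<in> hom (sum_group (cubes k \<Lambda> n) (\<lambda>\<xi>. fib N (src \<Lambda> \<xi>))) (C n)"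
        using hom_compose[OF \<phi>(1) \<psi>(1)] by (simp add: cub_chains_def)
      show "(\<lambda>x. x) \<in> hom (sum_group (cubes k \<Lambda> n) (\<lambda>\<xi>. fib N (src \<Lambda> \<xi>))) (C n)"
        using iso_set_refl[of "C n"] by (simp add: cub_chains_def iso_def)
      show "x \<in> carrier (sum_group (cubes k \<Lambda> n) (\<lambda>\<xi>. fib N (src \<Lambda> \<xi>)))" using x by (simp add: cub_chains_def)
      show "(\<psi> \<circ> \<phi>) (sum_gen (cubes k \<Lambda> n) (\<lambda>\<xi>. fib N (src \<Lambda> \<xi>)) \<xi> a) = sum_gen (cubes k \<Lambda> n) (\<lambda>\<xi>. fib N (src \<Lambda> \<xi>)) \<xi> a"
        if "\<xi> \<in> cubes k \<Lambda> n" "a \<in> carrier (fib N (src \<Lambda> \<xi>))" for \<xi> a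
        using \<phi>(2)[OF that] \<psi>(2)[OF basis_cube[OF that(1)] that(2)]
          left_moduleD(3)[OF N cube_src_obj[OF that(1)] that(2)] by (simp add: cub_gen_eq)
    qed (auto simp: comm_group_chains comm_group_summand)
    then show "\<psi> (\<phi> x) = x" by simp
  next
    fix X assume X: "X \<in> carrier (T n)"
    have "(\<phi> \<circ> \<psi>) X = (\<lambda>X. X) X"
    proof (rule TQ.hom_tensor_eqI[OF comm_group.axioms(2)[OF TQ.comm_group_tensor] hom_compose[OF \<psi>(1) \<phi>(1)] _ _ X])
      show id: "(\<lambda>X. X) \<in> hom (T n) (T n)" using iso_set_refl[of "T n"] by (simp add: iso_def)
      fix v m a assume v: "v \<in> obj \<Lambda>" and m: "m \<in> carrier (fib (Q n) v)" and a: "a \<in> carrier (fib N v)"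
      have "((\<phi> \<circ> \<psi>) \<circ> (\<lambda>m. pure n v m a)) m = (\<lambda>m. pure n v m a) m"
      proof (rule hom_free_Abelian_group_eqI[OF comm_group.axioms(2)[OF TQ.comm_group_tensor]
              hom_compose[OF TQ.pure_hom_left[OF v a] hom_compose[OF \<psi>(1) \<phi>(1)], unfolded fib_ZQ]
              TQ.pure_hom_left[OF v a, unfolded fib_ZQ] _ m[unfolded fib_ZQ]])
        fix p assume p: "p \<in> cubes k (tilde_graph \<Lambda> v) n"
        obtain \<eta> \<mu> where e: "p = (\<eta>, \<mu>)" by (cases p)
        note p = p[unfolded e]
        then have c: "\<eta> \<in> cubes k \<Lambda> n" "\<mu> \<in> mor \<Lambda>" "src \<Lambda> \<mu> = v" "rng \<Lambda> \<mu> = src \<Lambda> \<eta>"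
          by (auto simp: tilde_cube_iff composable_def)
        show "((\<phi> \<circ> \<psi>) \<circ> (\<lambda>m. pure n v m a)) (frag_of p) = pure n v (frag_of p) a"
          using \<psi>(2)[OF p a] \<phi>(2)[OF c(1), of "act N \<mu> a"] act_closed[OF c(2)] a c pure_cube[OF p a] by (simp add: e)
      qed
      then show "(\<phi> \<circ> \<psi>) (pure n v m a) = pure n v m a" by simp
    qed
    then show "\<phi> (\<psi> X) = X" by simp
  qed
  with \<phi> show thesis using that by (simp add: iso_def)
qed

lemma chain_complex_tensor: "chain_complex (ZQ_tensor k \<Lambda> N) (ZQ_tensor_boundary k \<Lambda> N)"
  unfolding chain_complex_def
proof (intro allI conjI ballI)
  fix n
  interpret T: tensor_product k \<Lambda> "Q n" N by (rule tensor_product_ZQ)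
  interpret T2: tensor_product k \<Lambda> "Q (n - 1 - 1)" N by (rule tensor_product_ZQ)
  note tm = tensor_map_properties[OF k_graph_axioms right_module_ZQ right_module_ZQ N module_map_ZQ_boundary]
  show "comm_group (ZQ_tensor k \<Lambda> N n)" unfolding ZQ_tensor_def by (rule T.comm_group_tensor)
  show d: "ZQ_tensor_boundary k \<Lambda> N n \<in> hom (ZQ_tensor k \<Lambda> N n) (ZQ_tensor k \<Lambda> N (n - 1))"
    unfolding ZQ_tensor_def ZQ_tensor_boundary_def by (rule tm(1))
  fix X assume X: "X \<in> carrier (ZQ_tensor k \<Lambda> N n)"
  let ?d = "ZQ_tensor_boundary k \<Lambda> N"
  have T2: "group (T (n - 1 - 1))" using comm_group.axioms(2)[OF T2.comm_group_tensor] .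
  have "(?d (n - 1) \<circ> ?d n) X = (\<lambda>_. \<one>\<^bsub>T (n - 1 - 1)\<^esub>) X"
  proof (rule T.hom_tensor_eqI[OF T2, where X = X])
    show "?d (n - 1) \<circ> ?d n \<in> hom (T n) (T (n - 1 - 1))"
      unfolding ZQ_tensor_boundary_def by (rule hom_compose[OF tm(1) tm(1)])
    show "(\<lambda>_. \<one>\<^bsub>T (n - 1 - 1)\<^esub>) \<in> hom (T n) (T (n - 1 - 1))"
      using group.is_monoid[OF T2] by (simp add: hom_def monoid.one_closed monoid.l_one)
    show "X \<in> carrier (T n)" using X by (simp only: ZQ_tensor_def)
    fix v m a assume *: "v \<in> obj \<Lambda>" "m \<in> carrier (fib (Q n) v)" "a \<in> carrier (fib N v)"
    have m': "ZQ_boundary \<Lambda> n v m \<in> carrier (fib (Q (n - 1)) v)"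
      using hom_in_carrier[OF module_mapD(1)[OF module_map_ZQ_boundary *(1)] *(2)] .
    have "(?d (n - 1) \<circ> ?d n) (pure n v m a) =
        pure (n - 1 - 1) v (ZQ_boundary \<Lambda> (n - 1) v (ZQ_boundary \<Lambda> n v m)) a"
      unfolding ZQ_tensor_boundary_def comp_def tm(2)[OF *] by (rule tm(2)[OF *(1) m' *(3)])
    also have "\<dots> = pure (n - 1 - 1) v \<one>\<^bsub>fib (Q (n - 1 - 1)) v\<^esub> a"
      unfolding ZQ_boundary_ZQ_boundary[OF *(1,2)] fib_ZQ one_free_Abelian_group ..
    also have "\<dots> = \<one>\<^bsub>T (n - 1 - 1)\<^esub>"
      by (rule hom_one[OF T2.pure_hom_left[OF *(1,3)] _ T2]) simp
    finally show "(?d (n - 1) \<circ> ?d n) (pure n v m a) = \<one>\<^bsub>T (n - 1 - 1)\<^esub>" .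
  qed
  then show "?d (n - 1) (?d n X) = \<one>\<^bsub>ZQ_tensor k \<Lambda> N (n - 1 - 1)\<^esub>"
    by (simp only: ZQ_tensor_def comp_def)
qed

lemma cub_boundary_gen_closed:
  assumes "\<xi> \<in> cubes k \<Lambda> n" "a \<in> carrier (fib N (src \<Lambda> \<xi>))" "i \<in> {1..nat n}"
  shows "act N (last_edge \<Lambda> i \<xi>) a \<in> carrier (fib N (src \<Lambda> (face0 \<Lambda> i \<xi>)))"
    "gen (n - 1) (face0 \<Lambda> i \<xi>) (act N (last_edge \<Lambda> i \<xi>) a) \<in> carrier (C (n - 1))"
    "gen (n - 1) (face1 \<Lambda> i \<xi>) a \<in> carrier (C (n - 1))"
proof -
  note f = cube_face_src_rng[OF assms(1,3)]
  show 1: "act N (last_edge \<Lambda> i \<xi>) a \<in> carrier (fib N (src \<Lambda> (face0 \<Lambda> i \<xi>)))"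
    using act_closed[OF f(1)] assms(2) f by simp
  show "gen (n - 1) (face0 \<Lambda> i \<xi>) (act N (last_edge \<Lambda> i \<xi>) a) \<in> carrier (C (n - 1))"
    by (rule gen_closed[OF face_cube(1)[OF assms(1,3)] 1])
  show "gen (n - 1) (face1 \<Lambda> i \<xi>) a \<in> carrier (C (n - 1))"
    by (rule gen_closed[OF face_cube(2)[OF assms(1,3)]]) (use assms(2) f in simp)
qed

text \<open>
  The faces of \<open>(\<xi>, s(\<xi>))\<close> are \<open>(F\<^sup>0\<^sub>i(\<xi>), S\<^sub>i(\<xi>))\<close> and
  \<open>(F\<^sup>1\<^sub>i(\<xi>), s(\<xi>))\<close>. Of these the second is again a basis element, and the first
  is the translate of one by \<open>S\<^sub>i(\<xi>)\<close>, which then acts on the coefficient.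
\<close>
lemma boundary_of_generator:
  assumes \<phi>: "\<phi> \<in> hom (C (n - 1)) (T (n - 1))"
    "\<And>\<xi> a. \<xi> \<in> cubes k \<Lambda> (n - 1) \<Longrightarrow> a \<in> carrier (fib N (src \<Lambda> \<xi>)) \<Longrightarrow>
      \<phi> (gen (n - 1) \<xi> a) = pure (n - 1) (src \<Lambda> \<xi>) (frag_of (\<xi>, src \<Lambda> \<xi>)) a"
    and \<xi>: "\<xi> \<in> cubes k \<Lambda> n" and a: "a \<in> carrier (fib N (src \<Lambda> \<xi>))"
  shows "\<phi> (cub_boundary_gen k \<Lambda> N n \<xi> a) =
    ZQ_tensor_boundary k \<Lambda> N n (pure n (src \<Lambda> \<xi>) (frag_of (\<xi>, src \<Lambda> \<xi>)) a)"
proof -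
  interpret T': tensor_product k \<Lambda> "Q (n - 1)" N by (rule tensor_product_ZQ)
  note cl = cub_boundary_gen_closed[OF \<xi> a]
  let ?v = "src \<Lambda> \<xi>"
  have v: "?v \<in> obj \<Lambda>" using cube_src_obj[OF \<xi>] .
  have p: "(\<xi>, ?v) \<in> cubes k (tilde_graph \<Lambda> ?v) n" using basis_cube[OF \<xi>] .
  have ab: "comm_group (fib (Q (n - 1)) ?v)" by (simp add: abelian_free_Abelian_group)
  note pf = tilde_face_cube[OF p]
  have pure_face: "pure (n - 1) ?v (frag_of (\<eta>, \<mu>)) a \<in> carrier (T (n - 1))"
    if "(\<eta>, \<mu>) \<in> cubes k (tilde_graph \<Lambda> ?v) (n - 1)" for \<eta> \<mu>
    by (rule T'.pure_closed[OF v _ a]) (use that in simp)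
  have "ZQ_tensor_boundary k \<Lambda> N n (pure n ?v (frag_of (\<xi>, ?v)) a) =
      pure (n - 1) ?v (ZQ_boundary \<Lambda> n ?v (frag_of (\<xi>, ?v))) a"
    unfolding ZQ_tensor_boundary_def
    by (rule tensor_map_properties(2)[OF k_graph_axioms right_module_ZQ right_module_ZQ N module_map_ZQ_boundary v _ a])
      (use p in simp)
  also have "\<dots> = alternating_product (T (n - 1)) (nat n)
      (\<lambda>i. pure (n - 1) ?v (frag_of (face0 \<Lambda> i \<xi>, cmp \<Lambda> (last_edge \<Lambda> i \<xi>) ?v)) a)
      (\<lambda>i. pure (n - 1) ?v (frag_of (face1 \<Lambda> i \<xi>, ?v)) a)"
    unfolding ZQ_boundary_frag_of[OF p]
    by (rule hom_alternating_product[OF ab T'.comm_group_tensor T'.pure_hom_left[OF v a]]) (use pf in auto)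
  also have "\<dots> = alternating_product (T (n - 1)) (nat n)
      (\<lambda>i. \<phi> (gen (n - 1) (face0 \<Lambda> i \<xi>) (act N (last_edge \<Lambda> i \<xi>) a)))
      (\<lambda>i. \<phi> (gen (n - 1) (face1 \<Lambda> i \<xi>) a))"
  proof (rule alternating_product_cong[OF T'.comm_group_tensor])
    fix i assume i: "i \<in> {1..nat n}"
    note f = cube_face_src_rng[OF \<xi> i]
    have "cmp \<Lambda> (last_edge \<Lambda> i \<xi>) ?v = last_edge \<Lambda> i \<xi>" using cmp_src[OF f(1)] f(3) by simp
    then show "pure (n - 1) ?v (frag_of (face0 \<Lambda> i \<xi>, cmp \<Lambda> (last_edge \<Lambda> i \<xi>) ?v)) a =
        \<phi> (gen (n - 1) (face0 \<Lambda> i \<xi>) (act N (last_edge \<Lambda> i \<xi>) a))"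
      using pure_cube[OF pf(1)[OF i] a] \<phi>(2)[OF face_cube(1)[OF \<xi> i] cl(1)[OF i]] by simp
    show "pure (n - 1) ?v (frag_of (face1 \<Lambda> i \<xi>, ?v)) a = \<phi> (gen (n - 1) (face1 \<Lambda> i \<xi>) a)"
      using \<phi>(2)[OF face_cube(2)[OF \<xi> i], of a] a f by simp
  qed (use cl hom_in_carrier[OF \<phi>(1)] in auto)
  also have "\<dots> = \<phi> (cub_boundary_gen k \<Lambda> N n \<xi> a)"
    unfolding cub_boundary_gen_eq
    by (rule hom_alternating_product[symmetric, OF comm_group_chains T'.comm_group_tensor \<phi>(1)]) (use cl in auto)
  finally show ?thesis ..
qed

text \<open>
  The boundary of a chain is the product of the boundaries of its components, so
  \<open>boundary_of_generator\<close> extends to all chains without knowing beforehand that the boundary is a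
  homomorphism.
\<close>
lemma chains_isomorphic:
  "chain_isomorphic C (cub_boundary k \<Lambda> N) (ZQ_tensor k \<Lambda> N) (ZQ_tensor_boundary k \<Lambda> N)"
proof -
  have "\<exists>\<phi>. \<forall>n. \<phi> n \<in> iso (C n) (T n) \<and> (\<forall>\<xi> \<in> cubes k \<Lambda> n. \<forall>a \<in> carrier (fib N (src \<Lambda> \<xi>)).
      \<phi> n (gen n \<xi> a) = pure n (src \<Lambda> \<xi>) (frag_of (\<xi>, src \<Lambda> \<xi>)) a)"
    by (rule choice) (meson chains_iso_tensor)
  then obtain \<phi> where iso: "\<phi> n \<in> iso (C n) (T n)"
    and \<phi>_gen: "\<xi> \<in> cubes k \<Lambda> n \<Longrightarrow> a \<in> carrier (fib N (src \<Lambda> \<xi>)) \<Longrightarrow>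
      \<phi> n (gen n \<xi> a) = pure n (src \<Lambda> \<xi>) (frag_of (\<xi>, src \<Lambda> \<xi>)) a" for n \<xi> a by blast
  have \<phi>: "\<phi> n \<in> hom (C n) (T n)" for n using iso by (simp add: iso_def)
  have C: "comm_group (C n)" and T: "comm_group (T n)" for n
    using comm_group_chains tensor_product.comm_group_tensor[OF tensor_product_ZQ] by auto
  let ?d = "ZQ_tensor_boundary k \<Lambda> N"
  have d: "?d n \<in> hom (T n) (T (n - 1))" for n
    using chain_complex_tensor by (simp add: chain_complex_def ZQ_tensor_def)
  have coeff: "x \<xi> \<in> carrier (fib N (src \<Lambda> \<xi>))" if "x \<in> carrier (C n)" "\<xi> \<in> cubes k \<Lambda> n" for n x \<xi>
    using that by (auto simp: cub_chains_def carrier_sum_group comm_group.axioms(2)[OF comm_group_summand] PiE_iff)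
  have bg: "cub_boundary_gen k \<Lambda> N n \<xi> a \<in> carrier (C (n - 1))"
    if "\<xi> \<in> cubes k \<Lambda> n" "a \<in> carrier (fib N (src \<Lambda> \<xi>))" for n \<xi> a
    unfolding cub_boundary_gen_eq
    by (rule alternating_product_closed[OF C]) (use cub_boundary_gen_closed[OF that] in auto)
  show ?thesis
  proof (rule chain_isomorphicI[OF C chain_complex_tensor])
    show "\<phi> n \<in> iso (C n) (ZQ_tensor k \<Lambda> N n)" for n using iso by (simp add: ZQ_tensor_def)
    fix n x assume x: "x \<in> carrier (C n)"
    let ?S = "{\<xi> \<in> cubes k \<Lambda> n. x \<xi> \<noteq> \<one>\<^bsub>fib N (src \<Lambda> \<xi>)\<^esub>}"
    have bg_x: "(\<lambda>\<xi>. cub_boundary_gen k \<Lambda> N n \<xi> (x \<xi>)) \<in> ?S \<rightarrow> carrier (C (n - 1))"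
      using bg coeff[OF x] by auto
    show "cub_boundary k \<Lambda> N n x \<in> carrier (C (n - 1))"
      unfolding cub_boundary_def by (rule comm_monoid.finprod_closed[OF comm_group.axioms(1)[OF C] bg_x])
    have "\<phi> (n - 1) (cub_boundary k \<Lambda> N n x) =
        finprod (T (n - 1)) (\<lambda>\<xi>. \<phi> (n - 1) (cub_boundary_gen k \<Lambda> N n \<xi> (x \<xi>))) ?S"
      unfolding cub_boundary_def by (rule hom_finprod[OF C T \<phi> bg_x])
    also have "\<dots> = finprod (T (n - 1)) (\<lambda>\<xi>. (?d n \<circ> \<phi> n) (gen n \<xi> (x \<xi>))) ?S"
    proof (rule comm_monoid.finprod_cong'[OF comm_group.axioms(1)[OF T] refl])
      show "(\<lambda>\<xi>. (?d n \<circ> \<phi> n) (gen n \<xi> (x \<xi>))) \<in> ?S \<rightarrow> carrier (T (n - 1))"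
        using gen_closed coeff[OF x] hom_in_carrier[OF hom_compose[OF \<phi> d]] by auto
      fix \<xi> assume "\<xi> \<in> ?S"
      then have \<xi>: "\<xi> \<in> cubes k \<Lambda> n" by simp
      show "\<phi> (n - 1) (cub_boundary_gen k \<Lambda> N n \<xi> (x \<xi>)) = (?d n \<circ> \<phi> n) (gen n \<xi> (x \<xi>))"
        using boundary_of_generator[OF \<phi> \<phi>_gen \<xi> coeff[OF x \<xi>]] \<phi>_gen[OF \<xi> coeff[OF x \<xi>]] by simp
    qed
    also have "\<dots> = (?d n \<circ> \<phi> n) x"
      unfolding cub_gen_eq
      by (rule hom_sum_group_expansion[where I = "cubes k \<Lambda> n" and G = "\<lambda>\<xi>. fib N (src \<Lambda> \<xi>)"
            and H = "T (n - 1)" and h = "?d n \<circ> \<phi> n" and x = x, symmetric])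
        (use comm_group_summand T hom_compose[OF \<phi>[of n] d] x in \<open>auto simp: cub_chains_def\<close>)
    finally show "\<phi> (n - 1) (cub_boundary k \<Lambda> N n x) = ?d n (\<phi> n x)" by simp
  qed
qed

end

section \<open>Cochains with coefficients\<close>
locale right_module_kgraph = k_graph k \<Lambda> for k :: nat and \<Lambda> :: "'a kgraph" +
  fixes M :: "('a, 'm) gmodule"
  assumes M: "right_module \<Lambda> M"
begin

abbreviation "C \<equiv> cub_cochains k \<Lambda> M"
abbreviation "Q \<equiv> ZQ k \<Lambda>"
abbreviation "D \<equiv> ZQ_Hom k \<Lambda> M"

lemma module_pair_ZQ: "module_pair k \<Lambda> (Q n) M"
  by unfold_locales (rule right_module_ZQ, rule M)

lemma comm_group_factor: "\<xi> \<in> cubes k \<Lambda> n \<Longrightarrow> comm_group (fib M (src \<Lambda> \<xi>))"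
  using right_moduleD(1)[OF M cube_src_obj] .

lemma comm_group_cochains: "comm_group (C n)"
  unfolding cub_cochains_def by (rule comm_group_product_group) (rule comm_group_factor)

lemma cochain_complex_ZQ_Hom: "cochain_complex D (ZQ_Hom_coboundary k \<Lambda>)"
  unfolding cochain_complex_def
proof (intro allI conjI ballI)
  fix n
  interpret H: module_pair k \<Lambda> "Q n" M by (rule module_pair_ZQ)
  interpret H2: module_pair k \<Lambda> "Q (n + 1 + 1)" M by (rule module_pair_ZQ)
  let ?d = "ZQ_Hom_coboundary k \<Lambda>"
  show "comm_group (D n)" unfolding ZQ_Hom_def by (rule H.comm_group_right_Hom)
  have mm: "module_map \<Lambda> (Q (n + 1)) (Q n) (ZQ_boundary \<Lambda> (n + 1))" for n
    using module_map_ZQ_boundary[of "n + 1"] by simp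
  show d: "?d n \<in> hom (D n) (D (n + 1))" for n
    unfolding ZQ_Hom_def ZQ_Hom_coboundary_def
    by (rule Hom_precomp_hom[OF k_graph_axioms right_module_ZQ right_module_ZQ M mm])
  fix f assume f: "f \<in> carrier (D n)"
  have ddf: "?d (n + 1) (?d n f) \<in> carrier (D (n + 1 + 1))"
    by (rule hom_in_carrier[OF d hom_in_carrier[OF d f]])
  show "?d (n + 1) (?d n f) = \<one>\<^bsub>D (n + 1 + 1)\<^esub>"
  proof (rule H2.right_Hom_eqI)
    show "?d (n + 1) (?d n f) \<in> carrier H2.H" using ddf by (simp only: ZQ_Hom_def)
    show "\<one>\<^bsub>D (n + 1 + 1)\<^esub> \<in> carrier H2.H"
      unfolding ZQ_Hom_def using comm_groupE(2)[OF H2.comm_group_right_Hom] .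
    fix v x assume v: "v \<in> obj \<Lambda>" and x: "x \<in> carrier (fib (Q (n + 1 + 1)) v)"
    have x': "ZQ_boundary \<Lambda> (n + 1 + 1) v x \<in> carrier (fib (Q (n + 1)) v)"
      by (rule hom_in_carrier[OF module_mapD(1)[OF mm v] x])
    have "?d (n + 1) (?d n f) v x = f v (ZQ_boundary \<Lambda> (n + 1) v (ZQ_boundary \<Lambda> (n + 1 + 1) v x))"
      unfolding ZQ_Hom_coboundary_def Hom_precomp_def restrict_apply' [OF v] restrict_apply'[OF x] restrict_apply'[OF x'] ..
    also have "ZQ_boundary \<Lambda> (n + 1) v (ZQ_boundary \<Lambda> (n + 1 + 1) v x) = \<one>\<^bsub>fib (Q n) v\<^esub>"
      using ZQ_boundary_ZQ_boundary[OF v x]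
      by (simp only: add_diff_cancel_right' fib_ZQ one_free_Abelian_group)
    also have "f v \<one>\<^bsub>fib (Q n) v\<^esub> = \<one>\<^bsub>fib M v\<^esub>"
      by (rule hom_one[OF module_mapD(1)[OF H.right_Hom_module_map v]])
        (use f v in \<open>auto simp: ZQ_Hom_def comm_group.axioms(2)[OF H.comm_group_fib]\<close>)
    also have "\<dots> = \<one>\<^bsub>D (n + 1 + 1)\<^esub> v x"
      unfolding ZQ_Hom_def H2.right_Hom_one restrict_apply' [OF v] restrict_apply'[OF x] ..
    finally show "?d (n + 1) (?d n f) v x = \<one>\<^bsub>D (n + 1 + 1)\<^esub> v x" .
  qed
qed

definition eval_cubes :: "int \<Rightarrow> ('a \<Rightarrow> (('a \<times> 'a) \<Rightarrow>\<^sub>0 int) \<Rightarrow> 'm) \<Rightarrow> 'a \<Rightarrow> 'm" where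
  "eval_cubes n f = (\<lambda>\<xi>\<in>cubes k \<Lambda> n. f (src \<Lambda> \<xi>) (frag_of (\<xi>, src \<Lambda> \<xi>)))"

lemma module_map_on_cube:
  assumes "module_map \<Lambda> (Q n) M f" "(\<eta>, \<mu>) \<in> cubes k (tilde_graph \<Lambda> v) n"
  shows "f v (frag_of (\<eta>, \<mu>)) = act M \<mu> (f (src \<Lambda> \<eta>) (frag_of (\<eta>, src \<Lambda> \<eta>)))"
proof -
  have c: "\<eta> \<in> cubes k \<Lambda> n" "\<mu> \<in> mor \<Lambda>" "src \<Lambda> \<mu> = v" "rng \<Lambda> \<mu> = src \<Lambda> \<eta>"
    using assms by (auto simp: tilde_cube_iff composable_def)
  have "f (src \<Lambda> \<mu>) (act (Q n) \<mu> (frag_of (\<eta>, src \<Lambda> \<eta>))) = act M \<mu> (f (rng \<Lambda> \<mu>) (frag_of (\<eta>, src \<Lambda> \<eta>)))"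
    by (rule module_mapD(2)[OF assms(1) c(2)]) (use c basis_cube in auto)
  then show ?thesis using tilde_cube_act[OF assms(2), of n] c by simp
qed

text \<open>
  The required value on \<open>(\<eta>, \<mu>)\<close> is \<open>g(\<eta>) \<cdot> \<mu>\<close>. Extending
  linearly in each fibre gives a family of homomorphisms, and naturality on the pairs is the
  associativity of the action on \<open>M\<close>.
\<close>
lemma extend_from_cubes:
  assumes g: "\<And>\<xi>. \<xi> \<in> cubes k \<Lambda> n \<Longrightarrow> g \<xi> \<in> carrier (fib M (src \<Lambda> \<xi>))"
  obtains f where "module_map \<Lambda> (Q n) M f"
    "\<And>\<xi>. \<xi> \<in> cubes k \<Lambda> n \<Longrightarrow> f (src \<Lambda> \<xi>) (frag_of (\<xi>, src \<Lambda> \<xi>)) = g \<xi>"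
proof -
  have act: "act M \<mu> (g \<eta>) \<in> carrier (fib M v)" if "(\<eta>, \<mu>) \<in> cubes k (tilde_graph \<Lambda> v) n" for \<eta> \<mu> v
    using hom_in_carrier[OF right_moduleD(2)[OF M], of \<mu>] g[of \<eta>] that by (auto simp: tilde_cube_iff composable_def)
  have "\<exists>h. v \<in> obj \<Lambda> \<longrightarrow> h \<in> hom (fib (Q n) v) (fib M v) \<and>
    (\<forall>(\<eta>, \<mu>) \<in> cubes k (tilde_graph \<Lambda> v) n. h (frag_of (\<eta>, \<mu>)) = act M \<mu> (g \<eta>))" for v
  proof (cases "v \<in> obj \<Lambda>")
    case True
    have "(\<lambda>(\<eta>, \<mu>). act M \<mu> (g \<eta>)) ` cubes k (tilde_graph \<Lambda> v) n \<subseteq> carrier (fib M v)"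
      using act by auto
    then obtain h where "h \<in> hom (free_Abelian_group (cubes k (tilde_graph \<Lambda> v) n)) (fib M v)"
      "\<And>p. p \<in> cubes k (tilde_graph \<Lambda> v) n \<Longrightarrow> h (frag_of p) = (\<lambda>(\<eta>, \<mu>). act M \<mu> (g \<eta>)) p"
      using comm_group.free_Abelian_group_universal[OF right_moduleD(1)[OF M True]] by blast
    then show ?thesis by (intro exI[of _ h]) auto
  qed simp
  then obtain f where f0: "\<forall>v. v \<in> obj \<Lambda> \<longrightarrow> f v \<in> hom (fib (Q n) v) (fib M v) \<and>
      (\<forall>(\<eta>, \<mu>) \<in> cubes k (tilde_graph \<Lambda> v) n. f v (frag_of (\<eta>, \<mu>)) = act M \<mu> (g \<eta>))"
    using choice[of "\<lambda>v h. v \<in> obj \<Lambda> \<longrightarrow> h \<in> hom (fib (Q n) v) (fib M v) \<and>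
      (\<forall>(\<eta>, \<mu>) \<in> cubes k (tilde_graph \<Lambda> v) n. h (frag_of (\<eta>, \<mu>)) = act M \<mu> (g \<eta>))"] by blast
  have f: "f v \<in> hom (fib (Q n) v) (fib M v)" if "v \<in> obj \<Lambda>" for v using f0 that by blast
  have f_cube: "f v (frag_of (\<eta>, \<mu>)) = act M \<mu> (g \<eta>)"
    if "v \<in> obj \<Lambda>" "(\<eta>, \<mu>) \<in> cubes k (tilde_graph \<Lambda> v) n" for v \<eta> \<mu> using f0 that by blast
  show thesis
  proof (rule that)
    show "module_map \<Lambda> (Q n) M f"
    proof (rule module_mapI)
      show "f v \<in> hom (fib (Q n) v) (fib M v)" if "v \<in> obj \<Lambda>" for v using f[OF that] .
      fix \<xi> x assume \<xi>: "\<xi> \<in> mor \<Lambda>" and x: "x \<in> carrier (fib (Q n) (rng \<Lambda> \<xi>))"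
      have v: "src \<Lambda> \<xi> \<in> obj \<Lambda>" "rng \<Lambda> \<xi> \<in> obj \<Lambda>" using src_obj rng_obj \<xi> by auto
      have "(f (src \<Lambda> \<xi>) \<circ> act (Q n) \<xi>) x = (act M \<xi> \<circ> f (rng \<Lambda> \<xi>)) x"
      proof (rule hom_free_Abelian_group_eqI[OF comm_group.axioms(2)[OF right_moduleD(1)[OF M v(1)]]
              hom_compose[OF right_moduleD(2)[OF right_module_ZQ \<xi>] f[OF v(1)], unfolded fib_ZQ]
              hom_compose[OF f[OF v(2)] right_moduleD(2)[OF M \<xi>], unfolded fib_ZQ] _ x[unfolded fib_ZQ]])
        fix p assume p: "p \<in> cubes k (tilde_graph \<Lambda> (rng \<Lambda> \<xi>)) n"
        obtain \<eta> \<mu> where e: "p = (\<eta>, \<mu>)" by (cases p)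
        note p = p[unfolded e]
        have c: "\<eta> \<in> cubes k \<Lambda> n" "composable \<Lambda> \<eta> \<mu>" "composable \<Lambda> \<mu> \<xi>"
          using p \<xi> by (auto simp: tilde_cube_iff composable_def)
        have p': "(\<eta>, cmp \<Lambda> \<mu> \<xi>) \<in> cubes k (tilde_graph \<Lambda> (src \<Lambda> \<xi>)) n"
          using c composable_cmp_right src_cmp by (simp add: tilde_cube_iff)
        have "g \<eta> \<in> carrier (fib M (rng \<Lambda> \<mu>))" using g[OF c(1)] composableD(3)[OF c(2)] by simp
        then show "(f (src \<Lambda> \<xi>) \<circ> act (Q n) \<xi>) (frag_of p) = (act M \<xi> \<circ> f (rng \<Lambda> \<xi>)) (frag_of p)"
          using right_moduleD(4)[OF M c(3)] by (simp add: e f_cube[OF v(1) p'] f_cube[OF v(2) p])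
      qed
      then show "f (src \<Lambda> \<xi>) (act (Q n) \<xi> x) = act M \<xi> (f (rng \<Lambda> \<xi>) x)" by simp
    qed
    show "f (src \<Lambda> \<xi>) (frag_of (\<xi>, src \<Lambda> \<xi>)) = g \<xi>" if "\<xi> \<in> cubes k \<Lambda> n" for \<xi>
      using f_cube[OF cube_src_obj[OF that] basis_cube[OF that]]
        right_moduleD(3)[OF M cube_src_obj[OF that] g[OF that]] by simp
  qed
qed

text \<open>
  A Yoneda argument: a module map is determined by its values on the basis elements
  \<open>(\<xi>, s(\<xi>))\<close>, and these values are arbitrary.
\<close>
lemma eval_cubes_iso: "eval_cubes n \<in> iso (D n) (C n)"
proof -
  interpret H: module_pair k \<Lambda> "Q n" M by (rule module_pair_ZQ)
  have basis: "frag_of (\<xi>, src \<Lambda> \<xi>) \<in> carrier (fib (Q n) (src \<Lambda> \<xi>))" if "\<xi> \<in> cubes k \<Lambda> n" for \<xi>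
    using basis_cube[OF that] by simp
  have "eval_cubes n \<in> hom (D n) (C n)"
  proof (rule homI)
    show "eval_cubes n f \<in> carrier (C n)" if "f \<in> carrier (D n)" for f
      using that H.right_Hom_closed cube_src_obj basis
      by (auto simp: eval_cubes_def cub_cochains_def ZQ_Hom_def simp del: fib_ZQ)
    show "eval_cubes n (f \<otimes>\<^bsub>D n\<^esub> g) = eval_cubes n f \<otimes>\<^bsub>C n\<^esub> eval_cubes n g" for f g
      unfolding eval_cubes_def cub_cochains_def ZQ_Hom_def H.right_Hom_mult mult_product_group
      by (rule restrict_ext) (use cube_src_obj basis in \<open>simp del: fib_ZQ\<close>)
  qed
  moreover have "inj_on (eval_cubes n) (carrier (D n))"
  proof (rule inj_onI)
    fix f g assume f: "f \<in> carrier (D n)" and g: "g \<in> carrier (D n)" and eq: "eval_cubes n f = eval_cubes n g"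
    have mf: "module_map \<Lambda> (Q n) M f" and mg: "module_map \<Lambda> (Q n) M g"
      using f g H.right_Hom_module_map by (auto simp: ZQ_Hom_def)
    show "f = g"
    proof (rule H.right_Hom_eqI)
      show "f \<in> carrier H.H" "g \<in> carrier H.H" using f g by (simp_all add: ZQ_Hom_def)
      fix v x assume v: "v \<in> obj \<Lambda>" and x: "x \<in> carrier (fib (Q n) v)"
      show "f v x = g v x"
      proof (rule hom_free_Abelian_group_eqI[OF comm_group.axioms(2)[OF H.comm_group_fib[OF v]]
              module_mapD(1)[OF mf v, unfolded fib_ZQ] module_mapD(1)[OF mg v, unfolded fib_ZQ] _ x[unfolded fib_ZQ]])
        fix p assume p: "p \<in> cubes k (tilde_graph \<Lambda> v) n"
        obtain \<eta> \<mu> where e: "p = (\<eta>, \<mu>)" by (cases p)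
        have "\<eta> \<in> cubes k \<Lambda> n" using p e by (simp add: tilde_cube_iff)
        then have "f (src \<Lambda> \<eta>) (frag_of (\<eta>, src \<Lambda> \<eta>)) = g (src \<Lambda> \<eta>) (frag_of (\<eta>, src \<Lambda> \<eta>))"
          using fun_cong[OF eq, of \<eta>] by (simp add: eval_cubes_def)
        then show "f v (frag_of p) = g v (frag_of p)"
          using module_map_on_cube[OF mf p[unfolded e]] module_map_on_cube[OF mg p[unfolded e]] by (simp add: e)
      qed
    qed
  qed
  moreover have "g \<in> eval_cubes n ` carrier (D n)" if g: "g \<in> carrier (C n)" for g
  proof -
    have "g \<xi> \<in> carrier (fib M (src \<Lambda> \<xi>))" if "\<xi> \<in> cubes k \<Lambda> n" for \<xi>
      using g that by (auto simp: cub_cochains_def)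
    then obtain f where f: "module_map \<Lambda> (Q n) M f"
      "\<And>\<xi>. \<xi> \<in> cubes k \<Lambda> n \<Longrightarrow> f (src \<Lambda> \<xi>) (frag_of (\<xi>, src \<Lambda> \<xi>)) = g \<xi>"
      using extend_from_cubes by blast
    let ?f = "\<lambda>v\<in>obj \<Lambda>. \<lambda>x\<in>carrier (fib (Q n) v). f v x"
    have "?f \<in> carrier (D n)"
      unfolding ZQ_Hom_def by (rule H.restrict_in_right_Hom[OF f(1)])
    moreover have "g = eval_cubes n ?f"
    proof (rule extensionalityI[where A = "cubes k \<Lambda> n"])
      show "g \<in> extensional (cubes k \<Lambda> n)" using g by (auto simp: cub_cochains_def PiE_def)
      show "g \<xi> = eval_cubes n ?f \<xi>" if "\<xi> \<in> cubes k \<Lambda> n" for \<xi>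
        using that f(2) cube_src_obj basis by (simp add: eval_cubes_def del: fib_ZQ)
    qed (simp add: eval_cubes_def)
    ultimately show ?thesis by blast
  qed
  ultimately show ?thesis by (auto simp: iso_iff hom_def)
qed

lemma cub_coboundary_apply:
  assumes "\<xi> \<in> cubes k \<Lambda> (n + 1)"
  shows "cub_coboundary k \<Lambda> M n f \<xi> = alternating_product (fib M (src \<Lambda> \<xi>)) (nat (n + 1))
    (\<lambda>i. act M (last_edge \<Lambda> i \<xi>) (f (face0 \<Lambda> i \<xi>))) (\<lambda>i. f (face1 \<Lambda> i \<xi>))"
  using assms by (simp add: cub_coboundary_def alternating_product_def Let_def)

lemma eval_cubes_coboundary:
  assumes f: "f \<in> carrier (D n)"
  shows "eval_cubes (n + 1) (ZQ_Hom_coboundary k \<Lambda> n f) = cub_coboundary k \<Lambda> M n (eval_cubes n f)"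
proof (rule extensionalityI[where A = "cubes k \<Lambda> (n + 1)"])
  show "eval_cubes (n + 1) (ZQ_Hom_coboundary k \<Lambda> n f) \<in> extensional (cubes k \<Lambda> (n + 1))"
    "cub_coboundary k \<Lambda> M n (eval_cubes n f) \<in> extensional (cubes k \<Lambda> (n + 1))"
    by (simp_all add: eval_cubes_def cub_coboundary_def)
  fix \<xi> assume \<xi>: "\<xi> \<in> cubes k \<Lambda> (n + 1)"
  interpret H: module_pair k \<Lambda> "Q n" M by (rule module_pair_ZQ)
  let ?v = "src \<Lambda> \<xi>"
  have v: "?v \<in> obj \<Lambda>" using cube_src_obj[OF \<xi>] .
  have p: "(\<xi>, ?v) \<in> cubes k (tilde_graph \<Lambda> ?v) (n + 1)" using basis_cube[OF \<xi>] .
  have ab: "comm_group (fib (Q n) ?v)" by (simp add: abelian_free_Abelian_group)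
  have pf: "(face0 \<Lambda> i \<xi>, cmp \<Lambda> (last_edge \<Lambda> i \<xi>) ?v) \<in> cubes k (tilde_graph \<Lambda> ?v) n"
    "(face1 \<Lambda> i \<xi>, ?v) \<in> cubes k (tilde_graph \<Lambda> ?v) n"
    "face0 \<Lambda> i \<xi> \<in> cubes k \<Lambda> n" "face1 \<Lambda> i \<xi> \<in> cubes k \<Lambda> n" if "i \<in> {1..nat (n + 1)}" for i
    using tilde_face_cube[OF p that] face_cube[OF \<xi> that] by simp_all
  have mf: "module_map \<Lambda> (Q n) M f" using f H.right_Hom_module_map by (simp add: ZQ_Hom_def)
  have ev: "eval_cubes n f \<eta> = f (src \<Lambda> \<eta>) (frag_of (\<eta>, src \<Lambda> \<eta>))" if "\<eta> \<in> cubes k \<Lambda> n" for \<eta>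
    using that by (simp add: eval_cubes_def)
  have f_closed: "f (src \<Lambda> \<eta>) (frag_of (\<eta>, src \<Lambda> \<eta>)) \<in> carrier (fib M (src \<Lambda> \<eta>))" if "\<eta> \<in> cubes k \<Lambda> n" for \<eta>
    by (rule hom_in_carrier[OF module_mapD(1)[OF mf cube_src_obj[OF that]]]) (use basis_cube[OF that] in simp)
  have "eval_cubes (n + 1) (ZQ_Hom_coboundary k \<Lambda> n f) \<xi> = f ?v (ZQ_boundary \<Lambda> (n + 1) ?v (frag_of (\<xi>, ?v)))"
    using \<xi> v p by (simp add: eval_cubes_def ZQ_Hom_coboundary_def Hom_precomp_def)
  also have "\<dots> = alternating_product (fib M ?v) (nat (n + 1))
      (\<lambda>i. f ?v (frag_of (face0 \<Lambda> i \<xi>, cmp \<Lambda> (last_edge \<Lambda> i \<xi>) ?v))) (\<lambda>i. f ?v (frag_of (face1 \<Lambda> i \<xi>, ?v)))"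
    unfolding ZQ_boundary_frag_of[OF p] add_diff_cancel_right'
    by (rule hom_alternating_product[OF ab H.comm_group_fib[OF v] module_mapD(1)[OF mf v]]) (use pf in auto)
  also have "\<dots> = alternating_product (fib M ?v) (nat (n + 1))
      (\<lambda>i. act M (last_edge \<Lambda> i \<xi>) (eval_cubes n f (face0 \<Lambda> i \<xi>))) (\<lambda>i. eval_cubes n f (face1 \<Lambda> i \<xi>))"
  proof (rule alternating_product_cong[OF H.comm_group_fib[OF v]])
    show "(\<lambda>i. act M (last_edge \<Lambda> i \<xi>) (eval_cubes n f (face0 \<Lambda> i \<xi>))) \<in> {1..nat (n + 1)} \<rightarrow> carrier (fib M ?v)"
    proof
      fix i assume i: "i \<in> {1..nat (n + 1)}"
      show "act M (last_edge \<Lambda> i \<xi>) (eval_cubes n f (face0 \<Lambda> i \<xi>)) \<in> carrier (fib M ?v)"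
        using hom_in_carrier[OF right_moduleD(2)[OF M cube_face_src_rng(1)[OF \<xi> i]]] f_closed[OF pf(3)[OF i]]
          cube_face_src_rng[OF \<xi> i] by (simp add: ev[OF pf(3)[OF i]])
    qed
    show "(\<lambda>i. eval_cubes n f (face1 \<Lambda> i \<xi>)) \<in> {1..nat (n + 1)} \<rightarrow> carrier (fib M ?v)"
    proof
      fix i assume i: "i \<in> {1..nat (n + 1)}"
      show "eval_cubes n f (face1 \<Lambda> i \<xi>) \<in> carrier (fib M ?v)"
        using f_closed[OF pf(4)[OF i]] cube_face_src_rng(4)[OF \<xi> i] by (simp add: ev[OF pf(4)[OF i]])
    qed
    fix i assume i: "i \<in> {1..nat (n + 1)}"
    note e = cube_face_src_rng[OF \<xi> i]
    have "cmp \<Lambda> (last_edge \<Lambda> i \<xi>) ?v = last_edge \<Lambda> i \<xi>" using cmp_src[OF e(1)] e(3) by simp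
    then show "f ?v (frag_of (face0 \<Lambda> i \<xi>, cmp \<Lambda> (last_edge \<Lambda> i \<xi>) ?v)) =
        act M (last_edge \<Lambda> i \<xi>) (eval_cubes n f (face0 \<Lambda> i \<xi>))"
      using module_map_on_cube[OF mf pf(1)[OF i]] ev[OF pf(3)[OF i]] by simp
    show "f ?v (frag_of (face1 \<Lambda> i \<xi>, ?v)) = eval_cubes n f (face1 \<Lambda> i \<xi>)"
      using ev[OF pf(4)[OF i]] e(4) by simp
  qed
  also have "\<dots> = cub_coboundary k \<Lambda> M n (eval_cubes n f) \<xi>"
    by (rule cub_coboundary_apply[OF \<xi>, symmetric])
  finally show "eval_cubes (n + 1) (ZQ_Hom_coboundary k \<Lambda> n f) \<xi> = cub_coboundary k \<Lambda> M n (eval_cubes n f) \<xi>" .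
qed

lemma cochains_isomorphic:
  "cochain_isomorphic C (cub_coboundary k \<Lambda> M) D (ZQ_Hom_coboundary k \<Lambda>)"
proof (rule cochain_isomorphicI[where \<psi> = eval_cubes])
  show "comm_group (C n)" "eval_cubes n \<in> iso (D n) (C n)" for n
    by (rule comm_group_cochains, rule eval_cubes_iso)
  show "cochain_complex D (ZQ_Hom_coboundary k \<Lambda>)" by (rule cochain_complex_ZQ_Hom)
  show "eval_cubes (n + 1) (ZQ_Hom_coboundary k \<Lambda> n f) = cub_coboundary k \<Lambda> M n (eval_cubes n f)"
    if "f \<in> carrier (D n)" for n f
    by (rule eval_cubes_coboundary[OF that])
qed

end

section \<open>Comparison of the complexes\<close>
theorem proposition4p7:
  fixes k :: nat and \<Lambda> :: "'a kgraph"
    and N :: "('a, 'n) gmodule" and M :: "('a, 'm) gmodule"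
  assumes "k_graph k \<Lambda>" and "left_module \<Lambda> N" and "right_module \<Lambda> M"
  shows "chain_isomorphic
           (cub_chains k \<Lambda> N) (cub_boundary k \<Lambda> N)
           (ZQ_tensor k \<Lambda> N) (ZQ_tensor_boundary k \<Lambda> N)
       \<and> cochain_isomorphic
           (cub_cochains k \<Lambda> M) (cub_coboundary k \<Lambda> M)
           (ZQ_Hom k \<Lambda> M) (ZQ_Hom_coboundary k \<Lambda>)"
proof
  interpret k_graph k \<Lambda> by fact
  interpret N: left_module_kgraph k \<Lambda> N by unfold_locales fact
  interpret M: right_module_kgraph k \<Lambda> M by unfold_locales fact
  show "chain_isomorphic (cub_chains k \<Lambda> N) (cub_boundary k \<Lambda> N) (ZQ_tensor k \<Lambda> N) (ZQ_tensor_boundary k \<Lambda> N)"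
    by (rule N.chains_isomorphic)
  show "cochain_isomorphic (cub_cochains k \<Lambda> M) (cub_coboundary k \<Lambda> M) (ZQ_Hom k \<Lambda> M) (ZQ_Hom_coboundary k \<Lambda>)"
    by (rule M.cochains_isomorphic)
qed

end
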